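(* Let ReducedAboveThreshold be run with an algorithm $\mathrm{Alg}:\mathcal X\to\mathcal Y^\infty$, parameter $\epsilon_{\max}>0$, threshold $\tau\in\mathbb R$, utility $u:\mathcal Y\times\mathcal X\to\mathbb R$ such that $u(\beta,\cdot)$ is $\Delta$-sensitive for every $\beta\in\mathcal Y$ ($\Delta>0$), and privacy functions $(\mathcal E_n)_{n\ge1}$ with $\mathcal E_n\le\epsilon_{\max}$ for all $n$. For $n\ge1$ and neighbors $x\sim x'$, let $\mathcal L^{\mathrm{Alg}}_{1:n}(x,x')$ denote the privacy loss between $\mathrm{Alg}_{1:n}(x)$ and $\mathrm{Alg}_{1:n}(x')$. For $x\in\mathcal X$ let $N(x)$ be the first round at which ReducedAboveThreshold run on input $x$ outputs $1$: $$N(x):=\inf\{n\ge1:\mathrm{ReducedAboveThreshold}_n(x)=1\}.$$ Then for all neighbors $x\sim x'$, the privacy loss $\mathcal L^{\mathrm{RAT}}(x,x')$ between $\mathrm{ReducedAboveThreshold}(x)$ and $\mathrm{ReducedAboveThreshold}(x')$ satisfies, almost surely on $\{N(x)<\infty\}$, $$\mathcal L^{\mathrm{RAT}}(x,x')\le\mathcal L^{\mathrm{Alg}}_{1:N(x)}(x,x')+\mathcal E_{N(x)}\left(\mathrm{Alg}_{1:N(x)-1}(x)\right).$$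
   Context: $\mathcal X$ is a set of databases with an arbitrary neighboring relation $\sim$; $\mathcal Y$ is a (standard Borel) output space. $\mathrm{Alg}$ is a randomized algorithm producing an infinite sequence; $\mathrm{Alg}_n(x)$ is the $n$th element and $\mathrm{Alg}_{1:n}(x)$ the first $n$ elements. $u(\beta,\cdot)$ is $\Delta$-sensitive if $|u(\beta,x)-u(\beta,x')|\le\Delta$ for all $x\sim x'$. Privacy loss: for a randomized algorithm $A$ on $\mathcal X$ with values in a measurable space and $x\sim x'$, let $p^x,p^{x'}$ be the densities of the laws of $A(x),A(x')$ with respect to a common reference measure (e.g. the sum of the two laws). The privacy loss between $A(x)$ and $A(x')$ is the random variable $\mathcal L(x,x')=\log\frac{p^x(A(x))}{p^{x'}(A(x))}$ (defined up to almost sure equality). Privacy functions: a sequence of (measurable) functions $\mathcal E_n:\mathcal Y^{n-1}\to\mathbb R_{>0}$, $n\ge1$, with $\mathcal E_{n+1}(\beta_{1:n})\ge\mathcal E_n(\beta_{1:n-1})$ for all $n$ and $\beta_{1:n}\in\mathcal Y^n$. Laplace process: $\mathrm{Lap}(s)$ is the centered Laplace distribution on $\mathbb R$ with density $\frac1{2s}e^{-|y|/s}$. Given $\eta>0$, $(P_t)_{t\ge\eta}$ is an inhomogeneous Poisson process with intensity $2/t$ and $P_\eta=0$; $\mathcal T_0:=\eta$, $\mathcal T_n:=\inf\{t\ge\eta:P_t\ge n\}$ for $n\ge1$; $Z_t:=\sum_{n=0}^{P_t}Y_n$ where, conditionally on the jump times, the $Y_n\sim\mathrm{Lap}(\mathcal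 T_n)$ are independent. ReducedAboveThreshold on input $x$: set $\eta:=2\Delta/\epsilon_{\max}$ and draw one path of $(Z_t)_{t\ge\eta}$, independent of $\mathrm{Alg}(x)$. For $n=1,2,\dots$: let $\epsilon_n:=\mathcal E_n(\mathrm{Alg}_{1:n-1}(x))$, $T_n:=2\Delta/\epsilon_n$, $\zeta_n:=Z_{T_n}$, and draw $\xi_n\sim\mathrm{Lap}(4\Delta/\epsilon_n)$, independently of everything else given $\epsilon_n$. If $u(\mathrm{Alg}_n(x),x)+\xi_n\ge\tau+\zeta_n$, output $1$ and halt; otherwise output $0$ and continue. The $n$th output bit is $\mathrm{ReducedAboveThreshold}_n(x)$. The iterates $\mathrm{Alg}_n(x)$ examined are also revealed, so the full output of ReducedAboveThreshold on $\{N(x)=n\}$ is $\mathrm{Alg}_{1:n}(x)$ together with the bit string $0^{n-1}1$; the privacy loss $\mathcal L^{\mathrm{RAT}}$ refers to this full output. *)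

theory Defs
  imports "HOL-Probability.Probability"
begin

section \<open>Measure-theoretic preliminaries\<close>

definition standard_borel :: "'a measure \<Rightarrow> bool" where
  "standard_borel M \<longleftrightarrow>
     (\<exists>T. completely_metrizable_space T \<and> separable_space T \<and>
          space M = topspace T \<and> sets M = sigma_sets (topspace T) {U. openin T U})"

definition option_space :: "'a measure \<Rightarrow> 'a option measure" where
  "option_space M =
     sigma (insert None (Some ` space M)) (insert {None} ((\<lambda>A. Some ` A) ` sets M))"

definition laplace :: "real \<Rightarrow> real measure" where
  "laplace s = density lborel (\<lambda>y. ennreal (1 / (2 * s) * exp (- \<bar>y\<bar> / s)))"

text \<open>Conditionally on \<open>X\<close>, the real random variables \<open>V i\<close> (\<open>i \<in> I\<close>) are independent
  and \<open>V i\<close> has law \<open>K i (X)\<close>.  This is the defining property of a regular conditional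
  distribution that is the product of the kernels \<open>K i\<close>, tested on finite cylinders.\<close>

definition cond_indep_law ::
  "'w measure \<Rightarrow> 'a measure \<Rightarrow> ('w \<Rightarrow> 'a) \<Rightarrow> 'i set \<Rightarrow> ('i \<Rightarrow> 'w \<Rightarrow> real)
     \<Rightarrow> ('i \<Rightarrow> 'a \<Rightarrow> real measure) \<Rightarrow> bool" where
  "cond_indep_law M S X I V K \<longleftrightarrow>
     X \<in> measurable M S \<and> (\<forall>i\<in>I. V i \<in> borel_measurable M) \<and>
     (\<forall>A\<in>sets S. \<forall>J B. finite J \<and> J \<subseteq> I \<and> (\<forall>i\<in>J. B i \<in> sets borel) \<longrightarrow>
        emeasure M {\<omega> \<in> space M. X \<omega> \<in> A \<and> (\<forall>i\<in>J. V i \<omega> \<in> B i)} =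
        (\<integral>\<^sup>+\<omega>. indicator A (X \<omega>) * (\<Prod>i\<in>J. emeasure (K i (X \<omega>)) (B i)) \<partial>M))"


section \<open>Privacy loss, sensitivity and privacy functions\<close>

definition sum_measure :: "'a measure \<Rightarrow> 'a measure \<Rightarrow> 'a measure" where
  "sum_measure P Q = measure_of (space P) (sets P) (\<lambda>A. emeasure P A + emeasure Q A)"

definition ennreal_log :: "ennreal \<Rightarrow> ereal" where
  "ennreal_log r = (if r = 0 then -\<infinity> else if r = \<infinity> then \<infinity> else ereal (ln (enn2real r)))"

text \<open>\<open>P\<close> and \<open>Q\<close> are the laws of \<open>A(x)\<close> and \<open>A(x')\<close>.  Their densities are taken with respect
  to the reference measure \<open>P + Q\<close>, and the loss is the following function evaluated at
  \<open>A(x)\<close>.  Where the second density vanishes and the first does not, the loss is \<open>\<infinity>\<close>.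
  The value where the first density vanishes is immaterial, that set being \<open>P\<close>-null.\<close>

definition privacy_loss :: "'a measure \<Rightarrow> 'a measure \<Rightarrow> 'a \<Rightarrow> ereal" where
  "privacy_loss P Q z =
     ennreal_log (RN_deriv (sum_measure P Q) P z / RN_deriv (sum_measure P Q) Q z)"

definition sensitive :: "('x \<Rightarrow> 'x \<Rightarrow> bool) \<Rightarrow> real \<Rightarrow> ('x \<Rightarrow> real) \<Rightarrow> bool" where
  "sensitive nbr \<Delta> f \<longleftrightarrow> (\<forall>x x'. nbr x x' \<longrightarrow> \<bar>f x - f x'\<bar> \<le> \<Delta>)"

text \<open>Sequences in the output space are indexed from 1: infinite sequences are elements of the
  product over \<open>{1..}\<close> and the first \<open>n\<close> entries are the restriction to \<open>{1..n}\<close>.\<close>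

definition privacy_functions :: "'y measure \<Rightarrow> (nat \<Rightarrow> (nat \<Rightarrow> 'y) \<Rightarrow> real) \<Rightarrow> bool" where
  "privacy_functions Y E \<longleftrightarrow>
     (\<forall>n\<ge>1. E n \<in> borel_measurable (Pi\<^sub>M {1..<n} (\<lambda>_. Y))) \<and>
     (\<forall>n\<ge>1. \<forall>\<beta>\<in>space (Pi\<^sub>M {1..<n} (\<lambda>_. Y)). 0 < E n \<beta>) \<and>
     (\<forall>n\<ge>1. \<forall>\<beta>\<in>space (Pi\<^sub>M {1..n} (\<lambda>_. Y)). E n (restrict \<beta> {1..<n}) \<le> E (Suc n) \<beta>)"

definition prefix_law :: "'y measure \<Rightarrow> nat \<Rightarrow> (nat \<Rightarrow> 'y) measure \<Rightarrow> (nat \<Rightarrow> 'y) measure" where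
  "prefix_law Y n A = distr A (Pi\<^sub>M {1..n} (\<lambda>_. Y)) (\<lambda>\<beta>. restrict \<beta> {1..n})"


section \<open>The Laplace process\<close>

definition inhom_poisson_process ::
  "'w measure \<Rightarrow> real \<Rightarrow> (real \<Rightarrow> real) \<Rightarrow> (real \<Rightarrow> 'w \<Rightarrow> nat) \<Rightarrow> bool" where
  "inhom_poisson_process M \<eta> intensity P \<longleftrightarrow>
     (\<forall>t\<ge>\<eta>. P t \<in> measurable M (count_space UNIV)) \<and>
     (\<forall>\<omega>\<in>space M. P \<eta> \<omega> = 0 \<and> mono_on {\<eta>..} (\<lambda>t. P t \<omega>) \<and>
        (\<forall>t\<ge>\<eta>. continuous (at_right t) (\<lambda>s. P s \<omega>))) \<and>
     (\<forall>s t. \<eta> \<le> s \<and> s < t \<longrightarrow>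
        distr M (count_space UNIV) (\<lambda>\<omega>. P t \<omega> - P s \<omega>) =
        measure_pmf (poisson_pmf (integral {s..t} intensity))) \<and>
     (\<forall>k t. \<eta> \<le> t 0 \<and> (\<forall>i<k. t i < t (Suc i)) \<longrightarrow>
        prob_space.indep_vars M (\<lambda>_. count_space UNIV)
          (\<lambda>i \<omega>. P (t (Suc i)) \<omega> - P (t i) \<omega>) {..<k})"

text \<open>For \<open>n \<ge> 1\<close> the infimum is over a nonempty set almost surely, as the total intensity on
  \<open>{\<eta>..}\<close> is infinite in the case used below.\<close>

definition jump_time :: "real \<Rightarrow> (real \<Rightarrow> 'w \<Rightarrow> nat) \<Rightarrow> nat \<Rightarrow> 'w \<Rightarrow> real" where
  "jump_time \<eta> P n \<omega> = (if n = 0 then \<eta> else Inf {t. \<eta> \<le> t \<and> n \<le> P t \<omega>})"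

definition laplace_process :: "'w measure \<Rightarrow> real \<Rightarrow> (real \<Rightarrow> 'w \<Rightarrow> real) \<Rightarrow> bool" where
  "laplace_process M \<eta> Z \<longleftrightarrow>
     (\<exists>P J.
        inhom_poisson_process M \<eta> (\<lambda>t. 2 / t) P \<and>
        cond_indep_law M (Pi\<^sub>M UNIV (\<lambda>_. borel)) (\<lambda>\<omega> n. jump_time \<eta> P n \<omega>)
          UNIV J (\<lambda>n T. laplace (T n)) \<and>
        (\<forall>t\<ge>\<eta>. \<forall>\<omega>\<in>space M. Z t \<omega> = (\<Sum>n=0..P t \<omega>. J n \<omega>)))"


section \<open>ReducedAboveThreshold\<close>

definition rat_eps ::
  "(nat \<Rightarrow> (nat \<Rightarrow> 'y) \<Rightarrow> real) \<Rightarrow> nat \<Rightarrow> (nat \<Rightarrow> 'y) \<Rightarrow> real" where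
  "rat_eps E n \<beta> = E n (restrict \<beta> {1..<n})"

text \<open>The randomness of a run on one database: a probability space carrying the iterates \<open>A\<close>, whose
  law is \<open>Alg(x)\<close>, an independent path \<open>Z\<close> of the Laplace process started at \<open>\<eta>\<close>, and noises
  \<open>\<xi> n\<close>.  Given \<open>A\<close> and \<open>Z\<close>, the \<open>\<xi> n\<close> are independent with law \<open>Lap(4\<Delta>/\<epsilon>\<^sub>n)\<close>; drawing them also for the
  rounds after the halting round does not change the output.\<close>

definition rat_run ::
  "'y measure \<Rightarrow> real \<Rightarrow> real \<Rightarrow> (nat \<Rightarrow> (nat \<Rightarrow> 'y) \<Rightarrow> real) \<Rightarrow> (nat \<Rightarrow> 'y) measure
     \<Rightarrow> 'w measure \<Rightarrow> ('w \<Rightarrow> nat \<Rightarrow> 'y) \<Rightarrow> (real \<Rightarrow> 'w \<Rightarrow> real) \<Rightarrow> (nat \<Rightarrow> 'w \<Rightarrow> real) \<Rightarrow> bool" where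
  "rat_run Y \<Delta> \<epsilon>max E Alg_law M A Z \<xi> \<longleftrightarrow>
     (let \<eta> = 2 * \<Delta> / \<epsilon>max;
          Seq = Pi\<^sub>M {1..} (\<lambda>_. Y);
          Path = Pi\<^sub>M {\<eta>..} (\<lambda>_. borel);
          Zpath = (\<lambda>\<omega>. \<lambda>t\<in>{\<eta>..}. Z t \<omega>)
      in prob_space M \<and>
         A \<in> measurable M Seq \<and> distr M Seq A = Alg_law \<and>
         laplace_process M \<eta> Z \<and>
         prob_space.indep_set M (sets (vimage_algebra (space M) A Seq))
           (sets (vimage_algebra (space M) Zpath Path)) \<and>
         cond_indep_law M (Seq \<Otimes>\<^sub>M Path) (\<lambda>\<omega>. (A \<omega>, Zpath \<omega>)) {1..} \<xi>
           (\<lambda>n (\<beta>, z). laplace (4 * \<Delta> / rat_eps E n \<beta>)))"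

text \<open>The test made in round \<open>n\<close>, if that round is reached; \<open>v\<close> is \<open>u(\<cdot>, x)\<close>.\<close>

definition rat_above ::
  "real \<Rightarrow> real \<Rightarrow> (nat \<Rightarrow> (nat \<Rightarrow> 'y) \<Rightarrow> real) \<Rightarrow> ('y \<Rightarrow> real)
     \<Rightarrow> ('w \<Rightarrow> nat \<Rightarrow> 'y) \<Rightarrow> (real \<Rightarrow> 'w \<Rightarrow> real) \<Rightarrow> (nat \<Rightarrow> 'w \<Rightarrow> real) \<Rightarrow> nat \<Rightarrow> 'w \<Rightarrow> bool" where
  "rat_above \<Delta> \<tau> E v A Z \<xi> n \<omega> \<longleftrightarrow>
     v (A \<omega> n) + \<xi> n \<omega> \<ge> \<tau> + Z (2 * \<Delta> / rat_eps E n (A \<omega>)) \<omega>"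

text \<open>The full output: in each round that is reached, the iterate together with the output bit
  (\<open>True\<close> for 1); \<open>None\<close> after halting.\<close>

definition rat_output ::
  "real \<Rightarrow> real \<Rightarrow> (nat \<Rightarrow> (nat \<Rightarrow> 'y) \<Rightarrow> real) \<Rightarrow> ('y \<Rightarrow> real)
     \<Rightarrow> ('w \<Rightarrow> nat \<Rightarrow> 'y) \<Rightarrow> (real \<Rightarrow> 'w \<Rightarrow> real) \<Rightarrow> (nat \<Rightarrow> 'w \<Rightarrow> real)
     \<Rightarrow> 'w \<Rightarrow> nat \<Rightarrow> ('y \<times> bool) option" where
  "rat_output \<Delta> \<tau> E v A Z \<xi> \<omega> =
     (\<lambda>n\<in>{1..}. if \<forall>m\<in>{1..<n}. \<not> rat_above \<Delta> \<tau> E v A Z \<xi> m \<omega>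
                then Some (A \<omega> n, rat_above \<Delta> \<tau> E v A Z \<xi> n \<omega>) else None)"

definition rat_output_space :: "'y measure \<Rightarrow> (nat \<Rightarrow> ('y \<times> bool) option) measure" where
  "rat_output_space Y = Pi\<^sub>M {1..} (\<lambda>_. option_space (Y \<Otimes>\<^sub>M count_space UNIV))"

definition halting_round :: "(nat \<Rightarrow> ('y \<times> bool) option) \<Rightarrow> enat" where
  "halting_round out = Inf {enat n | n. 1 \<le> n \<and> (\<exists>\<beta>. out n = Some (\<beta>, True))}"

end

theory Submission
  imports Defs
begin

text \<open>Given the iterates, the event of halting at round \<open>n\<close> involves the noises and the path at the
  times \<open>T\<^sub>1 \<ge> \<dots> \<ge> T\<^sub>n\<close>, which are decreasing because the privacy functions increase.  Shift the
  whole path by \<open>\<Delta>\<close>, that is, shift its value at the smallest time \<open>T\<^sub>n\<close>: this value has law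
  \<open>Lap(T\<^sub>n)\<close> and is independent of the later increments, so the shift costs
  \<open>exp (\<Delta> / T\<^sub>n) = exp (\<epsilon>\<^sub>n / 2)\<close>.  Shift the last noise by \<open>2\<Delta>\<close>, at the cost of another factor
  \<open>exp (\<epsilon>\<^sub>n / 2)\<close>.  Hence the halting probabilities on neighbors differ by a factor of at most
  \<open>exp \<epsilon>\<^sub>n\<close>, and integrating over the iterates bounds the ratio of the output densities.

  The law of the path comes from characteristic functions.  A Laplace variable of scale \<open>T\<close> has
  characteristic function \<open>1 / (1 + T\<^sup>2 \<theta>\<^sup>2)\<close>, and the product of these factors over the jump times in
  \<open>(a, b]\<close> has expectation \<open>(1 + a\<^sup>2 \<theta>\<^sup>2) / (1 + b\<^sup>2 \<theta>\<^sup>2)\<close>, since for intensity \<open>2 / t\<close> the integral of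
  \<open>(1 - 1 / (1 + t\<^sup>2 \<theta>\<^sup>2)) * 2 / t\<close> is \<open>ln (1 + t\<^sup>2 \<theta>\<^sup>2)\<close>.\<close>

section \<open>Privacy loss and densities\<close>

text \<open>Rounds before the last are free because all values of the path contain its starting
  variable: one change of that variable moves every threshold at once. Two obstacles shape the rest.
  The runs on the two databases live on unrelated probability spaces, and the process is given only
  through jump times and conditionally Laplace summands. So the laws at finitely many times must be
  computed from this description; characteristic functions serve because they turn out to depend on
  the times alone. Moreover the times are functions of the random iterates: sampling the path there
  is made measurable by right-continuity, and independence then allows the iterates to be frozen.
  The conditional laws of noises and summands are prescribed on cylinders only; writing a Laplace
  variable as its scale times a unit Laplace variable turns them into product measures, to which
  Fubini's theorem applies. Where the ratio of the prefix densities is infinite the bound is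
  trivial, and that set is cut off before the densities are compared.\<close>

lemma sets_sum_measure [simp, measurable_cong]: "sets (sum_measure P Q) = sets P"
  by (simp add: sum_measure_def)

lemma space_sum_measure [simp]: "space (sum_measure P Q) = space P"
  by (simp add: sum_measure_def)

lemma emeasure_sum_measure:
  assumes "sets Q = sets P" "C \<in> sets P"
  shows "emeasure (sum_measure P Q) C = emeasure P C + emeasure Q C"
proof (rule emeasure_measure_of[OF sum_measure_def])
  show "countably_additive (sets (sum_measure P Q)) (\<lambda>A. emeasure P A + emeasure Q A)"
  proof (rule countably_additiveI)
    fix F :: "nat \<Rightarrow> _" assume F: "range F \<subseteq> sets (sum_measure P Q)" "disjoint_family F"
    then show "(\<Sum>i. emeasure P (F i) + emeasure Q (F i)) = emeasure P (\<Union>i. F i) + emeasure Q (\<Union>i. F i)"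
      using assms by (subst suminf_add[symmetric]) (auto simp: suminf_emeasure)
  qed
qed (use assms in \<open>auto simp: positive_def dest: sets.sets_into_space\<close>)

context
  fixes P Q :: "'a measure"
  assumes fin: "finite_measure P" "finite_measure Q" and sets_eq: "sets Q = sets P"
begin

lemma finite_sum_measure: "finite_measure (sum_measure P Q)"
proof
  show "emeasure (sum_measure P Q) (space (sum_measure P Q)) \<noteq> \<infinity>"
    using finite_measure.emeasure_finite[OF fin(1)] finite_measure.emeasure_finite[OF fin(2)]
    by (simp add: emeasure_sum_measure[OF sets_eq] ennreal_add_eq_top)
qed

lemma ac_sum_measure:
  "absolutely_continuous (sum_measure P Q) P" "absolutely_continuous (sum_measure P Q) Q"
  using sets_eq by (auto simp: absolutely_continuous_def null_sets_def emeasure_sum_measure)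

lemma nn_integral_RN_sum_measure:
  assumes "f \<in> borel_measurable P"
  shows "integral\<^sup>N P f = (\<integral>\<^sup>+z. RN_deriv (sum_measure P Q) P z * f z \<partial>sum_measure P Q)"
    and "integral\<^sup>N Q f = (\<integral>\<^sup>+z. RN_deriv (sum_measure P Q) Q z * f z \<partial>sum_measure P Q)"
proof -
  interpret finite_measure "sum_measure P Q" by (rule finite_sum_measure)
  have "f \<in> borel_measurable (sum_measure P Q)"
    using assms by (simp cong: measurable_cong_sets)
  then show "integral\<^sup>N P f = (\<integral>\<^sup>+z. RN_deriv (sum_measure P Q) P z * f z \<partial>sum_measure P Q)"
    "integral\<^sup>N Q f = (\<integral>\<^sup>+z. RN_deriv (sum_measure P Q) Q z * f z \<partial>sum_measure P Q)"
    using sets_eq by (simp_all add: RN_deriv_nn_integral[OF ac_sum_measure(1)] RN_deriv_nn_integral[OF ac_sum_measure(2)])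
qed

lemma RN_sum_measure_finite:
  "AE z in sum_measure P Q. RN_deriv (sum_measure P Q) P z \<noteq> \<infinity> \<and> RN_deriv (sum_measure P Q) Q z \<noteq> \<infinity>"
proof -
  interpret finite_measure "sum_measure P Q" by (rule finite_sum_measure)
  have "AE z in sum_measure P Q. RN_deriv (sum_measure P Q) P z \<noteq> \<infinity>"
    by (rule RN_deriv_finite) (use fin ac_sum_measure in \<open>simp_all add: finite_measure_def\<close>)
  moreover have "AE z in sum_measure P Q. RN_deriv (sum_measure P Q) Q z \<noteq> \<infinity>"
    by (rule RN_deriv_finite) (use fin ac_sum_measure sets_eq in \<open>simp_all add: finite_measure_def\<close>)
  ultimately show ?thesis
    by eventually_elim simp
qed

lemma measurable_RN_sum_measure [measurable]:
  "RN_deriv (sum_measure P Q) P \<in> borel_measurable P" "RN_deriv (sum_measure P Q) Q \<in> borel_measurable P"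
  using borel_measurable_RN_deriv[of "sum_measure P Q"] by (simp_all cong: measurable_cong_sets)

text \<open>Change of measure by the ratio \<open>g\<close> of densities. The part of
  \<open>P\<close> singular to \<open>Q\<close> sits where the second density vanishes and the first
  does not; there \<open>g\<close> is infinite and \<open>h0\<close> makes \<open>h\<close> vanish,
  so nothing is lost in passing to \<open>Q\<close>.\<close>

lemma nn_integral_RN_ratio:
  defines "g \<equiv> \<lambda>z. RN_deriv (sum_measure P Q) P z / RN_deriv (sum_measure P Q) Q z"
  assumes [measurable]: "h \<in> borel_measurable P" and h0: "\<And>z. z \<in> space P \<Longrightarrow> g z = \<infinity> \<Longrightarrow> h z = 0"
  shows "(\<integral>\<^sup>+z. h z \<partial>P) = (\<integral>\<^sup>+z. g z * h z \<partial>Q)"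
proof -
  have "(\<integral>\<^sup>+z. h z \<partial>P) = (\<integral>\<^sup>+z. RN_deriv (sum_measure P Q) P z * h z \<partial>sum_measure P Q)"
    by (rule nn_integral_RN_sum_measure) measurable
  also have "\<dots> = (\<integral>\<^sup>+z. RN_deriv (sum_measure P Q) Q z * (g z * h z) \<partial>sum_measure P Q)"
  proof (rule nn_integral_cong_AE, use RN_sum_measure_finite AE_space in eventually_elim)
    fix z assume z: "z \<in> space (sum_measure P Q)" and fin: "RN_deriv (sum_measure P Q) P z \<noteq> \<infinity> \<and> RN_deriv (sum_measure P Q) Q z \<noteq> \<infinity>"
    let ?p = "RN_deriv (sum_measure P Q) P z" and ?q = "RN_deriv (sum_measure P Q) Q z"
    consider "g z = \<infinity>" | "g z \<noteq> \<infinity>" "?q = 0" | "?q \<noteq> 0" by blast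
    then show "?p * h z = ?q * (g z * h z)"
    proof cases
      case 2
      \<comment> \<open>In \<open>ennreal\<close> a nonzero numerator over 0 gives infinity, so a
        finite ratio over 0 has numerator 0.\<close>
      then have "?p = 0" by (cases "?p = 0") (simp_all add: g_def)
      with 2 show ?thesis by simp
    next
      case 3
      have "?q * g z = ?p * ?q / ?q"
        unfolding g_def ennreal_times_divide by (simp only: mult.commute)
      also have "\<dots> = ?p"
        by (rule ennreal_mult_divide_eq) (use 3 fin in auto)
      finally have "?q * g z = ?p" .
      then show ?thesis by (simp add: mult.assoc[symmetric])
    qed (use z in \<open>simp add: h0\<close>)
  qed
  also have "\<dots> = (\<integral>\<^sup>+z. g z * h z \<partial>Q)"
    unfolding g_def by (rule nn_integral_RN_sum_measure(2)[symmetric]) measurable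
  finally show ?thesis .
qed

text \<open>The bound on integrals over subsets of \<open>D\<close> becomes a bound almost
  everywhere by testing it on the very set where the pointwise bound fails: there the integrands are
  strictly ordered the wrong way round.\<close>

lemma RN_ratio_le:
  assumes D[measurable]: "D \<in> sets P" and r[measurable]: "r \<in> borel_measurable P"
    and rfin: "\<And>z. z \<in> D \<Longrightarrow> r z \<noteq> \<infinity>"
    and le: "\<And>C. C \<in> sets P \<Longrightarrow> C \<subseteq> D \<Longrightarrow> emeasure P C \<le> (\<integral>\<^sup>+z. r z * indicator C z \<partial>Q)"
  shows "AE z in P. z \<in> D \<longrightarrow> RN_deriv (sum_measure P Q) P z / RN_deriv (sum_measure P Q) Q z \<le> r z"
proof -
  let ?S = "sum_measure P Q"
  let ?p = "RN_deriv ?S P" and ?q = "RN_deriv ?S Q"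
  interpret S: finite_measure ?S by (rule finite_sum_measure)
  interpret P: finite_measure P by (rule fin)
  \<comment> \<open>The violating set in multiplied form. The quotient is restored at the end, where
    a zero of \<open>?q\<close> forces a zero of \<open>?p\<close>.\<close>
  define G where "G = {z \<in> space P. z \<in> D \<and> r z * ?q z < ?p z}"
  have G[measurable]: "G \<in> sets P" unfolding G_def by measurable
  have PG: "emeasure P G = (\<integral>\<^sup>+z. ?p z * indicator G z \<partial>?S)"
    using nn_integral_RN_sum_measure(1)[of "indicator G"] by simp
  have "emeasure P G \<le> (\<integral>\<^sup>+z. r z * indicator G z \<partial>Q)"
    by (rule le) (auto simp: G_def)
  also have "\<dots> = (\<integral>\<^sup>+z. ?q z * (r z * indicator G z) \<partial>?S)"
    by (rule nn_integral_RN_sum_measure(2)) measurable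
  finally have *: "(\<integral>\<^sup>+z. ?p z * indicator G z \<partial>?S) \<le> (\<integral>\<^sup>+z. ?q z * (r z * indicator G z) \<partial>?S)"
    unfolding PG .
  have le': "AE z in ?S. ?q z * (r z * indicator G z) \<le> ?p z * indicator G z"
    by (intro AE_I2) (auto simp: G_def indicator_def mult.commute[of "r _"] intro: less_imp_le)
  then have "(\<integral>\<^sup>+z. ?q z * (r z * indicator G z) \<partial>?S) \<le> (\<integral>\<^sup>+z. ?p z * indicator G z \<partial>?S)"
    by (rule nn_integral_mono_AE)
  with PG have "(\<integral>\<^sup>+z. ?q z * (r z * indicator G z) \<partial>?S) \<noteq> \<infinity>"
    using P.emeasure_finite[of G] by (auto simp: top_unique)
  moreover have "(\<lambda>z. ?q z * (r z * indicator G z)) \<in> borel_measurable ?S" "(\<lambda>z. ?p z * indicator G z) \<in> borel_measurable ?S"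
    by (simp_all cong: measurable_cong_sets)
  \<comment> \<open>A strict inequality on a set of positive measure would order the integrals
    strictly, provided the smaller one is finite.\<close>
  ultimately have "AE z in ?S. ?p z * indicator G z \<le> ?q z * (r z * indicator G z)"
    using nn_integral_less[of "\<lambda>z. ?q z * (r z * indicator G z)" ?S "\<lambda>z. ?p z * indicator G z"] le' *
    by (meson not_le)
  with RN_sum_measure_finite have "AE z in ?S. z \<in> D \<longrightarrow> ?p z / ?q z \<le> r z"
    using AE_space
  proof eventually_elim
    case (elim z)
    show "z \<in> D \<longrightarrow> ?p z / ?q z \<le> r z"
    proof
      assume z: "z \<in> D"
      have "\<not> r z * ?q z < ?p z"
        using elim z by (auto simp: G_def indicator_def mult.commute[of "r _"] split: if_splits)
      then have le: "?p z \<le> r z * ?q z" by simp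
      show "?p z / ?q z \<le> r z"
      proof (cases "?q z = 0")
        case True
        with le show ?thesis by simp
      next
        case False
        have "?p z / ?q z \<le> r z * ?q z / ?q z" using le by (rule divide_right_mono_ennreal)
        also have "\<dots> = r z" using False elim by (simp add: ennreal_mult_divide_eq)
        finally show ?thesis .
      qed
    qed
  qed
  then show ?thesis
    by (intro absolutely_continuous_AE[of P "sum_measure P Q"] ac_sum_measure) simp_all
qed

end

section \<open>The logarithm on the extended nonnegative reals\<close>

lemma ennreal_log_ennreal: "0 < x \<Longrightarrow> ennreal_log (ennreal x) = ereal (ln x)"
  by (simp add: ennreal_log_def)

lemma ennreal_log_mono:
  assumes "a \<le> b"
  shows "ennreal_log a \<le> ennreal_log b"
proof (cases "a = 0 \<or> b = \<infinity>")
  case False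
  obtain x y where xy: "a = ennreal x" "0 < x" "b = ennreal y" "0 < y"
  proof (cases a; cases b)
    fix x y assume "0 \<le> x" "a = ennreal x" "0 \<le> y" "b = ennreal y"
    moreover have "x \<noteq> 0" "y \<noteq> 0"
      using False assms \<open>a = ennreal x\<close> \<open>b = ennreal y\<close> by auto
    ultimately show thesis by (intro that[of x y]) auto
  qed (use False assms in \<open>auto simp: top_unique\<close>)
  then have "x \<le> y"
    using assms by simp
  then show ?thesis
    using xy by (simp add: ennreal_log_ennreal)
next
  case True
  then show ?thesis
    by (elim disjE) (simp_all add: ennreal_log_def)
qed

text \<open>A factor \<open>exp e\<close> between densities becomes a summand \<open>e\<close> of
  the privacy loss, also at 0 and infinity, whose infinite logarithms absorb
  \<open>e\<close>.\<close>

lemma ennreal_log_times_exp: "ennreal_log (a * ennreal (exp e)) = ennreal_log a + ereal e"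
proof (cases a)
  case (real x)
  show ?thesis
  proof (cases "x = 0")
    case True
    then show ?thesis
      using real by (simp add: ennreal_log_def)
  next
    case False
    with real show ?thesis
      by (simp add: ennreal_mult[symmetric] ennreal_log_ennreal ln_mult)
  qed
next
  case top
  then show ?thesis
    by (simp add: ennreal_log_def ennreal_top_mult)
qed

section \<open>The Laplace distribution\<close>

lemma sets_laplace [simp, measurable_cong]: "sets (laplace s) = sets borel"
  by (simp add: laplace_def)

lemma space_laplace [simp]: "space (laplace s) = UNIV"
  by (simp add: laplace_def)

definition laplace_density :: "real \<Rightarrow> real \<Rightarrow> real" where
  "laplace_density s y = 1 / (2 * s) * exp (- \<bar>y\<bar> / s)"

lemma laplace_density_measurable [measurable]: "laplace_density s \<in> borel_measurable borel"
  unfolding laplace_density_def[abs_def] by measurable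

lemma nn_integral_laplace:
  assumes "f \<in> borel_measurable borel"
  shows "integral\<^sup>N (laplace s) f = (\<integral>\<^sup>+y. ennreal (laplace_density s y) * f y \<partial>lborel)"
  unfolding laplace_def laplace_density_def using assms by (subst nn_integral_density) auto

text \<open>A Laplace variable of random scale can thus be produced from one fixed law, which
  replaces kernels by product measures.\<close>

lemma laplace_scale:
  assumes s: "0 < s"
  shows "distr (laplace 1) borel (\<lambda>w. s * w) = laplace s"
proof (rule measure_eqI)
  fix B assume "B \<in> sets (distr (laplace 1) borel (\<lambda>w. s * w))"
  then have B[measurable]: "B \<in> sets borel" by simp
  have "emeasure (laplace s) B = (\<integral>\<^sup>+y. indicator B y \<partial>laplace s)"
    by simp
  also have "\<dots> = (\<integral>\<^sup>+y. ennreal (laplace_density s y) * indicator B y \<partial>lborel)"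
    by (rule nn_integral_laplace) measurable
  also have "\<dots> = s * (\<integral>\<^sup>+y. ennreal (laplace_density s (s * y)) * indicator B (s * y) \<partial>lborel)"
    using s by (subst nn_integral_real_affine[where c=s and t=0]) auto
  also have "\<dots> = (\<integral>\<^sup>+y. ennreal s * (ennreal (laplace_density s (s * y)) * indicator B (s * y)) \<partial>lborel)"
    by (subst nn_integral_cmult) auto
  also have "\<dots> = (\<integral>\<^sup>+y. ennreal (laplace_density 1 y) * indicator B (s * y) \<partial>lborel)"
    using s by (intro nn_integral_cong)
      (auto simp: laplace_density_def mult.assoc[symmetric] ennreal_mult[symmetric] abs_mult)
  also have "\<dots> = (\<integral>\<^sup>+y. indicator B (s * y) \<partial>laplace 1)"
    by (rule nn_integral_laplace[symmetric]) measurable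
  also have "\<dots> = (\<integral>\<^sup>+y. indicator B y \<partial>distr (laplace 1) borel (\<lambda>w. s * w))"
    by (subst nn_integral_distr) auto
  also have "\<dots> = emeasure (distr (laplace 1) borel (\<lambda>w. s * w)) B"
    by simp
  finally show "emeasure (distr (laplace 1) borel (\<lambda>w. s * w)) B = emeasure (laplace s) B" ..
qed simp

text \<open>By the triangle inequality \<open>laplace_density s (y - c)\<close> is at most
  \<open>exp (\<bar>c\<bar> / s)\<close> times \<open>laplace_density s y\<close>; this is the
  privacy of the Laplace mechanism in integral form.\<close>

lemma nn_integral_laplace_shift:
  assumes s: "0 < s" and f[measurable]: "f \<in> borel_measurable borel"
  shows "(\<integral>\<^sup>+y. f (y + c) \<partial>laplace s) \<le> ennreal (exp (\<bar>c\<bar> / s)) * (\<integral>\<^sup>+y. f y \<partial>laplace s)"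
proof -
  have "(\<integral>\<^sup>+y. f (y + c) \<partial>laplace s) = (\<integral>\<^sup>+y. ennreal (laplace_density s y) * f (y + c) \<partial>lborel)"
    by (rule nn_integral_laplace) measurable
  also have "\<dots> = (\<integral>\<^sup>+y. ennreal (laplace_density s (y - c)) * f y \<partial>lborel)"
    by (subst nn_integral_real_affine[where c=1 and t="-c"]) (auto simp: add.commute)
  also have "\<dots> \<le> (\<integral>\<^sup>+y. ennreal (exp (\<bar>c\<bar> / s)) * (ennreal (laplace_density s y) * f y) \<partial>lborel)"
  proof (rule nn_integral_mono)
    fix y
    have "- \<bar>y - c\<bar> / s \<le> \<bar>c\<bar> / s + - \<bar>y\<bar> / s"
      using s by (simp add: divide_simps)
    then have "exp (- \<bar>y - c\<bar> / s) \<le> exp (\<bar>c\<bar> / s) * exp (- \<bar>y\<bar> / s)"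
      by (simp add: exp_add[symmetric])
    then have "laplace_density s (y - c) \<le> exp (\<bar>c\<bar> / s) * laplace_density s y"
      using s by (simp add: laplace_density_def divide_simps mult.commute)
    then have "ennreal (laplace_density s (y - c)) \<le> ennreal (exp (\<bar>c\<bar> / s)) * ennreal (laplace_density s y)"
      using s by (simp add: laplace_density_def ennreal_mult[symmetric] ennreal_leI)
    then show "ennreal (laplace_density s (y - c)) * f y
        \<le> ennreal (exp (\<bar>c\<bar> / s)) * (ennreal (laplace_density s y) * f y)"
      unfolding mult.assoc[symmetric] by (intro mult_right_mono) auto
  qed
  also have "\<dots> = ennreal (exp (\<bar>c\<bar> / s)) * (\<integral>\<^sup>+y. ennreal (laplace_density s y) * f y \<partial>lborel)"
    by (rule nn_integral_cmult) measurable
  also have "\<dots> = ennreal (exp (\<bar>c\<bar> / s)) * (\<integral>\<^sup>+y. f y \<partial>laplace s)"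
    by (subst nn_integral_laplace) measurable
  finally show ?thesis .
qed

section \<open>The characteristic function of the Laplace law\<close>

lemma integrable_exp_iexp_Ioi:
  "set_integrable lborel {0<..} (\<lambda>x::real. exp (- x) *\<^sub>R iexp (t * x))"
proof -
  have "set_integrable lborel {0<..} (\<lambda>x::real. exp (- x))"
    using integrable_I0i_exp_mscale[of 1] by simp
  then show ?thesis
    unfolding set_integrable_def by (rule Bochner_Integration.integrable_bound) auto
qed

text \<open>The antiderivative \<open>?F\<close> has norm proportional to \<open>exp (- x)\<close>,
  so only its value at 0 contributes.\<close>

lemma integral_exp_iexp_Ioi:
  "(CLBINT x:{0<..}. exp (- x) *\<^sub>R iexp (t * x)) = 1 / (1 - \<i> * t)"
proof -
  let ?F = "\<lambda>x::real. exp ((\<i> * t - 1) * x) / (\<i> * t - 1)"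
  have nz: "\<i> * complex_of_real t - 1 \<noteq> 0"
    by (simp add: complex_eq_iff)
  have eq: "exp (- x) *\<^sub>R iexp (t * x) = exp ((\<i> * t - 1) * complex_of_real x)" for x
  proof -
    have "exp (- x) *\<^sub>R iexp (t * x) = exp (complex_of_real (- x)) * iexp (t * x)"
      by (metis exp_of_real scaleR_conv_of_real)
    also have "\<dots> = exp ((\<i> * t - 1) * complex_of_real x)"
      by (simp add: exp_add[symmetric] algebra_simps)
    finally show ?thesis .
  qed
  have "(CLBINT x=ereal 0..\<infinity>. exp (- x) *\<^sub>R iexp (t * x)) = 0 - ?F 0"
  proof (rule interval_integral_FTC_integrable)
    fix x :: real
    have "((\<lambda>z. exp ((\<i> * t - 1) * z) / (\<i> * t - 1)) has_field_derivative exp ((\<i> * t - 1) * complex_of_real x)) (at (complex_of_real x))"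
      using nz by (auto intro!: derivative_eq_intros)
    then show "(?F has_vector_derivative exp (- x) *\<^sub>R iexp (t * x)) (at x)"
      unfolding eq by (rule has_vector_derivative_real_field)
    show "isCont (\<lambda>x. exp (- x) *\<^sub>R iexp (t * x)) x"
      by (intro continuous_intros)
  next
    show "set_integrable lborel (einterval (ereal 0) \<infinity>) (\<lambda>x. exp (- x) *\<^sub>R iexp (t * x))"
      using integrable_exp_iexp_Ioi by simp
    have "isCont ?F 0"
      using nz by (intro continuous_intros) auto
    then have "(?F \<longlongrightarrow> ?F 0) (at_right 0)"
      unfolding isCont_def by (rule filterlim_mono[OF _ order_refl]) (simp add: at_within_le_at)
    then show "((?F \<circ> real_of_ereal) \<longlongrightarrow> ?F 0) (at_right (ereal 0))"
      unfolding at_right_ereal by (simp add: filterlim_filtermap o_def)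
    have "((\<lambda>x. exp (- x) * (1 / norm (\<i> * t - 1))) \<longlongrightarrow> 0 * (1 / norm (\<i> * t - 1))) at_top"
      by (intro tendsto_intros filterlim_compose[OF exp_at_bot] filterlim_uminus_at_bot_at_top)
    moreover have "norm (?F x) = exp (- x) * (1 / norm (\<i> * t - 1))" for x
      by (simp add: norm_divide eq[symmetric])
    ultimately have "((\<lambda>x. norm (?F x)) \<longlongrightarrow> 0) at_top"
      by simp
    then have "(?F \<longlongrightarrow> 0) at_top"
      by (rule tendsto_norm_zero_cancel)
    then show "((?F \<circ> real_of_ereal) \<longlongrightarrow> 0) (at_left \<infinity>)"
      unfolding at_left_PInf by (simp add: filterlim_filtermap o_def)
  qed simp
  also have "\<dots> = 1 / (1 - \<i> * t)"
    using nz by (simp add: divide_simps)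
  finally show ?thesis
    by (simp add: interval_integral_to_infinity_eq)
qed

text \<open>The negative half-line is the reflection of the positive one with frequency
  \<open>- t\<close>, and the mean of \<open>1 / (1 - \<i> * t)\<close> and
  \<open>1 / (1 + \<i> * t)\<close> is \<open>1 / (1 + t^2)\<close>.\<close>

lemma has_bochner_integral_laplace_iexp:
  "has_bochner_integral lborel (\<lambda>x. (exp (- \<bar>x\<bar>) / 2) *\<^sub>R iexp (t * x)) (complex_of_real (1 / (1 + t\<^sup>2)))"
proof -
  have *: "has_bochner_integral lborel (\<lambda>x. indicator {0<..} x *\<^sub>R (exp (- x) *\<^sub>R iexp (r * x))) (1 / (1 - \<i> * r))" for r :: real
    using integrable_exp_iexp_Ioi[of r] integral_exp_iexp_Ioi[of r]
    unfolding set_integrable_def set_lebesgue_integral_def by (simp add: has_bochner_integral_iff)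
  have neg: "has_bochner_integral lborel (\<lambda>x. indicator {..<0} x *\<^sub>R (exp x *\<^sub>R iexp (t * x))) (1 / (1 + \<i> * t))"
    using lborel_has_bochner_integral_real_affine_iff[THEN iffD1, OF _ *[of "-t"], of "-1" 0]
    by (simp add: indicator_def of_bool_def)
  have "has_bochner_integral lborel (\<lambda>x. (1/2) *\<^sub>R (indicator {0<..} x *\<^sub>R (exp (- x) *\<^sub>R iexp (t * x)) + indicator {..<0} x *\<^sub>R (exp x *\<^sub>R iexp (t * x))))
     ((1/2) *\<^sub>R (1 / (1 - \<i> * t) + 1 / (1 + \<i> * t)))"
    using *[of t] neg by (intro has_bochner_integral_scaleR_right has_bochner_integral_add)
  moreover have "(1/2) *\<^sub>R (1 / (1 - \<i> * t) + 1 / (1 + \<i> * t)) = complex_of_real (1 / (1 + t\<^sup>2))"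
  proof -
    have "1 - \<i> * complex_of_real t \<noteq> 0" "1 + \<i> * complex_of_real t \<noteq> 0"
      by (auto simp: complex_eq_iff)
    then have "(1/2) *\<^sub>R (1 / (1 - \<i> * t) + 1 / (1 + \<i> * t)) = 1 / ((1 - \<i> * t) * (1 + \<i> * t))"
      by (simp add: scaleR_conv_of_real divide_simps)
    also have "(1 - \<i> * t) * (1 + \<i> * t) = complex_of_real (1 + t\<^sup>2)"
      by (simp add: algebra_simps power2_eq_square)
    finally show ?thesis by simp
  qed
  ultimately have "has_bochner_integral lborel (\<lambda>x. (1/2) *\<^sub>R (indicator {0<..} x *\<^sub>R (exp (- x) *\<^sub>R iexp (t * x)) + indicator {..<0} x *\<^sub>R (exp x *\<^sub>R iexp (t * x))))
     (complex_of_real (1 / (1 + t\<^sup>2)))" by simp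
  then show ?thesis
  proof (rule has_bochner_integral_cong_AE[THEN iffD1, rotated 3])
    show "AE x in lborel. (1/2) *\<^sub>R (indicator {0<..} x *\<^sub>R (exp (- x) *\<^sub>R iexp (t * x)) + indicator {..<0} x *\<^sub>R (exp x *\<^sub>R iexp (t * x))) = (exp (- \<bar>x\<bar>) / 2) *\<^sub>R iexp (t * x)"
      using AE_lborel_singleton[of 0]
      by eventually_elim (auto simp: indicator_def scaleR_conv_of_real split: if_splits)
  qed auto
qed

text \<open>The total mass is the characteristic function at 0.\<close>

lemma prob_space_laplace_1: "prob_space (laplace 1)"
proof
  have "has_bochner_integral lborel (\<lambda>x::real. complex_of_real (exp (- \<bar>x\<bar>) / 2)) (complex_of_real 1)"
    using has_bochner_integral_laplace_iexp[of 0] by (simp add: scaleR_conv_of_real)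
  then have "has_bochner_integral lborel (\<lambda>x::real. exp (- \<bar>x\<bar>) / 2) 1"
    by (drule_tac has_bochner_integral_bounded_linear[OF bounded_linear_Re]) simp
  then have "(\<integral>\<^sup>+x. ennreal (exp (- \<bar>x\<bar>) / 2) \<partial>lborel) = 1"
    by (subst nn_integral_eq_integral) (auto simp: has_bochner_integral_iff)
  then show "emeasure (laplace 1) (space (laplace 1)) = 1"
    unfolding laplace_def by (simp add: emeasure_density field_simps)
qed

lemma real_distribution_laplace:
  assumes "0 < s" shows "real_distribution (laplace s)"
proof -
  interpret prob_space "laplace 1" by (rule prob_space_laplace_1)
  have "prob_space (distr (laplace 1) borel (\<lambda>w. s * w))"
    by (rule prob_space_distr) measurable
  then have "prob_space (laplace s)"
    by (simp only: laplace_scale[OF assms])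
  then show ?thesis
    by (simp add: real_distribution_def real_distribution_axioms_def)
qed

lemma char_laplace_1: "char (laplace 1) t = complex_of_real (1 / (1 + t\<^sup>2))"
  using has_bochner_integral_laplace_iexp[of t]
  unfolding char_def laplace_def
  by (subst integral_density) (auto simp: has_bochner_integral_iff)

lemma char_laplace:
  assumes "0 < s"
  shows "char (laplace s) t = complex_of_real (1 / (1 + (s * t)\<^sup>2))"
proof -
  have "char (laplace s) t = (CLINT w|laplace 1. iexp (t * (s * w)))"
    unfolding char_def by (subst laplace_scale[OF assms, symmetric], subst integral_distr) auto
  also have "\<dots> = char (laplace 1) (s * t)"
    by (simp add: char_def mult_ac)
  finally show ?thesis
    by (simp add: char_laplace_1)
qed

text \<open>The conditional law is prescribed on cylinders only. The corresponding rectangles form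
  an intersection-stable generator, and on them both sides are the integral of
  \<open>indicator A\<close> times a product of Laplace probabilities. A family of conditional laws
  is thereby replaced by the product of the law of \<open>X\<close> with unit Laplace laws.\<close>

lemma cond_indep_law_laplace_joint:
  fixes M :: "'w measure" and S :: "'a measure"
  assumes M: "prob_space M"
    and cil: "cond_indep_law M S X I V (\<lambda>i a. laplace (s i a))"
    and s: "\<And>i. i \<in> J \<Longrightarrow> s i \<in> borel_measurable S"
    and pos: "AE x in M. \<forall>i\<in>J. 0 < s i (X x)"
    and J: "finite J" "J \<subseteq> I"
  shows "distr M (S \<Otimes>\<^sub>M Pi\<^sub>M J (\<lambda>_. borel)) (\<lambda>x. (X x, \<lambda>i\<in>J. V i x)) =
    distr (distr M S X \<Otimes>\<^sub>M Pi\<^sub>M J (\<lambda>_. laplace 1)) (S \<Otimes>\<^sub>M Pi\<^sub>M J (\<lambda>_. borel))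
      (\<lambda>(a, w). (a, \<lambda>i\<in>J. s i a * w i))" (is "?D1 = ?D2")
proof -
  interpret M: prob_space M by (rule M)
  interpret L: prob_space "laplace 1" by (rule prob_space_laplace_1)
  interpret PL: product_prob_space "\<lambda>_. laplace 1" J ..
  have PJ: "prob_space (Pi\<^sub>M J (\<lambda>_. laplace 1))"
    by (rule prob_space_PiM) (rule prob_space_laplace_1)
  have X[measurable]: "X \<in> measurable M S"
    using cil by (simp add: cond_indep_law_def)
  have V[measurable]: "V i \<in> borel_measurable M" if "i \<in> J" for i
    using cil J that by (auto simp: cond_indep_law_def)
  have rect: "emeasure M {x \<in> space M. X x \<in> A \<and> (\<forall>i\<in>J. V i x \<in> B i)} =
        (\<integral>\<^sup>+x. indicator A (X x) * (\<Prod>i\<in>J. emeasure (laplace (s i (X x))) (B i)) \<partial>M)"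
    if "A \<in> sets S" "\<And>i. i \<in> J \<Longrightarrow> B i \<in> sets borel" for A B
    using cil that J unfolding cond_indep_law_def by blast
  interpret DX: prob_space "distr M S X" by (rule M.prob_space_distr) measurable
  interpret pair: pair_sigma_finite "distr M S X" "Pi\<^sub>M J (\<lambda>_. laplace 1)" ..
  let ?R = "S \<Otimes>\<^sub>M Pi\<^sub>M J (\<lambda>_. borel :: real measure)"
  have sets_PL[measurable_cong]: "sets (Pi\<^sub>M J (\<lambda>_. laplace 1)) = sets (Pi\<^sub>M J (\<lambda>_. borel))"
    by (rule sets_PiM_cong) auto
  have scale[measurable]: "(\<lambda>(a, w). (a, \<lambda>i\<in>J. s i a * w i)) \<in> measurable (distr M S X \<Otimes>\<^sub>M Pi\<^sub>M J (\<lambda>_. laplace 1)) ?R"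
  proof -
    have "(\<lambda>p. s i (fst p) * snd p i) \<in> borel_measurable (distr M S X \<Otimes>\<^sub>M Pi\<^sub>M J (\<lambda>_. laplace 1))" if "i \<in> J" for i
      using s[OF that] that by measurable
    then show ?thesis
      unfolding case_prod_beta by (intro measurable_Pair measurable_restrict) auto
  qed
  have joint[measurable]: "(\<lambda>x. (X x, \<lambda>i\<in>J. V i x)) \<in> measurable M ?R"
    by (intro measurable_Pair measurable_restrict) auto
  have eq: "emeasure ?D1 (A \<times> Pi\<^sub>E J B) = emeasure ?D2 (A \<times> Pi\<^sub>E J B)"
    if A[measurable]: "A \<in> sets S" and B: "\<And>i. i \<in> J \<Longrightarrow> B i \<in> sets borel" for A B
  proof -
    have B'[measurable]: "Pi\<^sub>E J B \<in> sets (Pi\<^sub>M J (\<lambda>_. borel))"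
      using B J by (intro sets_PiM_I_finite) auto
    \<comment> \<open>Integrating against the fixed law \<open>laplace 1\<close> makes measurability
      in \<open>a\<close> immediate. Agreement with \<open>laplace (s i a)\<close> holds where the
      scales are positive, hence almost surely along \<open>X\<close>.\<close>
    define g where "g a = (\<Prod>i\<in>J. \<integral>\<^sup>+w. indicator (B i) (s i a * w) \<partial>laplace 1)" for a
    have g[measurable]: "g \<in> borel_measurable S"
    proof -
      have "(\<lambda>a. \<integral>\<^sup>+w. indicator (B i) (s i a * w) \<partial>laplace 1) \<in> borel_measurable S" if i: "i \<in> J" for i
      proof -
        note s[OF i, measurable] B[OF i, measurable]
        show ?thesis by measurable
      qed
      then show ?thesis unfolding g_def by measurable
    qed
    have g_eq: "g a = (\<Prod>i\<in>J. emeasure (laplace (s i a)) (B i))" if "\<And>i. i \<in> J \<Longrightarrow> 0 < s i a" for a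
      unfolding g_def
    proof (rule prod.cong[OF refl])
      fix i assume i: "i \<in> J"
      note B[OF i, measurable]
      have "emeasure (laplace (s i a)) (B i) = (\<integral>\<^sup>+w. indicator (B i) w \<partial>distr (laplace 1) borel (\<lambda>w. s i a * w))"
        using i by (subst laplace_scale[OF that[OF i]]) simp
      also have "\<dots> = (\<integral>\<^sup>+w. indicator (B i) (s i a * w) \<partial>laplace 1)"
        by (rule nn_integral_distr) auto
      finally show "(\<integral>\<^sup>+w. indicator (B i) (s i a * w) \<partial>laplace 1) = emeasure (laplace (s i a)) (B i)" ..
    qed
    have "emeasure ?D1 (A \<times> Pi\<^sub>E J B) = emeasure M {x \<in> space M. X x \<in> A \<and> (\<forall>i\<in>J. V i x \<in> B i)}"
      by (subst emeasure_distr) (auto intro!: arg_cong[where f="emeasure M"])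
    also have "\<dots> = (\<integral>\<^sup>+x. indicator A (X x) * (\<Prod>i\<in>J. emeasure (laplace (s i (X x))) (B i)) \<partial>M)"
      using B by (intro rect) auto
    also have "\<dots> = (\<integral>\<^sup>+x. indicator A (X x) * g (X x) \<partial>M)"
      using pos by (intro nn_integral_cong_AE, elim eventually_mono) (simp add: g_eq)
    also have "\<dots> = (\<integral>\<^sup>+a. indicator A a * g a \<partial>distr M S X)"
      by (subst nn_integral_distr) auto
    also have "\<dots> = (\<integral>\<^sup>+a. \<integral>\<^sup>+w. indicator A a * (\<Prod>i\<in>J. indicator (B i) (s i a * w i)) \<partial>Pi\<^sub>M J (\<lambda>_. laplace 1) \<partial>distr M S X)"
    proof (rule nn_integral_cong)
      fix a assume "a \<in> space (distr M S X)"
      have m: "(\<lambda>w. indicator (B i) (s i a * w)) \<in> borel_measurable (laplace 1)" if "i \<in> J" for i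
      proof -
        note B[OF that, measurable]
        show ?thesis by measurable
      qed
      have m': "(\<lambda>w. indicator (B i) (s i a * w i)) \<in> borel_measurable (Pi\<^sub>M J (\<lambda>_. laplace 1))" if "i \<in> J" for i
        using measurable_compose[OF measurable_component_singleton[OF that, of "\<lambda>_. laplace 1"] m[OF that]] .
      have "(\<integral>\<^sup>+w. indicator A a * (\<Prod>i\<in>J. indicator (B i) (s i a * w i)) \<partial>Pi\<^sub>M J (\<lambda>_. laplace 1))
        = indicator A a * (\<integral>\<^sup>+w. (\<Prod>i\<in>J. indicator (B i) (s i a * w i)) \<partial>Pi\<^sub>M J (\<lambda>_. laplace 1))"
        using m' by (intro nn_integral_cmult borel_measurable_prod_ennreal) auto
      also have "(\<integral>\<^sup>+w. (\<Prod>i\<in>J. indicator (B i) (s i a * w i)) \<partial>Pi\<^sub>M J (\<lambda>_. laplace 1)) = g a"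
        unfolding g_def by (rule PL.product_nn_integral_prod[OF J(1) m])
      finally show "indicator A a * g a = (\<integral>\<^sup>+w. indicator A a * (\<Prod>i\<in>J. indicator (B i) (s i a * w i)) \<partial>Pi\<^sub>M J (\<lambda>_. laplace 1))" ..
    qed
    also have "\<dots> = (\<integral>\<^sup>+a. \<integral>\<^sup>+w. indicator (A \<times> Pi\<^sub>E J B) (a, \<lambda>i\<in>J. s i a * w i) \<partial>Pi\<^sub>M J (\<lambda>_. laplace 1) \<partial>distr M S X)"
      using J(1) by (intro nn_integral_cong) (auto simp: indicator_times indicator_def PiE_iff split: if_splits)
    also have "\<dots> = (\<integral>\<^sup>+p. indicator (A \<times> Pi\<^sub>E J B) (case p of (a, w) \<Rightarrow> (a, \<lambda>i\<in>J. s i a * w i)) \<partial>(distr M S X \<Otimes>\<^sub>M Pi\<^sub>M J (\<lambda>_. laplace 1)))"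
    proof -
      have m: "(\<lambda>p. indicator (A \<times> Pi\<^sub>E J B) (case p of (a, w) \<Rightarrow> (a, \<lambda>i\<in>J. s i a * w i)) :: ennreal)
          \<in> borel_measurable (distr M S X \<Otimes>\<^sub>M Pi\<^sub>M J (\<lambda>_. laplace 1))"
        by (rule measurable_compose[OF scale]) measurable
      show ?thesis
        by (subst sigma_finite_measure.nn_integral_fst[OF prob_space_imp_sigma_finite[OF PJ] m, symmetric]) simp
    qed
    also have "\<dots> = (\<integral>\<^sup>+p. indicator (A \<times> Pi\<^sub>E J B) p \<partial>?D2)"
      by (subst nn_integral_distr) auto
    also have "\<dots> = emeasure ?D2 (A \<times> Pi\<^sub>E J B)"
      by (rule nn_integral_indicator) auto
    finally show ?thesis .
  qed
  define E where "E = {a \<times> b |a b. a \<in> sets S \<and> b \<in> {Pi\<^sub>E J B |B. B \<in> (\<Pi> i\<in>J. sets (borel :: real measure))}}"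
  have sub: "{Pi\<^sub>E J B |B. B \<in> (\<Pi> i\<in>J. sets (borel :: real measure))} \<subseteq> sets (Pi\<^sub>M J (\<lambda>_. borel))"
    using J(1) by (auto intro!: sets_PiM_I_finite)
  have E_sub: "E \<subseteq> Pow (space ?R)"
  proof
    fix e assume "e \<in> E"
    then obtain a B where "e = a \<times> Pi\<^sub>E J B" "a \<in> sets S" "Pi\<^sub>E J B \<in> sets (Pi\<^sub>M J (\<lambda>_. borel :: real measure))"
      using sub unfolding E_def by blast
    then have "e \<in> sets ?R" by simp
    then show "e \<in> Pow (space ?R)"
      using sets.sets_into_space by blast
  qed
  have sets_R: "sets ?R = sigma_sets (space ?R) E"
  proof -
    have "sets ?R = sets (sigma (space S \<times> space (Pi\<^sub>M J (\<lambda>_. borel :: real measure))) E)"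
      unfolding E_def
    proof (rule sets_pair_eq[where Ca="{space S}" and Cb="{space (Pi\<^sub>M J (\<lambda>_. borel :: real measure))}"])
      show "sets (Pi\<^sub>M J (\<lambda>_. borel :: real measure)) = sigma_sets (space (Pi\<^sub>M J (\<lambda>_. borel))) {Pi\<^sub>E J B |B. B \<in> (\<Pi> i\<in>J. sets borel)}"
        unfolding sets_PiM prod_algebra_eq_finite[OF J(1)] space_PiM
        by (rule arg_cong[where f="sigma_sets _"]) (auto simp: Pi_iff)
    qed (use sub sets.sets_into_space in \<open>auto simp: sets.sigma_sets_eq space_PiM intro!: exI[of _ "\<lambda>_. UNIV"]\<close>)
    then show ?thesis
      using E_sub by (simp add: space_pair_measure)
  qed
  show ?thesis
  proof (rule measure_eqI_generator_eq[where E=E and A="\<lambda>_. space ?R" and \<Omega>="space ?R"])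
    show "Int_stable E"
      unfolding E_def
    proof (rule Int_stableI, clarsimp)
      fix a b :: "'a set" and B B' :: "_ \<Rightarrow> real set"
      assume "a \<in> sets S" "b \<in> sets S" "B \<in> J \<rightarrow> sets borel" "B' \<in> J \<rightarrow> sets borel"
      then show "\<exists>c d. a \<times> Pi\<^sub>E J B \<inter> b \<times> Pi\<^sub>E J B' = c \<times> d \<and> c \<in> sets S \<and> (\<exists>B. d = Pi\<^sub>E J B \<and> B \<in> J \<rightarrow> sets borel)"
        by (intro exI[of _ "a \<inter> b"] exI[of _ "Pi\<^sub>E J (\<lambda>i. B i \<inter> B' i)"] conjI exI[of _ "\<lambda>i. B i \<inter> B' i"])
           (auto simp: Times_Int_Times PiE_Int)
    qed
    show "E \<subseteq> Pow (space ?R)"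
      by (rule E_sub)
    show "range (\<lambda>_. space ?R) \<subseteq> E"
    proof -
      have "space ?R = space S \<times> Pi\<^sub>E J (\<lambda>_. UNIV)" "(\<lambda>_. UNIV) \<in> J \<rightarrow> sets (borel :: real measure)"
        by (auto simp: space_pair_measure space_PiM)
      then show ?thesis
        unfolding E_def by blast
    qed
    show "emeasure ?D1 (space ?R) \<noteq> \<infinity>"
      using M.prob_space_distr[OF joint, THEN prob_space.emeasure_space_1] by simp
  qed (auto simp: sets_R E_def Pi_iff intro!: eq)
qed

section \<open>Independence from characteristic functions\<close>

lemma (in prob_space) expectation_indicator_vimage:
  assumes [measurable]: "V \<in> measurable M N" "B \<in> sets N"
  shows "expectation (\<lambda>x. indicator B (V x)) = prob (V -` B \<inter> space M)"
proof -
  have "expectation (\<lambda>x. indicator B (V x)) = expectation (indicator (V -` B \<inter> space M))"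
    by (intro Bochner_Integration.integral_cong) (auto simp: indicator_def)
  also have "\<dots> = prob (V -` B \<inter> space M)"
    by simp
  finally show ?thesis .
qed

text \<open>If \<open>c\<close> has mean 0, it vanishes almost surely. Otherwise reweighting
  \<open>M\<close> by \<open>c\<close> over its mean gives a probability measure under which
  \<open>V\<close> keeps its characteristic function, hence its law.\<close>

lemma (in prob_space) cf_factor_nonneg:
  fixes V c :: "'a \<Rightarrow> real"
  assumes [measurable]: "V \<in> borel_measurable M" "c \<in> borel_measurable M"
    and c: "\<And>x. 0 \<le> c x" "integrable M c"
    and cf: "\<And>t. (CLINT x|M. c x * iexp (t * V x)) = (LINT x|M. c x) * (CLINT x|M. iexp (t * V x))"
    and B[measurable]: "B \<in> sets borel"
  shows "(LINT x|M. c x * indicator B (V x)) = (LINT x|M. c x) * prob (V -` B \<inter> space M)"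
proof (cases "(LINT x|M. c x) = 0")
  case True
  then have "AE x in M. c x = 0"
    using integral_nonneg_eq_0_iff_AE[OF c(2)] c(1) by simp
  then have "(LINT x|M. c x * indicator B (V x)) = (LINT x|M. 0)"
    by (intro integral_cong_AE) auto
  with True show ?thesis by simp
next
  case False
  define e where "e = (LINT x|M. c x)"
  have e: "0 < e"
    using False c(1) by (simp add: e_def less_le)
  define N where "N = density M (\<lambda>x. ennreal (c x / e))"
  have [measurable_cong, simp]: "sets N = sets M" by (simp add: N_def)
  interpret N: prob_space N
  proof
    have "emeasure N (space N) = (\<integral>\<^sup>+x. ennreal (c x / e) \<partial>M)"
      by (simp add: N_def emeasure_density cong: nn_integral_cong)
    also have "\<dots> = ennreal (LINT x|M. c x / e)"
      using c e by (intro nn_integral_eq_integral) auto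
    also have "\<dots> = 1"
      using e by (simp add: e_def)
    finally show "emeasure N (space N) = 1" .
  qed
  have "distr N borel V = distr M borel V"
  proof (rule Levy_uniqueness)
    show "real_distribution (distr N borel V)" "real_distribution (distr M borel V)"
      by (auto simp: real_distribution_def real_distribution_axioms_def intro!: N.prob_space_distr prob_space_distr)
    show "char (distr N borel V) = char (distr M borel V)"
    proof
      fix t
      have "char (distr N borel V) t = (CLINT x|N. iexp (t * V x))"
        unfolding char_def by (rule integral_distr) auto
      also have "\<dots> = (CLINT x|M. (c x / e) *\<^sub>R iexp (t * V x))"
        unfolding N_def using c e by (intro integral_density) auto
      also have "\<dots> = (CLINT x|M. (c x * iexp (t * V x)) / e)"
        by (simp add: scaleR_conv_of_real)
      also have "\<dots> = (CLINT x|M. iexp (t * V x))"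
        using e by (simp only: integral_divide_zero cf) (simp add: e_def)
      also have "\<dots> = char (distr M borel V) t"
        unfolding char_def by (rule integral_distr[symmetric]) auto
      finally show "char (distr N borel V) t = char (distr M borel V) t" .
    qed
  qed
  then have "measure (distr N borel V) B = measure (distr M borel V) B" by simp
  then have "(LINT x|N. indicator B (V x)) = prob (V -` B \<inter> space M)"
    using N.expectation_indicator_vimage[of V borel B] by (simp add: measure_distr)
  moreover have "(LINT x|N. (indicator B (V x) :: real)) = (LINT x|M. (c x / e) *\<^sub>R indicator B (V x))"
    unfolding N_def using c e by (intro integral_density) auto
  ultimately show ?thesis
    using e by (simp add: e_def[symmetric] field_simps)
qed

text \<open>Adding the constant \<open>K\<close> makes the weight nonnegative; a constant weight
  factors trivially, so it can be subtracted again.\<close>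

lemma (in prob_space) cf_factor_real:
  fixes V c :: "'a \<Rightarrow> real"
  assumes [measurable]: "V \<in> borel_measurable M" "c \<in> borel_measurable M"
    and bound: "\<And>x. \<bar>c x\<bar> \<le> K"
    and cf: "\<And>t. (CLINT x|M. c x * iexp (t * V x)) = (LINT x|M. c x) * (CLINT x|M. iexp (t * V x))"
    and B[measurable]: "B \<in> sets borel"
  shows "(LINT x|M. c x * indicator B (V x)) = (LINT x|M. c x) * prob (V -` B \<inter> space M)"
proof -
  have c: "integrable M c"
    using bound by (intro integrable_const_bound[of _ K]) auto
  have ind: "integrable M (\<lambda>x. indicator B (V x) :: real)"
    by (intro integrable_const_bound[of _ 1]) auto
  have cind: "integrable M (\<lambda>x. c x * indicator B (V x))"
    using bound by (intro integrable_const_bound[of _ K]) (auto simp: indicator_def intro: order_trans[OF abs_ge_zero])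
  have i1: "integrable M (\<lambda>x. iexp (t * V x))" for t
    by (intro integrable_const_bound[of _ 1]) auto
  have i2: "integrable M (\<lambda>x. c x * iexp (t * V x))" for t
    using bound by (intro integrable_const_bound[of _ K]) (auto simp: norm_mult)
  have prob: "(LINT x|M. indicator B (V x)) = prob (V -` B \<inter> space M)"
    by (rule expectation_indicator_vimage) (rule assms)+
  have "(LINT x|M. (c x + K) * indicator B (V x)) = (LINT x|M. c x + K) * prob (V -` B \<inter> space M)"
  proof (rule cf_factor_nonneg)
    show "0 \<le> c x + K" for x using bound[of x] by linarith
    show "(CLINT x|M. complex_of_real (c x + K) * iexp (t * V x)) = (LINT x|M. c x + K) * (CLINT x|M. iexp (t * V x))" for t
      using i1[of t] i2[of t] c cf[of t] by (simp add: distrib_right prob_space)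
  qed (use c in auto)
  then show ?thesis
    using c ind cind prob by (simp add: distrib_right prob_space)
qed

text \<open>Conjugating the hypothesis at frequency \<open>- t\<close> gives it for
  \<open>cnj C\<close> at \<open>t\<close>, and therefore for the real part, the mean of
  \<open>C\<close> and \<open>cnj C\<close>.\<close>

lemma (in prob_space) cf_factor_Re:
  fixes V :: "'a \<Rightarrow> real" and C :: "'a \<Rightarrow> complex"
  assumes [measurable]: "V \<in> borel_measurable M" "C \<in> borel_measurable M"
    and bound: "\<And>x. norm (C x) \<le> K"
    and cf: "\<And>t. (CLINT x|M. C x * iexp (t * V x)) = (CLINT x|M. C x) * (CLINT x|M. iexp (t * V x))"
    and B[measurable]: "B \<in> sets borel"
  shows "(LINT x|M. Re (C x) * indicator B (V x)) = (LINT x|M. Re (C x)) * prob (V -` B \<inter> space M)"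
proof -
  have C: "integrable M C"
    using bound by (intro integrable_const_bound[of _ K]) auto
  have iC: "integrable M (\<lambda>x. C x * iexp (t * V x))" for t
    using bound by (intro integrable_const_bound[of _ K]) (auto simp: norm_mult)

  have [measurable]: "(\<lambda>x. cnj (C x)) \<in> borel_measurable M"
    by (rule measurable_compose[OF assms(2) borel_measurable_continuous_onI]) (intro continuous_intros)
  have iexp_cnj: "cnj (iexp (- t * v)) = iexp (t * v)" for t v :: real
    by (simp add: exp_cnj)
  have cf': "(CLINT x|M. cnj (C x) * iexp (t * V x)) = cnj (CLINT x|M. C x) * (CLINT x|M. iexp (t * V x))" for t
  proof -
    have "(CLINT x|M. cnj (C x) * iexp (t * V x)) = (CLINT x|M. cnj (C x * iexp (- t * V x)))"
      by (simp only: complex_cnj_mult iexp_cnj)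
    also have "\<dots> = cnj ((CLINT x|M. C x) * (CLINT x|M. iexp (- t * V x)))"
      unfolding cf[symmetric] by (rule Bochner_Integration.integral_cnj)
    also have "\<dots> = cnj (CLINT x|M. C x) * (CLINT x|M. cnj (iexp (- t * V x)))"
      by (simp only: complex_cnj_mult Bochner_Integration.integral_cnj)
    finally show ?thesis by (simp only: iexp_cnj)
  qed
  have icC: "integrable M (\<lambda>x. cnj (C x) * iexp (t * V x))" for t
    using bound by (intro integrable_const_bound[of _ K]) (auto simp: norm_mult)
  show ?thesis
  proof (rule cf_factor_real)
    show "\<bar>Re (C x)\<bar> \<le> K" for x using bound abs_Re_le_cmod order_trans by blast
    fix t
    have Re: "complex_of_real (Re z) = (z + cnj z) / 2" for z by (simp add: complex_eq_iff)
    have "(CLINT x|M. Re (C x) * iexp (t * V x)) = (CLINT x|M. (C x * iexp (t * V x) + cnj (C x) * iexp (t * V x)) / 2)"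
      by (simp add: Re distrib_right)
    also have "\<dots> = ((CLINT x|M. C x * iexp (t * V x)) + (CLINT x|M. cnj (C x) * iexp (t * V x))) / 2"
      by (simp only: integral_divide_zero Bochner_Integration.integral_add[OF iC icC])
    also have "\<dots> = ((CLINT x|M. C x) + cnj (CLINT x|M. C x)) / 2 * (CLINT x|M. iexp (t * V x))"
      by (simp only: cf cf') (simp add: distrib_right)
    also have "\<dots> = (LINT x|M. Re (C x)) * (CLINT x|M. iexp (t * V x))"
      using C by (simp only: Re[symmetric] integral_Re)
    finally show "(CLINT x|M. Re (C x) * iexp (t * V x)) = (LINT x|M. Re (C x)) * (CLINT x|M. iexp (t * V x))" .
  qed auto
qed

text \<open>The real part is covered already, and the imaginary part is the real part of
  \<open>- \<i> * C\<close>, for which the hypothesis holds as well.\<close>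

lemma (in prob_space) cf_factor:
  fixes V :: "'a \<Rightarrow> real" and C :: "'a \<Rightarrow> complex"
  assumes [measurable]: "V \<in> borel_measurable M" "C \<in> borel_measurable M"
    and bound: "\<And>x. norm (C x) \<le> K"
    and cf: "\<And>t. (CLINT x|M. C x * iexp (t * V x)) = (CLINT x|M. C x) * (CLINT x|M. iexp (t * V x))"
    and B[measurable]: "B \<in> sets borel"
  shows "(CLINT x|M. C x * indicator B (V x)) = (CLINT x|M. C x) * prob (V -` B \<inter> space M)"
proof -
  have C: "integrable M C"
    using bound by (intro integrable_const_bound[of _ K]) auto
  have K: "0 \<le> K" using bound[of undefined] norm_ge_zero order_trans by blast
  have re: "(LINT x|M. Re (C x) * indicator B (V x)) = (LINT x|M. Re (C x)) * prob (V -` B \<inter> space M)"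
    using assms by (rule cf_factor_Re)
  have "(LINT x|M. Re (- \<i> * C x) * indicator B (V x)) = (LINT x|M. Re (- \<i> * C x)) * prob (V -` B \<inter> space M)"
  proof (rule cf_factor_Re[OF assms(1) _ _ _ B])
    show "norm (- \<i> * C x) \<le> K" for x
      using bound[of x] by (simp add: norm_mult)
    show "(CLINT x|M. - \<i> * C x * iexp (t * V x)) = (CLINT x|M. - \<i> * C x) * (CLINT x|M. iexp (t * V x))" for t
      by (simp only: mult.assoc integral_mult_right_zero cf)
  qed measurable
  then have im: "(LINT x|M. Im (C x) * indicator B (V x)) = (LINT x|M. Im (C x)) * prob (V -` B \<inter> space M)"
    by simp
  have Ci: "integrable M (\<lambda>x. C x * indicator B (V x))"
    using bound K by (intro integrable_const_bound[of _ K]) (auto simp: indicator_def)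
  show ?thesis
  proof (rule complex_eqI)
    show "Re (CLINT x|M. C x * indicator B (V x)) = Re ((CLINT x|M. C x) * prob (V -` B \<inter> space M))"
    proof -
      have "Re (CLINT x|M. C x * indicator B (V x)) = (LINT x|M. Re (C x * indicator B (V x)))"
        by (rule integral_Re[symmetric]) (rule Ci)
      also have "\<dots> = (LINT x|M. Re (C x) * indicator B (V x))"
        by (rule Bochner_Integration.integral_cong) (auto simp: indicator_def)
      also have "\<dots> = Re (CLINT x|M. C x) * prob (V -` B \<inter> space M)"
        by (simp only: re integral_Re[OF C])
      finally show ?thesis by simp
    qed
    show "Im (CLINT x|M. C x * indicator B (V x)) = Im ((CLINT x|M. C x) * prob (V -` B \<inter> space M))"
    proof -
      have "Im (CLINT x|M. C x * indicator B (V x)) = (LINT x|M. Im (C x * indicator B (V x)))"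
        by (rule integral_Im[symmetric]) (rule Ci)
      also have "\<dots> = (LINT x|M. Im (C x) * indicator B (V x))"
        by (rule Bochner_Integration.integral_cong) (auto simp: indicator_def)
      also have "\<dots> = Im (CLINT x|M. C x) * prob (V -` B \<inter> space M)"
        by (simp only: im integral_Im[OF C])
      finally show ?thesis by simp
    qed
  qed
qed

text \<open>Exponentials are exchanged for indicators one coordinate at a time. Each exchange
  regards all other factors as a bounded complex weight, so only uniqueness for one-dimensional
  characteristic functions is used.\<close>

lemma (in prob_space) indep_vars_of_cf:
  fixes V :: "'i \<Rightarrow> 'a \<Rightarrow> real"
  assumes I: "finite I" "I \<noteq> {}" and V: "\<And>i. i \<in> I \<Longrightarrow> V i \<in> borel_measurable M"
    and cf: "\<And>t. (CLINT x|M. (\<Prod>i\<in>I. iexp (t i * V i x))) = (\<Prod>i\<in>I. CLINT x|M. iexp (t i * V i x))"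
  shows "indep_vars (\<lambda>_. borel) V I"
proof -
  \<comment> \<open>\<open>K\<close> collects the coordinates that already carry indicators; the
    frequencies of the others stay arbitrary, which is what the induction needs.\<close>
  have main: "(CLINT x|M. (\<Prod>i\<in>K. indicator (B i) (V i x)) * (\<Prod>i\<in>I - K. iexp (t i * V i x)))
      = (\<Prod>i\<in>K. complex_of_real (prob (V i -` B i \<inter> space M))) * (\<Prod>i\<in>I - K. CLINT x|M. iexp (t i * V i x))"
    if "K \<subseteq> I" "\<And>i. i \<in> I \<Longrightarrow> B i \<in> sets borel" for K B t
    using finite_subset[OF that(1) I(1)] that
  proof (induction K arbitrary: t rule: finite_induct)
    case empty
    then show ?case using cf by simp
  next
    case (insert k K)
    note [measurable] = V insert.prems(2)
    define C where "C x = (\<Prod>i\<in>K. indicator (B i) (V i x)) * (\<Prod>i\<in>I - insert k K. iexp (t i * V i x))" for x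
    have k: "k \<in> I" "K \<subseteq> I" using insert by auto
    have Ik: "I - K = insert k (I - insert k K)" using insert by auto
    have split: "(\<Prod>i\<in>I - K. f i) = f k * (\<Prod>i\<in>I - insert k K. f i)" for f :: "'i \<Rightarrow> complex"
      unfolding Ik using I by (subst prod.insert) auto
    \<comment> \<open>The frequency at \<open>k\<close> becomes a free \<open>r\<close>, since
      uniqueness needs the factorization for every frequency; \<open>r = 0\<close> then yields the
      mean of the weight \<open>C\<close>.\<close>
    have IH: "(CLINT x|M. C x * iexp (r * V k x)) =
        (\<Prod>i\<in>K. complex_of_real (prob (V i -` B i \<inter> space M))) * (\<Prod>i\<in>I - insert k K. CLINT x|M. iexp (t i * V i x)) * (CLINT x|M. iexp (r * V k x))" for r
    proof -
      have "(CLINT x|M. (\<Prod>i\<in>K. indicator (B i) (V i x)) * (\<Prod>i\<in>I - K. iexp ((t(k := r)) i * V i x)))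
        = (\<Prod>i\<in>K. complex_of_real (prob (V i -` B i \<inter> space M))) * (\<Prod>i\<in>I - K. CLINT x|M. iexp ((t(k := r)) i * V i x))"
        using insert.prems by (intro insert.IH) auto
      moreover have "(\<Prod>i\<in>I - insert k K. iexp ((t(k := r)) i * V i x)) = (\<Prod>i\<in>I - insert k K. iexp (t i * V i x))" for x
        by (rule prod.cong) auto
      moreover have "(\<Prod>i\<in>I - insert k K. CLINT x|M. iexp ((t(k := r)) i * V i x)) = (\<Prod>i\<in>I - insert k K. CLINT x|M. iexp (t i * V i x))"
        by (rule prod.cong) auto
      ultimately show ?thesis
        unfolding split C_def by (simp add: mult_ac)
    qed
    have EC: "(CLINT x|M. C x) = (\<Prod>i\<in>K. complex_of_real (prob (V i -` B i \<inter> space M))) * (\<Prod>i\<in>I - insert k K. CLINT x|M. iexp (t i * V i x))"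
      using IH[of 0] by (simp add: prob_space)
    have "(CLINT x|M. C x * indicator (B k) (V k x)) = (CLINT x|M. C x) * prob (V k -` B k \<inter> space M)"
    proof (rule cf_factor[where K=1])
      show "V k \<in> borel_measurable M" using k by measurable
      have "(\<lambda>x. indicator (B i) (V i x) :: complex) \<in> borel_measurable M" if "i \<in> I" for i
        using V[OF that] insert.prems(2)[OF that] by measurable
      moreover have "(\<lambda>x. iexp (t i * V i x)) \<in> borel_measurable M" if "i \<in> I" for i
        using V[OF that] by measurable
      ultimately show "C \<in> borel_measurable M"
        unfolding C_def using k by (intro borel_measurable_times borel_measurable_prod) auto
      have "norm (\<Prod>i\<in>K. indicator (B i) (V i x) :: complex) \<le> 1" for x
        unfolding prod_norm[symmetric] by (intro prod_le_1) (auto simp: indicator_def)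
      moreover have "norm (\<Prod>i\<in>I - insert k K. iexp (t i * V i x)) = 1" for x
        unfolding prod_norm[symmetric] by simp
      ultimately show "norm (C x) \<le> 1" for x
        unfolding C_def norm_mult by simp
    qed (use IH EC insert.prems in auto)
    moreover have "(\<Prod>i\<in>insert k K. indicator (B i) (V i x)) * (\<Prod>i\<in>I - insert k K. iexp (t i * V i x))
        = C x * indicator (B k) (V k x)" for x
      using insert.hyps unfolding C_def by (simp add: mult_ac)
    ultimately show ?case
      using insert.hyps(1,2) by (simp only: EC prod.insert simp_thms if_False) (simp only: mult_ac)
  qed
  show ?thesis
  proof (subst indep_vars_finite[where E="\<lambda>_. sets borel"])
    show "\<forall>A\<in>I \<rightarrow> sets borel. prob (\<Inter>j\<in>I. V j -` A j \<inter> space M) = (\<Prod>j\<in>I. prob (V j -` A j \<inter> space M))"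
    proof
      fix A assume A: "A \<in> I \<rightarrow> sets (borel :: real measure)"
      have ms: "(\<Inter>j\<in>I. V j -` A j \<inter> space M) \<in> events"
        using A V I by (intro sets.finite_INT) (auto intro: measurable_sets)
      have "(CLINT x|M. (\<Prod>i\<in>I. indicator (A i) (V i x))) = (\<Prod>i\<in>I. complex_of_real (prob (V i -` A i \<inter> space M)))"
        using main[of I A] A by auto
      also have "(CLINT x|M. (\<Prod>i\<in>I. indicator (A i) (V i x))) = (CLINT x|M. complex_of_real (indicator (\<Inter>j\<in>I. V j -` A j \<inter> space M) x))"
        using I by (intro Bochner_Integration.integral_cong refl) (auto simp: indicator_def)
      also have "\<dots> = complex_of_real (prob (\<Inter>j\<in>I. V j -` A j \<inter> space M))"
        using ms by (subst integral_complex_of_real) simp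
      finally show "prob (\<Inter>j\<in>I. V j -` A j \<inter> space M) = (\<Prod>j\<in>I. prob (V j -` A j \<inter> space M))"
        by (simp flip: of_real_prod)
    qed
  qed (use I V in \<open>auto simp: Int_stable_def sets.sigma_sets_eq[of borel, simplified]\<close>)
qed

section \<open>The Poisson process of intensity \<open>2 / t\<close>\<close>

text \<open>The probability generating function of the Poisson law, from the exponential series with
  argument \<open>r * c\<close>.\<close>

lemma integral_poisson_power:
  fixes c r :: real
  assumes r: "0 < r" and c: "0 \<le> c" "c \<le> 1"
  shows "(LINT k|measure_pmf (poisson_pmf r). c ^ k) = exp (- ((1 - c) * r))"
proof -
  have sums: "(\<lambda>k. r ^ k / fact k * exp (- r) * c ^ k) sums exp (- ((1 - c) * r))"
  proof -
    have "(\<lambda>k. exp (- r) * ((r * c) ^ k /\<^sub>R fact k)) sums (exp (- r) * exp (r * c))"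
      by (intro sums_mult exp_converges)
    then show ?thesis
      by (simp add: exp_add[symmetric] algebra_simps power_mult_distrib divide_inverse)
  qed
  have int: "integrable (count_space UNIV) (\<lambda>k. r ^ k / fact k * exp (- r) * c ^ k)"
    using sums r c by (auto simp: integrable_count_space_nat_iff sums_iff)
  have "(LINT k|measure_pmf (poisson_pmf r). c ^ k) = (LINT k|count_space UNIV. r ^ k / fact k * exp (- r) * c ^ k)"
    unfolding measure_pmf_eq_density using r by (subst integral_density) auto
  also have "\<dots> = exp (- ((1 - c) * r))"
    using integral_count_space_nat[OF int] sums by (simp add: sums_iff)
  finally show ?thesis .
qed

lemma integral_two_div:
  fixes s t :: real
  assumes "0 < s" "s \<le> t"
  shows "integral {s..t} (\<lambda>r. 2 / r) = 2 * ln (t / s)"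
proof -
  have "((\<lambda>r. 2 / r) has_integral (2 * ln t - 2 * ln s)) {s..t}"
    using assms by (intro fundamental_theorem_of_calculus)
      (auto intro!: derivative_eq_intros simp: has_real_derivative_iff_has_vector_derivative[symmetric])
  then have "integral {s..t} (\<lambda>r. 2 / r) = 2 * ln t - 2 * ln s"
    by (rule integral_unique)
  then show ?thesis
    using assms by (simp add: ln_div)
qed

text \<open>Concavity of \<open>ln\<close> for the numbers 1 and \<open>y / x\<close> with weights
  \<open>1 / (1 + x)\<close> and \<open>x / (1 + x)\<close>; their weighted mean is
  \<open>(1 + y) / (1 + x)\<close>.\<close>

lemma weighted_ln_le:
  fixes x y :: real
  assumes "0 < x" "0 < y"
  shows "x / (1 + x) * ln (y / x) \<le> ln ((1 + y) / (1 + x))"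
proof -
  define r where "r = (1 + y) / (1 + x)"
  have r: "0 < r" using assms by (simp add: r_def)
  \<comment> \<open>The bound \<open>ln z \<le> z - 1\<close> is applied to each number divided by
    the mean \<open>r\<close>; the weighted sum of the right-hand sides is exactly 0.\<close>
  have 1: "ln (1 / r) \<le> 1 / r - 1" "ln ((y / x) / r) \<le> (y / x) / r - 1"
    using r assms by (intro ln_le_minus_one; simp)+
  have "x / (1 + x) * ln (y / x) - ln r = 1 / (1 + x) * ln (1 / r) + x / (1 + x) * ln ((y / x) / r)"
  proof -
    have "ln ((y / x) / r) = ln (y / x) - ln r" "ln (1 / r) = - ln r"
      using r assms by (simp_all add: ln_div ln_mult)
    moreover have "1 / (1 + x) = 1 - x / (1 + x)"
      using assms by (simp add: field_simps)
    ultimately show ?thesis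
      by (simp only:) (simp only: algebra_simps mult_1_left mult_minus_right)
  qed
  also have "\<dots> \<le> 1 / (1 + x) * (1 / r - 1) + x / (1 + x) * ((y / x) / r - 1)"
    using 1 assms by (intro add_mono mult_left_mono) auto
  also have "\<dots> = 0"
    using assms unfolding r_def by (simp add: divide_simps) (simp add: algebra_simps)
  finally show ?thesis by (simp add: r_def)
qed

section \<open>Factors attached to a single time cell\<close>

definition cauchy_factor :: "real \<Rightarrow> real" where
  "cauchy_factor y = 1 / (1 + y\<^sup>2)"

lemma cauchy_factor_bounds: "0 < cauchy_factor y" "cauchy_factor y \<le> 1"
proof -
  have "0 < 1 + y\<^sup>2" by (simp add: add_pos_nonneg)
  then show "0 < cauchy_factor y" "cauchy_factor y \<le> 1"
    by (simp_all add: cauchy_factor_def)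
qed

lemma cauchy_factor_antimono:
  assumes "0 \<le> a" "a \<le> b"
  shows "cauchy_factor (b * t) \<le> cauchy_factor (a * t)"
proof -
  have "(a * t)\<^sup>2 \<le> (b * t)\<^sup>2"
    using assms by (simp add: power_mult_distrib mult_right_mono power_mono)
  then show ?thesis
    unfolding cauchy_factor_def by (intro divide_left_mono) (auto simp: add_pos_nonneg)
qed

text \<open>The quotient of \<open>cauchy_factor (b * t)\<close> by
  \<open>cauchy_factor (a * t)\<close>. It will be the characteristic function of the increment over
  \<open>(a, b]\<close>, and as a quotient it multiplies along adjacent cells.\<close>

definition increment_factor :: "real \<Rightarrow> real \<Rightarrow> real \<Rightarrow> real" where
  "increment_factor a b t = (1 + (a * t)\<^sup>2) / (1 + (b * t)\<^sup>2)"

lemma increment_factor_nonneg: "0 \<le> increment_factor a b t"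
  by (simp add: increment_factor_def)

lemma increment_factor_trans:
  "increment_factor a b t * increment_factor b c t = increment_factor a c t"
proof -
  have "1 + (b * t)\<^sup>2 \<noteq> 0" by (metis add_pos_nonneg less_numeral_extra(1) less_numeral_extra(3) zero_le_power2)
  then show ?thesis by (simp add: increment_factor_def)
qed

text \<open>The outer terms are Poisson generating functions of mean \<open>2 * ln (b / a)\<close>,
  evaluated at the factors of the two endpoints, so they also bracket the expected product over the
  jumps. Both bounds are the weighted logarithm inequality for the squares of \<open>a * t\<close>
  and \<open>b * t\<close>, once in each order.\<close>

lemma increment_factor_bounds:
  assumes "0 < a" "a \<le> b"
  shows "exp (- ((1 - cauchy_factor (b * t)) * (2 * ln (b / a)))) \<le> increment_factor a b t"
    and "increment_factor a b t \<le> exp (- ((1 - cauchy_factor (a * t)) * (2 * ln (b / a))))"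
proof -
  have pos: "0 < 1 + y\<^sup>2" for y :: real by (simp add: add_pos_nonneg)
  have c: "1 - cauchy_factor y = y\<^sup>2 / (1 + y\<^sup>2)" for y
    using pos[of y] by (simp add: cauchy_factor_def field_simps)
  have key: "(1 - cauchy_factor (p * t)) * (2 * ln (q / p)) \<le> ln ((1 + (q * t)\<^sup>2) / (1 + (p * t)\<^sup>2))"
    if "0 < p" "0 < q" for p q
  proof (cases "t = 0")
    case False
    have "(q * t)\<^sup>2 / (p * t)\<^sup>2 = (q / p)\<^sup>2"
      using False that by (simp add: power_mult_distrib power_divide)
    then have "2 * ln (q / p) = ln ((q * t)\<^sup>2 / (p * t)\<^sup>2)"
      using that by (simp add: ln_realpow)
    then show ?thesis
      using weighted_ln_le[of "(p * t)\<^sup>2" "(q * t)\<^sup>2"] that False by (simp add: c)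
  qed (simp add: cauchy_factor_def)
  have b: "0 < b" using assms by simp
  have e: "increment_factor a b t = exp (- ln ((1 + (b * t)\<^sup>2) / (1 + (a * t)\<^sup>2)))"
    using pos[of "a * t"] pos[of "b * t"] by (simp add: increment_factor_def exp_minus ln_div exp_diff)
  show "increment_factor a b t \<le> exp (- ((1 - cauchy_factor (a * t)) * (2 * ln (b / a))))"
    unfolding e using key[OF assms(1) b] by simp
  have "ln ((1 + (a * t)\<^sup>2) / (1 + (b * t)\<^sup>2)) = - ln ((1 + (b * t)\<^sup>2) / (1 + (a * t)\<^sup>2))"
    using pos[of "a * t"] pos[of "b * t"] by (simp add: ln_div)
  moreover have "ln (a / b) = - ln (b / a)" using assms b by (simp add: ln_div)
  ultimately show "exp (- ((1 - cauchy_factor (b * t)) * (2 * ln (b / a)))) \<le> increment_factor a b t"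
    unfolding e using key[OF b assms(1)] by simp
qed

text \<open>The bound is uniform in \<open>t\<close>: the denominator is at least
  \<open>(b * t)^2\<close>, so the difference is at most \<open>1 - (a / b)^2\<close>, and
  \<open>1 - z \<le> - ln z\<close> turns this into the Poisson mass of \<open>(a, b]\<close>. It
  makes the error of a cell quadratic in its mass.\<close>

lemma cauchy_factor_diff_le:
  assumes "0 < a" "a \<le> b"
  shows "cauchy_factor (a * t) - cauchy_factor (b * t) \<le> 2 * ln (b / a)"
proof -
  have pos: "0 < 1 + y\<^sup>2" for y :: real by (simp add: add_pos_nonneg)
  have "cauchy_factor (a * t) - cauchy_factor (b * t) = ((b * t)\<^sup>2 - (a * t)\<^sup>2) / ((1 + (a * t)\<^sup>2) * (1 + (b * t)\<^sup>2))"
    using pos[of "a * t"] pos[of "b * t"] unfolding cauchy_factor_def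
    by (subst diff_frac_eq) (auto simp: less_imp_neq[symmetric])
  also have "\<dots> \<le> 1 - (a / b)\<^sup>2"
  proof (cases "t = 0")
    case False
    have le: "(b * t)\<^sup>2 \<le> (1 + (a * t)\<^sup>2) * (1 + (b * t)\<^sup>2)"
    proof -
      have "1 * (b * t)\<^sup>2 \<le> (1 + (a * t)\<^sup>2) * (1 + (b * t)\<^sup>2)"
        by (intro mult_mono) auto
      then show ?thesis by simp
    qed
    have nn: "0 \<le> (b * t)\<^sup>2 - (a * t)\<^sup>2"
      using assms by (simp add: power_mult_distrib mult_right_mono power_mono)
    have "((b * t)\<^sup>2 - (a * t)\<^sup>2) / ((1 + (a * t)\<^sup>2) * (1 + (b * t)\<^sup>2)) \<le> ((b * t)\<^sup>2 - (a * t)\<^sup>2) / (b * t)\<^sup>2"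
      using le nn False assms pos[of "a * t"] pos[of "b * t"] by (intro divide_left_mono) auto
    also have "\<dots> = 1 - (a / b)\<^sup>2"
      using False assms by (simp add: power_mult_distrib power_divide diff_divide_distrib)
    finally show ?thesis .
  qed (use assms in \<open>simp add: power_le_one\<close>)
  also have "\<dots> \<le> - ln ((a / b)\<^sup>2)"
    using ln_le_minus_one[of "(a / b)\<^sup>2"] assms by simp
  also have "\<dots> = 2 * ln (b / a)"
    using assms by (simp add: ln_realpow ln_div)
  finally show ?thesis .
qed

lemma exp_diff_le:
  fixes u v :: real
  assumes "0 \<le> u" "u \<le> v"
  shows "exp (- u) - exp (- v) \<le> v - u"
proof -
  have "exp (- u) - exp (- v) = exp (- u) * (1 - exp (- (v - u)))"
    by (simp add: algebra_simps exp_add[symmetric])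
  also have "\<dots> \<le> 1 * (v - u)"
    using assms exp_ge_add_one_self[of "- (v - u)"] by (intro mult_mono) (auto simp: algebra_simps)
  finally show ?thesis by simp
qed

section \<open>Counts and jump times\<close>

locale log_poisson = prob_space M for M :: "'w measure" +
  fixes \<eta> :: real and P :: "real \<Rightarrow> 'w \<Rightarrow> nat"
  assumes \<eta>: "0 < \<eta>" and poisson: "inhom_poisson_process M \<eta> (\<lambda>t. 2 / t) P"
begin

lemma count_measurable [measurable]: "\<eta> \<le> t \<Longrightarrow> P t \<in> measurable M (count_space UNIV)"
  using poisson by (simp add: inhom_poisson_process_def)

lemma count_start: "x \<in> space M \<Longrightarrow> P \<eta> x = 0"
  using poisson by (simp add: inhom_poisson_process_def)

lemma count_mono: "x \<in> space M \<Longrightarrow> \<eta> \<le> s \<Longrightarrow> s \<le> t \<Longrightarrow> P s x \<le> P t x"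
  using poisson by (auto simp: inhom_poisson_process_def mono_on_def)

lemma count_right_cont:
  assumes "x \<in> space M" "\<eta> \<le> t"
  shows "eventually (\<lambda>s. P s x = P t x) (at_right t)"
proof -
  have "continuous (at_right t) (\<lambda>s. P s x)"
    using poisson assms by (simp add: inhom_poisson_process_def)
  then have "((\<lambda>s. P s x) \<longlongrightarrow> P t x) (at_right t)"
    by (simp add: continuous_within)
  then show ?thesis
    by (simp add: tendsto_discrete)
qed

text \<open>A right-continuous path with values in the naturals is constant for a short while to the
  right of \<open>t\<close>.\<close>

lemma count_seq:
  assumes "x \<in> space M" "\<eta> \<le> t" "f \<longlonglongrightarrow> t" "\<And>m. t \<le> f m"
  shows "eventually (\<lambda>m. P (f m) x = P t x) sequentially"
proof -
  obtain b where b: "t < b" "\<And>s. t < s \<Longrightarrow> s < b \<Longrightarrow> P s x = P t x"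
    using count_right_cont[OF assms(1,2)] by (auto simp: eventually_at_right_field)
  have "eventually (\<lambda>m. f m < b) sequentially"
    using assms(3) b(1) by (rule order_tendstoD)
  then show ?thesis
    by eventually_elim (metis assms(4) b(2) order_le_less)
qed

lemma count_diff_measurable:
  assumes [simp]: "\<eta> \<le> s" "\<eta> \<le> t"
  shows "(\<lambda>x. P t x - P s x) \<in> measurable M (count_space UNIV)"
  by measurable

lemma expectation_count_powers_strict:
  fixes c :: "nat \<Rightarrow> real"
  assumes t: "\<eta> \<le> t 0" "\<And>i. i < m \<Longrightarrow> t i < t (Suc i)" and c: "\<And>i. i < m \<Longrightarrow> 0 \<le> c i \<and> c i \<le> 1"
  shows "expectation (\<lambda>x. \<Prod>i<m. c i ^ (P (t (Suc i)) x - P (t i) x)) =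
    (\<Prod>i<m. exp (- ((1 - c i) * (2 * ln (t (Suc i) / t i)))))"
proof -
  have ge: "\<eta> \<le> t i" if "i \<le> m" for i
    using that
  proof (induction i)
    case (Suc i)
    then show ?case using t(2)[of i] by simp
  qed (use t in simp)
  have D[measurable]: "(\<lambda>x. P (t (Suc i)) x - P (t i) x) \<in> measurable M (count_space UNIV)" if "i < m" for i
    using ge[of i] ge[of "Suc i"] that by (intro count_diff_measurable) auto
  have "indep_vars (\<lambda>_. count_space UNIV) (\<lambda>i x. P (t (Suc i)) x - P (t i) x) {..<m}"
    using poisson t by (auto simp: inhom_poisson_process_def)
  then have ind: "indep_vars (\<lambda>_. borel) (\<lambda>i x. c i ^ (P (t (Suc i)) x - P (t i) x)) {..<m}"
    by (rule indep_vars_compose2) auto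
  have int: "integrable M (\<lambda>x. c i ^ (P (t (Suc i)) x - P (t i) x))" if "i < m" for i
  proof (rule integrable_const_bound[of _ 1])
    show "AE x in M. norm (c i ^ (P (t (Suc i)) x - P (t i) x)) \<le> 1"
      using c[OF that] by (auto simp: power_le_one)
    show "(\<lambda>x. c i ^ (P (t (Suc i)) x - P (t i) x)) \<in> borel_measurable M"
      using measurable_compose[OF D[OF that], of "\<lambda>k. c i ^ k"] by simp
  qed
  have "expectation (\<lambda>x. \<Prod>i<m. c i ^ (P (t (Suc i)) x - P (t i) x)) =
     (\<Prod>i<m. expectation (\<lambda>x. c i ^ (P (t (Suc i)) x - P (t i) x)))"
    using ind int by (intro indep_vars_lebesgue_integral) auto
  also have "\<dots> = (\<Prod>i<m. exp (- ((1 - c i) * (2 * ln (t (Suc i) / t i)))))"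
  proof (rule prod.cong[OF refl])
    fix i assume i: "i \<in> {..<m}"
    have pos: "0 < t i" "t i < t (Suc i)" using ge[of i] \<eta> i t(2)[of i] by auto
    then have rate: "0 < 2 * ln (t (Suc i) / t i)" by simp
    have "expectation (\<lambda>x. c i ^ (P (t (Suc i)) x - P (t i) x)) =
        (LINT k|distr M (count_space UNIV) (\<lambda>x. P (t (Suc i)) x - P (t i) x). c i ^ k)"
      using D i by (subst integral_distr) auto
    also have "distr M (count_space UNIV) (\<lambda>x. P (t (Suc i)) x - P (t i) x) = measure_pmf (poisson_pmf (2 * ln (t (Suc i) / t i)))"
      using poisson ge[of i] pos i by (simp add: inhom_poisson_process_def integral_two_div)
    finally show "expectation (\<lambda>x. c i ^ (P (t (Suc i)) x - P (t i) x)) = exp (- ((1 - c i) * (2 * ln (t (Suc i) / t i))))"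
      using integral_poisson_power[OF rate] c i by simp
  qed
  finally show ?thesis .
qed

lemma count_powers_measurable:
  assumes "\<And>i. i < m \<Longrightarrow> \<eta> \<le> t i \<and> \<eta> \<le> t (Suc i)"
  shows "(\<lambda>x. \<Prod>i<m. (c i :: real) ^ (P (t (Suc i)) x - P (t i) x)) \<in> borel_measurable M"
proof (rule borel_measurable_prod)
  fix i assume "i \<in> {..<m}"
  then have "(\<lambda>x. P (t (Suc i)) x - P (t i) x) \<in> measurable M (count_space UNIV)"
    using assms[of i] by (intro count_diff_measurable) auto
  then show "(\<lambda>x. c i ^ (P (t (Suc i)) x - P (t i) x)) \<in> borel_measurable M"
    by (rule measurable_compose[of _ _ _ "\<lambda>k. c i ^ k"]) simp
qed

text \<open>The definition of the process gives independent increments along strictly increasing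
  times only. Coinciding times are reached as a limit from the right, with integrands bounded by
  1.\<close>

lemma expectation_count_powers:
  fixes c :: "nat \<Rightarrow> real"
  assumes t: "\<eta> \<le> t 0" "\<And>i. i < m \<Longrightarrow> t i \<le> t (Suc i)" and c: "\<And>i. i < m \<Longrightarrow> 0 \<le> c i \<and> c i \<le> 1"
  shows "expectation (\<lambda>x. \<Prod>i<m. c i ^ (P (t (Suc i)) x - P (t i) x)) =
    (\<Prod>i<m. exp (- ((1 - c i) * (2 * ln (t (Suc i) / t i)))))"
proof -
  let ?p = "\<lambda>t x. \<Prod>i<m. c i ^ (P (t (Suc i)) x - P (t i) x)"
  have ge: "\<eta> \<le> t i" if "i \<le> m" for i
    using that by (induction i) (use t in \<open>auto intro: order_trans\<close>)
  \<comment> \<open>Moving the time of index \<open>i\<close> by \<open>i / (q + 1)\<close>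
    separates coinciding times and never moves a time to the left.\<close>
  define T where "T q i = t i + real i * inverse (real (Suc q))" for q i
  have T_ge: "t i \<le> T q i" for q i by (simp add: T_def)
  have T_lim: "(\<lambda>q. T q i) \<longlonglongrightarrow> t i" for i
  proof -
    have "(\<lambda>q. t i + real i * inverse (real (Suc q))) \<longlonglongrightarrow> t i + real i * 0"
      by (intro tendsto_intros LIMSEQ_inverse_real_of_nat)
    then show ?thesis by (simp add: T_def)
  qed
  have T_strict: "T q i < T q (Suc i)" if "i < m" for q i
    unfolding T_def using t(2)[OF that] by (intro add_le_less_mono mult_strict_right_mono) auto
  have strict: "expectation (\<lambda>x. ?p (T q) x) =
    (\<Prod>i<m. exp (- ((1 - c i) * (2 * ln (T q (Suc i) / T q i)))))" for q
    using t T_strict c by (intro expectation_count_powers_strict) (auto simp: T_def)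
  have "(\<lambda>q. expectation (\<lambda>x. ?p (T q) x))
    \<longlonglongrightarrow> expectation (\<lambda>x. ?p t x)"
  proof (rule integral_dominated_convergence[where w="\<lambda>_. 1"])
    show "(\<lambda>x. ?p t x) \<in> borel_measurable M"
      using ge by (intro count_powers_measurable) auto
    show "(\<lambda>x. ?p (T q) x) \<in> borel_measurable M" for q
      using ge T_ge by (intro count_powers_measurable) (meson Suc_leI less_imp_le order_trans)
    show "AE x in M. (\<lambda>q. ?p (T q) x) \<longlonglongrightarrow> (?p t x)"
    proof (rule AE_I2, rule tendsto_prod)
      fix x i assume x: "x \<in> space M" and i: "i \<in> {..<m}"
      have ev: "eventually (\<lambda>q. P (T q i) x = P (t i) x) sequentially"
        "eventually (\<lambda>q. P (T q (Suc i)) x = P (t (Suc i)) x) sequentially"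
        using x i ge T_ge T_lim by (auto intro!: count_seq)
      show "(\<lambda>q. c i ^ (P (T q (Suc i)) x - P (T q i) x)) \<longlonglongrightarrow> c i ^ (P (t (Suc i)) x - P (t i) x)"
        by (rule tendsto_eventually, use ev in eventually_elim) simp
    qed
    have "norm (?p (T q) x) \<le> 1" for q x
      using c unfolding prod_norm[symmetric] by (intro prod_le_1) (simp add: power_le_one)
    then show "AE x in M. norm (?p (T q) x) \<le> 1" for q
      by simp
  qed simp
  moreover have "(\<lambda>q. \<Prod>i<m. exp (- ((1 - c i) * (2 * ln (T q (Suc i) / T q i)))))
    \<longlonglongrightarrow> (\<Prod>i<m. exp (- ((1 - c i) * (2 * ln (t (Suc i) / t i)))))"
  proof (intro tendsto_intros T_lim)
    fix i assume "i \<in> {..<m}"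
    then show "t i \<noteq> 0" "t (Suc i) / t i \<noteq> 0"
      using ge[of i] ge[of "Suc i"] \<eta> by auto
  qed
  ultimately show ?thesis
    unfolding strict by (rule LIMSEQ_unique)
qed

text \<open>A count staying below \<open>n\<close> with positive probability would keep the mean of
  \<open>(1 / 2) ^ P\<close> away from 0, but at time \<open>\<eta> + k\<close> this mean is
  \<open>\<eta> / (\<eta> + k)\<close>. The base 1/2 cancels the 2 of the intensity.\<close>

lemma count_unbounded: "AE x in M. \<forall>n. \<exists>t\<ge>\<eta>. n \<le> P t x"
  unfolding AE_all_countable
proof
  fix n
  define B where "B = {x \<in> space M. \<forall>k. P (\<eta> + real k) x < n}"
  have B[measurable]: "B \<in> events"
    unfolding B_def using \<eta> by measurable
  have bound: "prob B * (1 / 2) ^ n \<le> \<eta> / (\<eta> + real k)" for k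
  proof -
    have "expectation (\<lambda>x. \<Prod>i<(1::nat). (1 / 2) ^ (P ((\<lambda>i. \<eta> + real i * real k) (Suc i)) x - P ((\<lambda>i. \<eta> + real i * real k) i) x))
      = (\<Prod>i<(1::nat). exp (- ((1 - 1 / 2) * (2 * ln ((\<lambda>i. \<eta> + real i * real k) (Suc i) / (\<lambda>i. \<eta> + real i * real k) i)))))"
      by (rule expectation_count_powers) (auto simp: field_simps)
    then have "expectation (\<lambda>x. (1 / 2) ^ (P (\<eta> + real k) x - P \<eta> x)) = exp (- ln ((\<eta> + real k) / \<eta>))"
      by simp
    also have "exp (- ln ((\<eta> + real k) / \<eta>)) = \<eta> / (\<eta> + real k)"
      using \<eta> by (simp add: exp_minus)
    also have "expectation (\<lambda>x. (1 / 2 :: real) ^ (P (\<eta> + real k) x - P \<eta> x)) = expectation (\<lambda>x. (1 / 2) ^ P (\<eta> + real k) x)"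
      by (intro Bochner_Integration.integral_cong) (auto simp: count_start)
    finally have e: "expectation (\<lambda>x. (1 / 2) ^ P (\<eta> + real k) x) = \<eta> / (\<eta> + real k)" .
    have "prob B * (1 / 2) ^ n = expectation (\<lambda>x. indicator B x * (1 / 2) ^ n)"
      by (simp add: emeasure_eq_measure)
    also have "\<dots> \<le> expectation (\<lambda>x. (1 / 2) ^ P (\<eta> + real k) x)"
    proof (rule integral_mono)
      have "(\<lambda>x. (1 / 2 :: real) ^ P (\<eta> + real k) x) \<in> borel_measurable M"
        by (rule measurable_compose[of "P (\<eta> + real k)" _ "count_space UNIV"]) auto
      then show "integrable M (\<lambda>x. (1 / 2 :: real) ^ P (\<eta> + real k) x)"
        by (intro integrable_const_bound[of _ 1]) (auto simp: power_le_one)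
      show "integrable M (\<lambda>x. indicat_real B x * (1 / 2) ^ n)"
        by (intro integrable_mult_left integrable_real_indicator) (auto simp: emeasure_eq_measure)
      show "indicat_real B x * (1 / 2) ^ n \<le> (1 / 2) ^ P (\<eta> + real k) x" for x
        by (auto simp: indicator_def B_def intro!: power_decreasing less_imp_le)
    qed
    finally show ?thesis unfolding e .
  qed
  have "(\<lambda>k. \<eta> / (\<eta> + real k)) \<longlonglongrightarrow> 0"
    by (rule real_tendsto_divide_at_top[OF tendsto_const])
       (intro filterlim_tendsto_add_at_top[OF tendsto_const] filterlim_real_sequentially)
  then have "prob B * (1 / 2) ^ n \<le> 0"
    by (rule LIMSEQ_le_const) (use bound in auto)
  then have "prob B = 0"
    using zero_less_power[of "1 / 2 :: real" n]
    by (metis half_gt_zero_iff measure_nonneg mult_le_0_iff not_le order_antisym zero_less_one)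
  then have "AE x in M. x \<notin> B"
    using prob_eq_0[OF B] by blast
  then show "AE x in M. \<exists>t\<ge>\<eta>. n \<le> P t x"
    using AE_space
  proof eventually_elim
    case (elim x)
    then obtain k where "n \<le> P (\<eta> + real k) x" by (auto simp: B_def not_less)
    then show ?case by (intro exI[of _ "\<eta> + real k"]) auto
  qed
qed

abbreviation "jump \<equiv> jump_time \<eta> P"

lemma jump_le:
  assumes "\<eta> \<le> b" "1 \<le> n" "n \<le> P b x"
  shows "jump n x \<le> b"
  using assms unfolding jump_time_def by (auto intro!: cInf_lower bdd_belowI[of _ \<eta>])

text \<open>The last assumption keeps the infimum in \<open>jump_time\<close> from ranging over the
  empty set.\<close>

lemma jump_ge:
  assumes "x \<in> space M" "\<eta> \<le> a" "P a x < n" "\<exists>t\<ge>\<eta>. n \<le> P t x"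
  shows "a \<le> jump n x"
proof -
  have "a \<le> t" if "\<eta> \<le> t" "n \<le> P t x" for t
    using count_mono[OF assms(1) that(1), of a] that assms by (meson leD le_cases order_trans)
  then show ?thesis
    using assms unfolding jump_time_def by (auto intro!: cInf_greatest)
qed

text \<open>By right-continuity the count has already reached \<open>n\<close> at the jump time
  itself, so the infimum is attained.\<close>

lemma jump_le_iff:
  assumes x: "x \<in> space M" and b: "\<eta> \<le> b" and n: "1 \<le> n" and ex: "\<exists>t\<ge>\<eta>. n \<le> P t x"
  shows "jump n x \<le> b \<longleftrightarrow> n \<le> P b x"
proof
  assume le: "jump n x \<le> b"
  have ge: "\<eta> \<le> jump n x"
    using n count_start[OF x] by (intro jump_ge[OF x _ _ ex]) auto
  obtain s where s: "jump n x < s" "\<And>r. jump n x < r \<Longrightarrow> r < s \<Longrightarrow> P r x = P (jump n x) x"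
    using count_right_cont[OF x ge] by (auto simp: eventually_at_right_field)
  have "n \<le> P (jump n x) x"
  proof -
    have "Inf {t. \<eta> \<le> t \<and> n \<le> P t x} < s"
      using s(1) n by (simp add: jump_time_def)
    then obtain r where r: "\<eta> \<le> r" "n \<le> P r x" "r < s"
      using ex by (subst (asm) cInf_less_iff) (auto intro!: bdd_belowI[of _ \<eta>])
    have "jump n x \<le> r"
      using r n by (intro jump_le) auto
    then show ?thesis
      using r s(2)[of r] by (cases "r = jump n x") auto
  qed
  also have "\<dots> \<le> P b x"
    by (rule count_mono[OF x ge le])
  finally show "n \<le> P b x" .
qed (use assms in \<open>auto intro: jump_le\<close>)

section \<open>Products over the jumps in time cells\<close>

abbreviation jumps_in :: "(nat \<Rightarrow> real) \<Rightarrow> nat \<Rightarrow> 'w \<Rightarrow> nat set" where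
  "jumps_in t l x \<equiv> {P (t l) x<..P (t (Suc l)) x}"

text \<open>Given the jump times, this is the characteristic function of the Laplace summands whose
  indices fall in the cells, with frequency \<open>\<theta> l\<close> throughout cell
  \<open>l\<close>. The summand of index 0 is not among them.\<close>

definition cell_prod :: "(nat \<Rightarrow> real) \<Rightarrow> (nat \<Rightarrow> real) \<Rightarrow> nat \<Rightarrow> 'w \<Rightarrow> real" where
  "cell_prod t \<theta> m x = (\<Prod>l<m. \<Prod>n\<in>jumps_in t l x. cauchy_factor (jump n x * \<theta> l))"

lemma cell_prod_bounds: "0 \<le> cell_prod t \<theta> m x" "cell_prod t \<theta> m x \<le> 1"
  unfolding cell_prod_def using cauchy_factor_bounds
  by (simp_all add: prod_nonneg prod_le_1 less_imp_le)

lemma cell_prod_measurable: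
  assumes "\<And>n. (\<lambda>x. jump n x) \<in> borel_measurable M" "\<And>i. i \<le> m \<Longrightarrow> \<eta> \<le> t i"
  shows "cell_prod t \<theta> m \<in> borel_measurable M"
  unfolding cell_prod_def
proof (rule borel_measurable_prod)
  fix l assume l: "l \<in> {..<m}"
  note assms(1)[measurable]
  have P: "P (t l) \<in> measurable M (count_space UNIV)" "P (t (Suc l)) \<in> measurable M (count_space UNIV)"
    using assms(2)[of l] assms(2)[of "Suc l"] l by auto
  have "(\<lambda>x. \<Prod>n\<in>{a<..b}. cauchy_factor (jump n x * \<theta> l)) \<in> borel_measurable M" for a b
    unfolding cauchy_factor_def by measurable
  then have "(\<lambda>x. \<Prod>n\<in>{a<..P (t (Suc l)) x}. cauchy_factor (jump n x * \<theta> l)) \<in> borel_measurable M" for a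
    by (rule measurable_compose_countable[OF _ P(2)])
  then show "(\<lambda>x. \<Prod>n\<in>jumps_in t l x. cauchy_factor (jump n x * \<theta> l)) \<in> borel_measurable M"
    by (rule measurable_compose_countable[OF _ P(1)])
qed

text \<open>A jump with index in cell \<open>i\<close> occurs between \<open>t i\<close> and
  \<open>t (Suc i)\<close>, and its factor decreases with the jump time. Replacing jump times by
  endpoints leaves powers that involve the counts alone.\<close>

lemma cell_prod_sandwich:
  assumes t: "\<And>i. i \<le> m \<Longrightarrow> \<eta> \<le> t i" and x: "x \<in> space M" "\<forall>n. \<exists>t\<ge>\<eta>. n \<le> P t x"
  shows "(\<Prod>i<m. cauchy_factor (t (Suc i) * \<theta> i) ^ (P (t (Suc i)) x - P (t i) x)) \<le> cell_prod t \<theta> m x"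
    and "cell_prod t \<theta> m x \<le> (\<Prod>i<m. cauchy_factor (t i * \<theta> i) ^ (P (t (Suc i)) x - P (t i) x))"
proof -
  have J: "t i \<le> jump n x" "jump n x \<le> t (Suc i)"
    if "i < m" "n \<in> jumps_in t i x" for i n
    using that t[of i] t[of "Suc i"] x by (auto intro!: jump_ge jump_le)
  have pos: "0 \<le> t i" "0 \<le> jump n x" if "i < m" "n \<in> jumps_in t i x" for i n
    using J[OF that] t[of i] that \<eta> by auto
  have powers: "(\<Prod>i<m. cauchy_factor (c i) ^ (P (t (Suc i)) x - P (t i) x)) =
      (\<Prod>i<m. \<Prod>n\<in>jumps_in t i x. cauchy_factor (c i))" for c
    by simp
  show "(\<Prod>i<m. cauchy_factor (t (Suc i) * \<theta> i) ^ (P (t (Suc i)) x - P (t i) x)) \<le> cell_prod t \<theta> m x"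
    "cell_prod t \<theta> m x \<le> (\<Prod>i<m. cauchy_factor (t i * \<theta> i) ^ (P (t (Suc i)) x - P (t i) x))"
    unfolding powers cell_prod_def using J pos cauchy_factor_bounds
    by (intro prod_mono conjI prod_nonneg ballI cauchy_factor_antimono; simp add: less_imp_le)+
qed

text \<open>Moving all jumps to the left or to the right ends of their cells gives two products, and
  both the expectation and the claimed value lie between the expectations of these. Cell by cell the
  two bounds differ by at most the oscillation of the factor times the Poisson mass, that is, by at
  most the squared mass.\<close>

lemma expectation_cell_prod_approx:
  assumes jm: "\<And>n. (\<lambda>x. jump n x) \<in> borel_measurable M"
    and t: "\<eta> \<le> t 0" "\<And>i. i < m \<Longrightarrow> t i \<le> t (Suc i)"
  shows "\<bar>expectation (cell_prod t \<theta> m) - (\<Prod>i<m. increment_factor (t i) (t (Suc i)) (\<theta> i))\<bar>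
    \<le> (\<Sum>i<m. (2 * ln (t (Suc i) / t i))\<^sup>2)"
proof -
  let ?G = "(\<Prod>i<m. increment_factor (t i) (t (Suc i)) (\<theta> i))"
  have ge: "\<eta> \<le> t i" if "i \<le> m" for i
    using that by (induction i) (use t in \<open>auto intro: order_trans\<close>)
  define \<Lambda> where "\<Lambda> i = 2 * ln (t (Suc i) / t i)" for i
  have cell: "0 < t i" "t i \<le> t (Suc i)" "0 \<le> \<Lambda> i" if "i < m" for i
    using ge[of i] t(2)[of i] that \<eta> by (auto simp: \<Lambda>_def)
  define l where "l i = exp (- ((1 - cauchy_factor (t (Suc i) * \<theta> i)) * \<Lambda> i))" for i
  define r where "r i = exp (- ((1 - cauchy_factor (t i * \<theta> i)) * \<Lambda> i))" for i
  define L where "L x = (\<Prod>i<m. cauchy_factor (t (Suc i) * \<theta> i) ^ (P (t (Suc i)) x - P (t i) x))" for x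
  define R where "R x = (\<Prod>i<m. cauchy_factor (t i * \<theta> i) ^ (P (t (Suc i)) x - P (t i) x))" for x
  have LR[measurable]: "L \<in> borel_measurable M" "R \<in> borel_measurable M"
    unfolding L_def[abs_def] R_def[abs_def] by (rule count_powers_measurable, use ge in auto)+
  have LR01: "norm (L x) \<le> 1" "norm (R x) \<le> 1" for x
    using cauchy_factor_bounds unfolding L_def R_def prod_norm[symmetric]
    by (simp_all add: prod_le_1 power_le_one less_imp_le)
  have int: "integrable M L" "integrable M R" "integrable M (cell_prod t \<theta> m)"
    using LR01 cell_prod_bounds cell_prod_measurable[of m t, OF jm ge]
    by (simp_all add: integrable_const_bound[of _ 1])
  have sand: "AE x in M. L x \<le> cell_prod t \<theta> m x \<and> cell_prod t \<theta> m x \<le> R x"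
    using count_unbounded AE_space
  proof eventually_elim
    case (elim x)
    then show ?case
      using cell_prod_sandwich[of m t x \<theta>, OF ge] by (simp add: L_def R_def)
  qed
  have EL: "expectation L = (\<Prod>i<m. l i)"
    unfolding L_def[abs_def] l_def \<Lambda>_def using t cauchy_factor_bounds
    by (intro expectation_count_powers) (auto intro: less_imp_le)
  have ER: "expectation R = (\<Prod>i<m. r i)"
    unfolding R_def[abs_def] r_def \<Lambda>_def using t cauchy_factor_bounds
    by (intro expectation_count_powers) (auto intro: less_imp_le)
  have E: "(\<Prod>i<m. l i) \<le> expectation (cell_prod t \<theta> m)" "expectation (cell_prod t \<theta> m) \<le> (\<Prod>i<m. r i)"
    unfolding EL[symmetric] ER[symmetric] using sand int by (auto intro!: integral_mono_AE)
  have lr01: "0 \<le> l i" "l i \<le> 1" "0 \<le> r i" "r i \<le> 1" if "i < m" for i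
    using cell(3)[OF that] cauchy_factor_bounds by (auto simp: l_def r_def)
  have G: "(\<Prod>i<m. l i) \<le> ?G"
      "?G \<le> (\<Prod>i<m. r i)"
    using increment_factor_bounds cell lr01 increment_factor_nonneg
    by (auto intro!: prod_mono simp: l_def r_def \<Lambda>_def)
  have "\<bar>expectation (cell_prod t \<theta> m) - ?G\<bar> \<le> norm ((\<Prod>i<m. r i) - (\<Prod>i<m. l i))"
    using E G by (auto simp: abs_le_iff)
  also have "\<dots> \<le> (\<Sum>i<m. norm (r i - l i))"
    using lr01 by (intro norm_prod_diff) auto
  also have "\<dots> \<le> (\<Sum>i<m. (\<Lambda> i)\<^sup>2)"
  proof (rule sum_mono)
    fix i assume i: "i \<in> {..<m}"
    define a where "a = cauchy_factor (t i * \<theta> i)"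
    define b where "b = cauchy_factor (t (Suc i) * \<theta> i)"
    have ab: "b \<le> a" "a - b \<le> \<Lambda> i" "a \<le> 1"
      using cell[of i] i unfolding a_def b_def \<Lambda>_def
      by (auto intro!: cauchy_factor_antimono cauchy_factor_diff_le cauchy_factor_bounds)
    have "0 \<le> (1 - a) * \<Lambda> i" "(1 - a) * \<Lambda> i \<le> (1 - b) * \<Lambda> i"
      using ab cell[of i] i by (auto intro!: mult_right_mono)
    then have "l i \<le> r i" "r i - l i \<le> (1 - b) * \<Lambda> i - (1 - a) * \<Lambda> i"
      unfolding l_def r_def a_def[symmetric] b_def[symmetric] by (simp, intro exp_diff_le)
    moreover have "(1 - b) * \<Lambda> i - (1 - a) * \<Lambda> i = (a - b) * \<Lambda> i"
      by (simp add: algebra_simps)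
    moreover have "(a - b) * \<Lambda> i \<le> \<Lambda> i * \<Lambda> i"
      using ab cell[of i] i by (intro mult_right_mono) auto
    ultimately show "norm (r i - l i) \<le> (\<Lambda> i)\<^sup>2"
      by (simp add: power2_eq_square)
  qed
  finally show ?thesis by (simp add: \<Lambda>_def)
qed

lemma prod_pairs: "(\<Prod>l<2 * m. f l) = (\<Prod>l<m. f (2 * l) * f (Suc (2 * l)))" for f :: "nat \<Rightarrow> 'b::comm_monoid_mult"
  by (induction m) (simp_all add: mult.assoc)

lemma sum_pairs: "(\<Sum>l<2 * m. f l) = (\<Sum>l<m. f (2 * l) + f (Suc (2 * l)))" for f :: "nat \<Rightarrow> 'b::comm_monoid_add"
  by (induction m) (simp_all add: add.assoc)

text \<open>Inserting geometric means leaves both sides unchanged and halves the error bound.\<close>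

lemma expectation_cell_prod_refine:
  assumes jm: "\<And>n. (\<lambda>x. jump n x) \<in> borel_measurable M"
    and t: "\<eta> \<le> t 0" "\<And>i. i < m \<Longrightarrow> t i \<le> t (Suc i)"
  shows "\<bar>expectation (cell_prod t \<theta> m) - (\<Prod>i<m. increment_factor (t i) (t (Suc i)) (\<theta> i))\<bar>
    \<le> (\<Sum>i<m. (2 * ln (t (Suc i) / t i))\<^sup>2) / 2 ^ p"
  using t
proof (induction p arbitrary: t \<theta> m)
  case 0
  then show ?case using expectation_cell_prod_approx[OF jm] by simp
next
  case (Suc p)
  \<comment> \<open>The geometric mean splits the Poisson mass of its cell into equal halves, and
    the squares of two halves add up to half of the original square.\<close>
  define t' where "t' l = (if even l then t (l div 2) else sqrt (t (l div 2) * t (Suc (l div 2))))" for l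
  define \<theta>' where "\<theta>' l = \<theta> (l div 2)" for l :: nat
  have ge: "\<eta> \<le> t i" if "i \<le> m" for i
    using that by (induction i) (use Suc.prems in \<open>auto intro: order_trans\<close>)
  have t'_simps[simp]: "t' (2 * l) = t l" "t' (Suc (2 * l)) = sqrt (t l * t (Suc l))" "t' (Suc (Suc (2 * l))) = t (Suc l)"
    "\<theta>' (2 * l) = \<theta> l" "\<theta>' (Suc (2 * l)) = \<theta> l" for l
    by (simp_all add: t'_def \<theta>'_def)
  have cell: "0 < t l" "t l \<le> sqrt (t l * t (Suc l))" "sqrt (t l * t (Suc l)) \<le> t (Suc l)" if "l < m" for l
  proof -
    show pos: "0 < t l" using ge[of l] that \<eta> by simp
    have le: "t l \<le> t (Suc l)" using Suc.prems that by simp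
    have "t l * t l \<le> t l * t (Suc l)" "t l * t (Suc l) \<le> t (Suc l) * t (Suc l)"
      using pos le by (auto intro: mult_left_mono mult_right_mono)
    then show "t l \<le> sqrt (t l * t (Suc l))" "sqrt (t l * t (Suc l)) \<le> t (Suc l)"
      using pos le by (auto intro!: real_le_rsqrt real_le_lsqrt simp: power2_eq_square)
  qed
  have mono: "t' i \<le> t' (Suc i)" if "i < 2 * m" for i
  proof (cases "even i")
    case True
    then obtain l where "i = 2 * l" by (elim evenE)
    then show ?thesis using cell[of l] that by simp
  next
    case False
    then obtain l where "i = 2 * l + 1" by (elim oddE)
    then show ?thesis using cell[of l] that by simp
  qed
  have "\<bar>expectation (cell_prod t' \<theta>' (2 * m)) - (\<Prod>i<2 * m. increment_factor (t' i) (t' (Suc i)) (\<theta>' i))\<bar>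
    \<le> (\<Sum>i<2 * m. (2 * ln (t' (Suc i) / t' i))\<^sup>2) / 2 ^ p"
    using mono Suc.prems(1) by (intro Suc.IH) (auto simp: t'_def)
  moreover have "(\<Prod>i<2 * m. increment_factor (t' i) (t' (Suc i)) (\<theta>' i)) = (\<Prod>i<m. increment_factor (t i) (t (Suc i)) (\<theta> i))"
    unfolding prod_pairs by (simp add: increment_factor_trans)
  moreover have "expectation (cell_prod t' \<theta>' (2 * m)) = expectation (cell_prod t \<theta> m)"
  proof (rule Bochner_Integration.integral_cong[OF refl])
    fix x assume x: "x \<in> space M"
    show "cell_prod t' \<theta>' (2 * m) x = cell_prod t \<theta> m x"
      unfolding cell_prod_def prod_pairs
    proof (rule prod.cong[OF refl])
      fix l assume l: "l \<in> {..<m}"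
      have ge_l: "\<eta> \<le> t l" using ge[of l] l by simp
      have "jumps_in t l x = {P (t l) x<..P (sqrt (t l * t (Suc l))) x} \<union> {P (sqrt (t l * t (Suc l))) x<..P (t (Suc l)) x}"
      proof -
        have "P (t l) x \<le> P (sqrt (t l * t (Suc l))) x" "P (sqrt (t l * t (Suc l))) x \<le> P (t (Suc l)) x"
          using cell[of l] l ge_l by (auto intro!: count_mono[OF x])
        then show ?thesis by auto
      qed
      then have "(\<Prod>n\<in>jumps_in t l x. cauchy_factor (jump n x * \<theta> l)) =
        (\<Prod>n\<in>{P (t l) x<..P (sqrt (t l * t (Suc l))) x}. cauchy_factor (jump n x * \<theta> l)) *
        (\<Prod>n\<in>{P (sqrt (t l * t (Suc l))) x<..P (t (Suc l)) x}. cauchy_factor (jump n x * \<theta> l))"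
        by (simp only:) (rule prod.union_disjoint, auto)
      then show "(\<Prod>n\<in>{P (t' (2 * l)) x<..P (t' (Suc (2 * l))) x}. cauchy_factor (jump n x * \<theta>' (2 * l))) *
         (\<Prod>n\<in>{P (t' (Suc (2 * l))) x<..P (t' (Suc (Suc (2 * l)))) x}. cauchy_factor (jump n x * \<theta>' (Suc (2 * l))))
         = (\<Prod>n\<in>jumps_in t l x. cauchy_factor (jump n x * \<theta> l))"
        by simp
    qed
  qed
  moreover have "(\<Sum>i<2 * m. (2 * ln (t' (Suc i) / t' i))\<^sup>2) = (\<Sum>i<m. (2 * ln (t (Suc i) / t i))\<^sup>2) / 2"
    unfolding sum_pairs sum_divide_distrib
  proof (rule sum.cong[OF refl])
    fix l assume l: "l \<in> {..<m}"
    have pos: "0 < t l" "0 < t (Suc l)" using cell[of l] l by auto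
    then have half: "ln (sqrt (t l * t (Suc l)) / t l) = ln (t (Suc l) / t l) / 2"
      "ln (t (Suc l) / sqrt (t l * t (Suc l))) = ln (t (Suc l) / t l) / 2"
      by (simp_all add: ln_div ln_sqrt ln_mult field_simps)
    show "(2 * ln (t' (Suc (2 * l)) / t' (2 * l)))\<^sup>2 + (2 * ln (t' (Suc (Suc (2 * l))) / t' (Suc (2 * l))))\<^sup>2
      = (2 * ln (t (Suc l) / t l))\<^sup>2 / 2"
      unfolding t'_simps half by (simp add: power2_eq_square)
  qed
  ultimately show ?case
    by (simp only: power_Suc divide_divide_eq_left)
qed

text \<open>Neither term compared depends on the depth \<open>p\<close> of the refinement, whose
  error bound tends to 0.\<close>

lemma expectation_cell_prod:
  assumes jm: "\<And>n. (\<lambda>x. jump n x) \<in> borel_measurable M"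
    and t: "\<eta> \<le> t 0" "\<And>i. i < m \<Longrightarrow> t i \<le> t (Suc i)"
  shows "expectation (cell_prod t \<theta> m) = (\<Prod>i<m. increment_factor (t i) (t (Suc i)) (\<theta> i))"
proof -
  have "(\<lambda>p. (\<Sum>i<m. (2 * ln (t (Suc i) / t i))\<^sup>2) / 2 ^ p) \<longlonglongrightarrow> 0"
    by (rule LIMSEQ_divide_realpow_zero) simp
  then have "\<bar>expectation (cell_prod t \<theta> m) - (\<Prod>i<m. increment_factor (t i) (t (Suc i)) (\<theta> i))\<bar> \<le> 0"
    by (rule LIMSEQ_le_const) (use expectation_cell_prod_refine[OF jm t] in auto)
  then show ?thesis by simp
qed

end

section \<open>Increments of the Laplace process\<close>

lemma integrable_laplace_1_iexp: "integrable (laplace 1) (\<lambda>w. iexp (c * w))"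
proof -
  interpret prob_space "laplace 1" by (rule prob_space_laplace_1)
  show ?thesis
    by (rule integrable_const_bound[of _ 1]) simp_all
qed

text \<open>Stated for an abstract commutative monoid because it cuts both the sum in the exponent
  and the product of the factors into cells.\<close>

lemma (in comm_monoid_set) cells:
  fixes p :: "nat \<Rightarrow> nat"
  assumes "\<And>i. i < k \<Longrightarrow> p i \<le> p (Suc i)"
  shows "F g {p 0<..p k} = F (\<lambda>j. F g {p j<..p (Suc j)}) {..<k}"
  using assms
proof (induction k)
  case (Suc k)
  have "p 0 \<le> p i" if "i \<le> k" for i
    using that by (induction i) (use Suc.prems in \<open>auto intro: order_trans\<close>)
  then have "p 0 \<le> p k" "p k \<le> p (Suc k)" using Suc.prems by auto
  then have "{p 0<..p (Suc k)} = {p 0<..p k} \<union> {p k<..p (Suc k)}" by auto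
  then have "F g {p 0<..p (Suc k)} = f (F g {p 0<..p k}) (F g {p k<..p (Suc k)})"
    by (simp only:) (rule union_disjoint, auto)
  then show ?case
    using Suc by (simp add: lessThan_Suc commute)
qed simp

lemma cauchy_factor_zero [simp]: "cauchy_factor 0 = 1"
  by (simp add: cauchy_factor_def)

lemma increment_factor_zero [simp]: "increment_factor a b 0 = 1"
  by (simp add: increment_factor_def)

text \<open>A Laplace variable of scale \<open>a\<close> plus an independent increment over
  \<open>(a, b]\<close> has the characteristic function of scale \<open>b\<close>; this is why
  \<open>Z t\<close> is Laplace distributed with scale \<open>t\<close>.\<close>

lemma cauchy_factor_increment: "cauchy_factor (a * t) * increment_factor a b t = cauchy_factor (b * t)"
proof -
  have "1 + (a * t)\<^sup>2 \<noteq> 0" by (metis add_pos_nonneg less_numeral_extra(1) less_numeral_extra(3) zero_le_power2)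
  then show ?thesis by (simp add: increment_factor_def cauchy_factor_def)
qed

locale laplace_sum = log_poisson +
  fixes J :: "nat \<Rightarrow> 'a \<Rightarrow> real" and Z :: "real \<Rightarrow> 'a \<Rightarrow> real"
  assumes jumps: "cond_indep_law M (Pi\<^sub>M UNIV (\<lambda>_. borel)) (\<lambda>x n. jump n x) UNIV J (\<lambda>n T. laplace (T n))"
    and Z: "\<And>t x. \<eta> \<le> t \<Longrightarrow> x \<in> space M \<Longrightarrow> Z t x = (\<Sum>n=0..P t x. J n x)"
begin

lemma jumps_measurable [measurable]: "(\<lambda>x n. jump n x) \<in> measurable M (Pi\<^sub>M UNIV (\<lambda>_. borel))"
  using jumps by (simp add: cond_indep_law_def)

lemma jump_measurable [measurable]: "(\<lambda>x. jump n x) \<in> borel_measurable M"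
  using measurable_compose[OF jumps_measurable measurable_component_singleton[of n]] by simp

lemma J_measurable [measurable]: "J n \<in> borel_measurable M"
  using jumps by (simp add: cond_indep_law_def)

lemma Z_measurable [measurable]:
  assumes [simp]: "\<eta> \<le> t"
  shows "Z t \<in> borel_measurable M"
proof -
  have "(\<lambda>x. \<Sum>n=0..k. J n x) \<in> borel_measurable M" for k :: nat
    by measurable
  then have "(\<lambda>x. \<Sum>n=0..P t x. J n x) \<in> borel_measurable M"
    by (rule measurable_compose_countable) simp
  then show ?thesis
    by (rule measurable_cong[THEN iffD1, rotated]) (simp add: Z)
qed

lemma Z_right_cont:
  assumes "x \<in> space M" "\<eta> \<le> t" "f \<longlonglongrightarrow> t" "\<And>m. t \<le> f m"
  shows "(\<lambda>m. Z (f m) x) \<longlonglongrightarrow> Z t x"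
proof (rule tendsto_eventually)
  have ge: "\<eta> \<le> f m" for m using assms(2,4) order_trans by blast
  show "eventually (\<lambda>m. Z (f m) x = Z t x) sequentially"
    using count_seq[OF assms] by eventually_elim (simp add: Z ge assms)
qed

lemma jump_pos: "AE x in M. \<forall>n. 0 < jump n x"
  using count_unbounded AE_space
proof eventually_elim
  case (elim x)
  show ?case
  proof
    fix n
    have "\<eta> \<le> jump n x"
    proof (cases "n = 0")
      case False
      then show ?thesis using elim count_start[of x] by (intro jump_ge) auto
    qed (simp add: jump_time_def)
    then show "0 < jump n x" using \<eta> by simp
  qed
qed

text \<open>Given the jump times, the summands are independent Laplace variables, so the exponential
  integrates to a product. The frequencies may depend on the jump times, which lets increments with
  a random number of summands be written as sums over the fixed range
  \<open>n \<le> K\<close>.\<close>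

lemma cf_marked_jumps:
  assumes \<Theta>: "\<And>n. \<Theta> n \<in> borel_measurable (Pi\<^sub>M UNIV (\<lambda>_. borel))"
  shows "(CLINT x|M. iexp (\<Sum>n\<le>K. \<Theta> n (\<lambda>n. jump n x) * J n x)) =
    complex_of_real (expectation (\<lambda>x. \<Prod>n\<le>K. cauchy_factor (jump n x * \<Theta> n (\<lambda>n. jump n x))))"
proof -
  note \<Theta>[measurable]
  let ?S = "Pi\<^sub>M UNIV (\<lambda>_. borel) :: (nat \<Rightarrow> real) measure"
  let ?R = "?S \<Otimes>\<^sub>M Pi\<^sub>M {..K} (\<lambda>_. borel :: real measure)"
  let ?T = "\<lambda>x n. jump n x"
  let ?L = "Pi\<^sub>M {..K} (\<lambda>_. laplace 1)"
  interpret L: prob_space "laplace 1" by (rule prob_space_laplace_1)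
  interpret PL: product_prob_space "\<lambda>_. laplace 1" "{..K}" ..
  have PJ: "prob_space ?L"
    by (rule prob_space_PiM) (rule prob_space_laplace_1)
  interpret DX: prob_space "distr M ?S ?T" by (rule prob_space_distr) measurable
  interpret pp: pair_prob_space "distr M ?S ?T" ?L ..
  have sets_PL[measurable_cong]: "sets ?L = sets (Pi\<^sub>M {..K} (\<lambda>_. borel))"
    by (rule sets_PiM_cong) auto
  have joint: "distr M ?R (\<lambda>x. (?T x, \<lambda>i\<in>{..K}. J i x)) =
    distr (distr M ?S ?T \<Otimes>\<^sub>M ?L) ?R (\<lambda>(a, w). (a, \<lambda>i\<in>{..K}. a i * w i))"
    by (rule cond_indep_law_laplace_joint[OF _ jumps]) (use jump_pos in \<open>auto elim: eventually_mono intro: prob_space_axioms\<close>)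
  define F where "F p = iexp (\<Sum>n\<le>K. \<Theta> n (fst p) * snd p n)" for p :: "(nat \<Rightarrow> real) \<times> (nat \<Rightarrow> real)"
  have F[measurable]: "F \<in> borel_measurable ?R"
  proof -
    have "(\<lambda>p. \<Theta> n (fst p) * snd p n) \<in> borel_measurable ?R" if "n \<in> {..K}" for n
      using that by measurable
    then have "(\<lambda>p. \<Sum>n\<le>K. \<Theta> n (fst p) * snd p n) \<in> borel_measurable ?R"
      by (rule borel_measurable_sum)
    then show ?thesis
      unfolding F_def[abs_def] by measurable
  qed
  have m1[measurable]: "(\<lambda>x. (?T x, \<lambda>i\<in>{..K}. J i x)) \<in> measurable M ?R"
    by (intro measurable_Pair measurable_restrict) auto
  have m2[measurable]: "(\<lambda>(a, w). (a, \<lambda>i\<in>{..K}. a i * w i)) \<in> measurable (distr M ?S ?T \<Otimes>\<^sub>M ?L) ?R"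
  proof -
    have "(\<lambda>p. fst p i * snd p i) \<in> borel_measurable (distr M ?S ?T \<Otimes>\<^sub>M ?L)" if "i \<in> {..K}" for i
      using that by measurable
    then show ?thesis
      unfolding case_prod_beta by (intro measurable_Pair measurable_restrict) auto
  qed
  have "(CLINT x|M. iexp (\<Sum>n\<le>K. \<Theta> n (?T x) * J n x)) = (CLINT x|M. F (?T x, \<lambda>i\<in>{..K}. J i x))"
    by (simp add: F_def)
  also have "\<dots> = (CLINT p|distr M ?R (\<lambda>x. (?T x, \<lambda>i\<in>{..K}. J i x)). F p)"
    by (rule integral_distr[symmetric]) measurable
  also have "\<dots> = (CLINT p|distr M ?S ?T \<Otimes>\<^sub>M ?L. F (case p of (a, w) \<Rightarrow> (a, \<lambda>i\<in>{..K}. a i * w i)))"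
    unfolding joint by (rule integral_distr) measurable
  also have "\<dots> = (CLINT a|distr M ?S ?T. CLINT w|?L. F (a, \<lambda>i\<in>{..K}. a i * w i))"
  proof -
    have "integrable (distr M ?S ?T \<Otimes>\<^sub>M ?L) (\<lambda>p. F (case p of (a, w) \<Rightarrow> (a, \<lambda>i\<in>{..K}. a i * w i)))"
    proof (rule pp.P.integrable_const_bound[of _ 1])
      show "AE p in distr M ?S ?T \<Otimes>\<^sub>M ?L. norm (F (case p of (a, w) \<Rightarrow> (a, \<lambda>i\<in>{..K}. a i * w i))) \<le> 1"
        unfolding F_def by simp
    qed measurable
    then show ?thesis
      by (subst pp.integral_fst'[symmetric]) auto
  qed
  also have "\<dots> = (CLINT a|distr M ?S ?T. complex_of_real (\<Prod>n\<le>K. cauchy_factor (a n * \<Theta> n a)))"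
  proof (rule Bochner_Integration.integral_cong[OF refl])
    fix a
    have "F (a, \<lambda>i\<in>{..K}. a i * w i) = (\<Prod>n\<le>K. iexp ((a n * \<Theta> n a) * w n))" for w
    proof -
      have "F (a, \<lambda>i\<in>{..K}. a i * w i) = exp (\<Sum>n\<le>K. \<i> * complex_of_real ((a n * \<Theta> n a) * w n))"
        by (simp add: F_def sum_distrib_left mult_ac)
      then show ?thesis
        by (simp only: exp_sum finite_atMost)
    qed
    then have "(CLINT w|?L. F (a, \<lambda>i\<in>{..K}. a i * w i)) = (CLINT w|?L. \<Prod>n\<le>K. iexp ((a n * \<Theta> n a) * w n))"
      by simp
    also have "\<dots> = (\<Prod>n\<le>K. CLINT w|laplace 1. iexp ((a n * \<Theta> n a) * w))"
    proof (rule PL.product_integral_prod)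
      show "integrable (laplace 1) (\<lambda>w. iexp ((a n * \<Theta> n a) * w))" for n
        by (rule integrable_laplace_1_iexp)
    qed simp
    also have "\<dots> = (\<Prod>n\<le>K. complex_of_real (cauchy_factor (a n * \<Theta> n a)))"
      by (simp only: char_def[symmetric] char_laplace_1 cauchy_factor_def)
    finally show "(CLINT w|?L. F (a, \<lambda>i\<in>{..K}. a i * w i)) = complex_of_real (\<Prod>n\<le>K. cauchy_factor (a n * \<Theta> n a))"
      by simp
  qed
  also have "\<dots> = complex_of_real (LINT a|distr M ?S ?T. (\<Prod>n\<le>K. cauchy_factor (a n * \<Theta> n a)))"
    by (rule integral_complex_of_real)
  also have "(LINT a|distr M ?S ?T. (\<Prod>n\<le>K. cauchy_factor (a n * \<Theta> n a))) = expectation (\<lambda>x. \<Prod>n\<le>K. cauchy_factor (jump n x * \<Theta> n (?T x)))"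
    unfolding cauchy_factor_def by (rule integral_distr) measurable
  finally show ?thesis .
qed

text \<open>The zeroth increment is the whole value of the process at \<open>s 1\<close>, so the increments sum to the process.\<close>

definition increment :: "(nat \<Rightarrow> real) \<Rightarrow> nat \<Rightarrow> 'a \<Rightarrow> real" where
  "increment s j x = Z (s (Suc j)) x - (if j = 0 then 0 else Z (s j) x)"

text \<open>Each summand gets the frequency of the cell containing its jump time, and frequency 0
  beyond the last cell. Once \<open>K\<close> reaches the count at \<open>s k\<close>, the truncated
  sum and product equal their limits, and dominated convergence applies on both sides.\<close>

lemma joint_cf_increments:
  assumes s0: "s 0 = \<eta>" and s: "\<And>i. i < k \<Longrightarrow> s i \<le> s (Suc i)" and k: "0 < k"
  shows "(CLINT x|M. \<Prod>j<k. iexp (\<theta> j * increment s j x)) =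
    complex_of_real (cauchy_factor (\<eta> * \<theta> 0) * (\<Prod>j<k. increment_factor (s j) (s (Suc j)) (\<theta> j)))"
proof -
  have ge: "\<eta> \<le> s i" if "i \<le> k" for i
    using that by (induction i) (use s s0 in \<open>auto intro: order_trans\<close>)
  \<comment> \<open>Index 0 is set by hand: its jump time is \<open>\<eta> = s 0\<close>, which the
    half-open cells exclude, while its summand belongs to the zeroth increment.\<close>
  define \<Theta> where "\<Theta> n T = (if n = 0 then \<theta> 0 else \<Sum>j<k. \<theta> j * indicator {s j<..s (Suc j)} (T n))" for n :: nat and T :: "nat \<Rightarrow> real"
  have \<Theta>m[measurable]: "\<Theta> n \<in> borel_measurable (Pi\<^sub>M UNIV (\<lambda>_. borel))" for n
    unfolding \<Theta>_def[abs_def] by measurable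
  let ?T = "\<lambda>x n. jump n x"
  have good: "AE x in M. x \<in> space M \<and> (\<forall>n. \<exists>t\<ge>\<eta>. n \<le> P t x)"
    using count_unbounded AE_space by eventually_elim simp
  have iff: "jump n x \<in> {s j<..s (Suc j)} \<longleftrightarrow> n \<in> jumps_in s j x"
    if "x \<in> space M" "\<forall>n. \<exists>t\<ge>\<eta>. n \<le> P t x" "j < k" "1 \<le> n" for x j n
    using jump_le_iff[of x "s j" n] jump_le_iff[of x "s (Suc j)" n] ge[of j] ge[of "Suc j"] that
    by (auto simp: not_le[symmetric])
  have Pmono: "P (s i) x \<le> P (s j) x" if "x \<in> space M" "i \<le> j" "j \<le> k" for x i j
  proof -
    have "s i \<le> s j"
      using that(2,3) by (induction rule: dec_induct) (use s in \<open>auto intro: order_trans\<close>)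
    then show ?thesis
      using that ge by (intro count_mono) auto
  qed
  have cell: "\<Theta> n (?T x) = \<theta> j"
    if "x \<in> space M" "\<forall>n. \<exists>t\<ge>\<eta>. n \<le> P t x" "j < k" "n \<in> jumps_in s j x" for x j n
  proof -
    have "indicator {s i<..s (Suc i)} (jump n x) = (if i = j then 1 else 0 :: real)" if "i < k" for i
    proof -
      have "n \<in> jumps_in s i x \<longleftrightarrow> i = j"
        using \<open>j < k\<close> \<open>n \<in> _\<close> \<open>x \<in> space M\<close> that Pmono[of x "Suc i" j] Pmono[of x "Suc j" i]
        by (cases i j rule: linorder_cases) auto
      then show ?thesis
        using iff[of x i n] \<open>n \<in> _\<close> \<open>x \<in> space M\<close> \<open>\<forall>n. \<exists>t\<ge>\<eta>. n \<le> P t x\<close> that by (auto simp: indicator_def)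
    qed
    then have "(\<Sum>i<k. \<theta> i * indicator {s i<..s (Suc i)} (jump n x)) = (\<Sum>i<k. if i = j then \<theta> i else 0)"
      by (intro sum.cong) auto
    then show ?thesis
      using that by (simp add: \<Theta>_def)
  qed
  have beyond: "\<Theta> n (?T x) = 0"
    if "x \<in> space M" "\<forall>n. \<exists>t\<ge>\<eta>. n \<le> P t x" "P (s k) x < n" for x n
  proof -
    have "jump n x \<notin> {s j<..s (Suc j)}" if "j < k" for j
      using iff[of x j n] Pmono[of x "Suc j" k] \<open>x \<in> space M\<close> \<open>\<forall>n. \<exists>t\<ge>\<eta>. n \<le> P t x\<close> \<open>P (s k) x < n\<close> that by auto
    then show ?thesis
      using that by (simp add: \<Theta>_def)
  qed
  have sum_eq: "(\<Sum>n\<le>K. \<Theta> n (?T x) * J n x) = (\<Sum>j<k. \<theta> j * increment s j x)"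
    if x: "x \<in> space M" "\<forall>n. \<exists>t\<ge>\<eta>. n \<le> P t x" "P (s k) x \<le> K" for x K
  proof -
    have P0: "P (s 0) x = 0" using count_start x s0 by simp
    have inc: "increment s j x = (if j = 0 then J 0 x else 0) + (\<Sum>n\<in>jumps_in s j x. J n x)" if j: "j < k" for j
    proof (cases "j = 0")
      case True
      have "{0..P (s (Suc 0)) x} = insert 0 {0<..P (s (Suc 0)) x}" by auto
      then show ?thesis
        using True ge[of "Suc 0"] j x P0 by (simp add: increment_def Z)
    next
      case False
      have "{0..P (s (Suc j)) x} = {0..P (s j) x} \<union> jumps_in s j x"
        using Pmono[of x j "Suc j"] j x by auto
      then have "(\<Sum>n=0..P (s (Suc j)) x. J n x) = (\<Sum>n=0..P (s j) x. J n x) + (\<Sum>n\<in>jumps_in s j x. J n x)"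
        by (simp only:) (rule sum.union_disjoint, auto)
      then show ?thesis
        using False ge[of j] ge[of "Suc j"] j x by (simp add: increment_def Z)
    qed
    have "{..K} = insert 0 ({P (s 0) x<..P (s k) x} \<union> {P (s k) x<..K})"
      using x P0 by auto
    then have "(\<Sum>n\<le>K. \<Theta> n (?T x) * J n x) = \<Theta> 0 (?T x) * J 0 x + (\<Sum>n\<in>{P (s 0) x<..P (s k) x} \<union> {P (s k) x<..K}. \<Theta> n (?T x) * J n x)"
      by (simp only:) (rule sum.insert, auto)
    also have "(\<Sum>n\<in>{P (s 0) x<..P (s k) x} \<union> {P (s k) x<..K}. \<Theta> n (?T x) * J n x)
      = (\<Sum>n\<in>{P (s 0) x<..P (s k) x}. \<Theta> n (?T x) * J n x)"
      using beyond[OF x(1,2)] by (intro sum.mono_neutral_right) auto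
    also have "\<dots> = (\<Sum>j<k. \<Sum>n\<in>jumps_in s j x. \<Theta> n (?T x) * J n x)"
      using Pmono[OF x(1)] by (intro sum.cells) auto
    also have "\<dots> = (\<Sum>j<k. \<theta> j * (\<Sum>n\<in>jumps_in s j x. J n x))"
      using cell[OF x(1,2)] by (intro sum.cong refl) (simp add: sum_distrib_left)
    finally have "(\<Sum>n\<le>K. \<Theta> n (?T x) * J n x) = \<theta> 0 * J 0 x + (\<Sum>j<k. \<theta> j * (\<Sum>n\<in>jumps_in s j x. J n x))"
      by (simp add: \<Theta>_def)
    moreover have "(\<Sum>j<k. \<theta> j * increment s j x) = (\<Sum>j<k. (if j = 0 then \<theta> j * J 0 x else 0) + \<theta> j * (\<Sum>n\<in>jumps_in s j x. J n x))"
      by (rule sum.cong) (auto simp: inc algebra_simps)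
    ultimately show ?thesis
      using k by (simp add: sum.distrib)
  qed
  have prod_eq: "(\<Prod>n\<le>K. cauchy_factor (jump n x * \<Theta> n (?T x))) = cauchy_factor (\<eta> * \<theta> 0) * cell_prod s \<theta> k x"
    if x: "x \<in> space M" "\<forall>n. \<exists>t\<ge>\<eta>. n \<le> P t x" "P (s k) x \<le> K" for x K
  proof -
    have P0: "P (s 0) x = 0" using count_start x s0 by simp
    let ?c = "\<lambda>n. cauchy_factor (jump n x * \<Theta> n (?T x))"
    have "{..K} = insert 0 ({P (s 0) x<..P (s k) x} \<union> {P (s k) x<..K})"
      using x P0 by auto
    then have "(\<Prod>n\<le>K. ?c n) = ?c 0 * (\<Prod>n\<in>{P (s 0) x<..P (s k) x} \<union> {P (s k) x<..K}. ?c n)"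
      by (simp only:) (rule prod.insert, auto)
    also have "(\<Prod>n\<in>{P (s 0) x<..P (s k) x} \<union> {P (s k) x<..K}. ?c n) = (\<Prod>n\<in>{P (s 0) x<..P (s k) x}. ?c n)"
      using beyond[OF x(1,2)] by (intro prod.mono_neutral_right) auto
    also have "\<dots> = (\<Prod>j<k. \<Prod>n\<in>jumps_in s j x. ?c n)"
      using Pmono[OF x(1)] by (intro prod.cells) auto
    also have "\<dots> = cell_prod s \<theta> k x"
      unfolding cell_prod_def using cell[OF x(1,2)] by (intro prod.cong refl) simp
    finally show ?thesis
      by (simp add: \<Theta>_def jump_time_def)
  qed
  have inc_m[measurable]: "increment s j \<in> borel_measurable M" if "j < k" for j
    unfolding increment_def[abs_def] using ge[of j] ge[of "Suc j"] that
    by (cases "j = 0") (auto intro!: borel_measurable_diff Z_measurable)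
  let ?V = "\<lambda>x. \<Sum>j<k. \<theta> j * increment s j x"
  let ?S = "\<lambda>K x. \<Sum>n\<le>K. \<Theta> n (?T x) * J n x"
  let ?C = "\<lambda>K x. \<Prod>n\<le>K. cauchy_factor (jump n x * \<Theta> n (?T x))"
  let ?L = "\<lambda>x. cauchy_factor (\<eta> * \<theta> 0) * cell_prod s \<theta> k x"
  have "(\<lambda>K. CLINT x|M. iexp (?S K x)) \<longlonglongrightarrow> (CLINT x|M. iexp (?V x))"
  proof (rule integral_dominated_convergence[where w="\<lambda>_. 1"])
    show "(\<lambda>x. iexp (?V x)) \<in> borel_measurable M"
      using inc_m by measurable
    show "(\<lambda>x. iexp (?S K x)) \<in> borel_measurable M" for K
      by measurable
    show "AE x in M. (\<lambda>K. iexp (?S K x)) \<longlonglongrightarrow> iexp (?V x)"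
      using good
    proof eventually_elim
      case (elim x)
      show ?case
        by (rule tendsto_eventually, rule eventually_sequentiallyI[of "P (s k) x"]) (use elim sum_eq in simp)
    qed
  qed auto
  moreover have "(\<lambda>K. expectation (\<lambda>x. ?C K x))
      \<longlonglongrightarrow> expectation (\<lambda>x. ?L x)"
  proof (rule integral_dominated_convergence[where w="\<lambda>_. 1"])
    show "(\<lambda>x. ?L x) \<in> borel_measurable M"
      using cell_prod_measurable[of k s \<theta>] ge by (intro borel_measurable_times) auto
    show "(\<lambda>x. ?C K x) \<in> borel_measurable M" for K
      unfolding cauchy_factor_def by measurable
    show "AE x in M. (\<lambda>K. ?C K x) \<longlonglongrightarrow> ?L x"
      using good
    proof eventually_elim
      case (elim x)
      show ?case
        by (rule tendsto_eventually, rule eventually_sequentiallyI[of "P (s k) x"]) (use elim prod_eq in simp)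
    qed
    have "norm (?C K x) \<le> 1" for K x
      unfolding prod_norm[symmetric] using cauchy_factor_bounds
      by (intro prod_le_1) (simp add: less_imp_le)
    then show "AE x in M. norm (?C K x) \<le> 1" for K
      by simp
  qed auto
  then have "(\<lambda>K. complex_of_real (expectation (\<lambda>x. ?C K x)))
      \<longlonglongrightarrow> complex_of_real (expectation (\<lambda>x. ?L x))"
    by (rule tendsto_of_real)
  ultimately have "(CLINT x|M. iexp (?V x)) = complex_of_real (expectation (\<lambda>x. ?L x))"
    unfolding cf_marked_jumps[OF \<Theta>m] by (rule LIMSEQ_unique)
  also have "\<dots> = complex_of_real (cauchy_factor (\<eta> * \<theta> 0) * (\<Prod>j<k. increment_factor (s j) (s (Suc j)) (\<theta> j)))"
    using s s0 by (simp add: expectation_cell_prod)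
  also have "(CLINT x|M. iexp (?V x)) = (CLINT x|M. \<Prod>j<k. iexp (\<theta> j * increment s j x))"
    by (intro Bochner_Integration.integral_cong refl) (simp add: sum_distrib_left exp_sum)
  finally show ?thesis .
qed

end

section \<open>Joint law of the increments\<close>

context laplace_sum
begin

text \<open>For \<open>j = 0\<close> the starting variable is included, which turns the factor of
  the first cell into that of a Laplace variable of scale \<open>s 1\<close>.\<close>

definition increment_cf :: "(nat \<Rightarrow> real) \<Rightarrow> nat \<Rightarrow> real \<Rightarrow> real" where
  "increment_cf s j t = (if j = 0 then cauchy_factor (s 1 * t) else increment_factor (s j) (s (Suc j)) t)"

context
  fixes s :: "nat \<Rightarrow> real" and k :: nat
  assumes s0: "s 0 = \<eta>" and s: "\<And>i. i < k \<Longrightarrow> s i \<le> s (Suc i)" and k: "0 < k"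
begin

lemma s_ge: "i \<le> k \<Longrightarrow> \<eta> \<le> s i"
  by (induction i) (use s s0 in \<open>auto intro: order_trans\<close>)

lemma increment_measurable [measurable]: "j < k \<Longrightarrow> increment s j \<in> borel_measurable M"
  unfolding increment_def[abs_def] using s_ge[of j] s_ge[of "Suc j"]
  by (cases "j = 0") (auto intro!: borel_measurable_diff Z_measurable)

lemma joint_cf_increments':
  "(CLINT x|M. \<Prod>j<k. iexp (\<theta> j * increment s j x)) = complex_of_real (\<Prod>j<k. increment_cf s j (\<theta> j))"
proof -
  obtain k' where k': "k = Suc k'" using k by (cases k) auto
  have "cauchy_factor (\<eta> * \<theta> 0) * (\<Prod>j<k. increment_factor (s j) (s (Suc j)) (\<theta> j)) = (\<Prod>j<k. increment_cf s j (\<theta> j))"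
    unfolding k' prod.lessThan_Suc_shift
    by (simp add: increment_cf_def s0 cauchy_factor_increment mult.assoc[symmetric])
  then show ?thesis
    using joint_cf_increments[of s k \<theta>] s0 s k by simp
qed

text \<open>The marginal comes from the joint formula by setting all other frequencies to 0, where
  their factors are 1.\<close>

lemma cf_increment:
  assumes "j < k"
  shows "(CLINT x|M. iexp (t * increment s j x)) = complex_of_real (increment_cf s j t)"
proof -
  have "(\<Prod>i<k. iexp ((if i = j then t else 0) * increment s i x)) = iexp (t * increment s j x)" for x
  proof -
    have "(\<Prod>i<k. iexp ((if i = j then t else 0) * increment s i x)) = (\<Prod>i<k. if i = j then iexp (t * increment s i x) else 1)"
      by (intro prod.cong) auto
    then show ?thesis using assms by simp
  qed
  moreover have "(\<Prod>i<k. increment_cf s i (if i = j then t else 0)) = increment_cf s j t"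
  proof -
    have "(\<Prod>i<k. increment_cf s i (if i = j then t else 0)) = (\<Prod>i<k. if i = j then increment_cf s i t else 1)"
      by (intro prod.cong) (auto simp: increment_cf_def)
    then show ?thesis using assms by simp
  qed
  ultimately show ?thesis
    using joint_cf_increments'[of "\<lambda>i. if i = j then t else 0"] by simp
qed

lemma char_increment:
  assumes [simp]: "j < k"
  shows "char (distr M borel (increment s j)) t = complex_of_real (increment_cf s j t)"
  unfolding char_def by (subst integral_distr) (simp, simp, rule cf_increment[OF assms])

lemma real_distribution_increment: "j < k \<Longrightarrow> real_distribution (distr M borel (increment s j))"
  by (auto simp: real_distribution_def real_distribution_axioms_def intro!: prob_space_distr)

lemma law_first_increment: "distr M borel (increment s 0) = laplace (s 1)"
proof (rule Levy_uniqueness)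
  have pos: "0 < s 1" using s_ge[of 1] k \<eta> by simp
  show "real_distribution (distr M borel (increment s 0))"
    using k by (rule real_distribution_increment)
  show "real_distribution (laplace (s 1))"
    using pos by (rule real_distribution_laplace)
  show "char (distr M borel (increment s 0)) = char (laplace (s 1))"
    using k pos by (simp add: fun_eq_iff char_increment char_laplace increment_cf_def cauchy_factor_def)
qed

lemma law_increments:
  "distr M (Pi\<^sub>M {..<k} (\<lambda>_. borel)) (\<lambda>x. \<lambda>j\<in>{..<k}. increment s j x) =
    Pi\<^sub>M {..<k} (\<lambda>j. distr M borel (increment s j))"
proof -
  have "indep_vars (\<lambda>_. borel) (increment s) {..<k}"
  proof (rule indep_vars_of_cf)
    fix t :: "nat \<Rightarrow> real"
    have "(\<Prod>j<k. CLINT x|M. iexp (t j * increment s j x)) = (\<Prod>j<k. complex_of_real (increment_cf s j (t j)))"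
      by (rule prod.cong[OF refl]) (simp only: cf_increment lessThan_iff)
    then show "(CLINT x|M. (\<Prod>j<k. iexp (t j * increment s j x))) = (\<Prod>j<k. CLINT x|M. iexp (t j * increment s j x))"
      by (simp only: joint_cf_increments' of_real_prod)
  qed (use k in auto)
  then show ?thesis
    using k by (subst (asm) indep_vars_iff_distr_eq_PiM') auto
qed

lemma Z_telescope:
  assumes "j < k"
  shows "Z (s (Suc j)) x = (\<Sum>i\<le>j. increment s i x)"
  using assms
proof (induction j)
  case (Suc j)
  then have "(\<Sum>i\<le>Suc j. increment s i x) = Z (s (Suc j)) x + increment s (Suc j) x"
    by simp
  then show ?case
    by (simp add: increment_def)
qed (simp add: increment_def)

end

end

section \<open>Shifting a path of the Laplace process\<close>

lemma laplace_process_laplace_sum: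
  assumes "prob_space M" "0 < \<eta>" "laplace_process M \<eta> Z"
  shows "\<exists>P J. laplace_sum M \<eta> P J Z"
proof -
  obtain P J where "inhom_poisson_process M \<eta> (\<lambda>t. 2 / t) P"
    "cond_indep_law M (Pi\<^sub>M UNIV (\<lambda>_. borel)) (\<lambda>x n. jump_time \<eta> P n x) UNIV J (\<lambda>n T. laplace (T n))"
    "\<forall>t\<ge>\<eta>. \<forall>x\<in>space M. Z t x = (\<Sum>n=0..P t x. J n x)"
    using assms(3) unfolding laplace_process_def by blast
  then have "laplace_sum M \<eta> P J Z"
    using assms by (simp add: laplace_sum_def laplace_sum_axioms_def log_poisson_def log_poisson_axioms_def)
  then show ?thesis by blast
qed

text \<open>Fubini's theorem isolates the Laplace coordinate \<open>i\<close>, where the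
  one-dimensional shift bound applies with all other coordinates fixed.\<close>

lemma nn_integral_PiM_laplace_shift:
  fixes D :: "'i \<Rightarrow> real measure"
  assumes I: "finite I" "i \<in> I" and D: "\<And>j. real_distribution (D j)" "D i = laplace s" and s: "0 < s"
    and f: "f \<in> borel_measurable (Pi\<^sub>M I (\<lambda>_. borel))"
  shows "(\<integral>\<^sup>+v. f (v(i := v i + c)) \<partial>Pi\<^sub>M I D) \<le> ennreal (exp (\<bar>c\<bar> / s)) * (\<integral>\<^sup>+v. f v \<partial>Pi\<^sub>M I D)"
proof -
  define K where "K = I - {i}"
  have ins: "I = insert i K" "finite K" "i \<notin> K" using I by (auto simp: K_def)
  have sets_D: "sets (Pi\<^sub>M I' D) = sets (Pi\<^sub>M I' (\<lambda>_. borel))" for I'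
    using D by (intro sets_PiM_cong) (auto simp: real_distribution.events_eq_borel)
  interpret D: product_sigma_finite D
    using D by (simp add: product_sigma_finite_def real_distribution_def prob_space_imp_sigma_finite)
  have shift: "(\<lambda>v. v(i := v i + c)) \<in> measurable (Pi\<^sub>M I (\<lambda>_. borel)) (Pi\<^sub>M I (\<lambda>_. borel :: real measure))"
    using I by (intro measurable_fun_upd[where J=I]) auto
  have fs: "(\<lambda>v. f (v(i := v i + c))) \<in> borel_measurable (Pi\<^sub>M I (\<lambda>_. borel))"
    using measurable_compose[OF shift f] .
  have "(\<integral>\<^sup>+v. f (v(i := v i + c)) \<partial>Pi\<^sub>M I D) = (\<integral>\<^sup>+v. \<integral>\<^sup>+y. f (v(i := y + c)) \<partial>laplace s \<partial>Pi\<^sub>M K D)"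
    unfolding ins(1) D(2)[symmetric]
    by (subst D.product_nn_integral_insert) (use fs ins in \<open>simp_all add: measurable_cong_sets[OF sets_D refl]\<close>)
  also have "\<dots> \<le> (\<integral>\<^sup>+v. ennreal (exp (\<bar>c\<bar> / s)) * (\<integral>\<^sup>+y. f (v(i := y)) \<partial>laplace s) \<partial>Pi\<^sub>M K D)"
  proof (rule nn_integral_mono, rule nn_integral_laplace_shift[OF s])
    fix v assume "v \<in> space (Pi\<^sub>M K D)"
    then have "v \<in> space (Pi\<^sub>M K (\<lambda>_. borel))"
      by (simp add: sets_eq_imp_space_eq[OF sets_D])
    then have "(\<lambda>y. v(i := y)) \<in> measurable borel (Pi\<^sub>M I (\<lambda>_. borel))"
      unfolding ins(1) by (intro measurable_fun_upd[where J=K]) auto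
    then show "(\<lambda>y. f (v(i := y))) \<in> borel_measurable borel"
      by (rule measurable_compose) (rule f)
  qed
  also have "\<dots> = ennreal (exp (\<bar>c\<bar> / s)) * (\<integral>\<^sup>+v. \<integral>\<^sup>+y. f (v(i := y)) \<partial>laplace s \<partial>Pi\<^sub>M K D)"
  proof (rule nn_integral_cmult)
    interpret prob_space "laplace s"
      using real_distribution_laplace[OF s] by (simp add: real_distribution_def)
    have "(\<lambda>p. (fst p)(i := snd p)) \<in> measurable (Pi\<^sub>M K (\<lambda>_. borel) \<Otimes>\<^sub>M borel) (Pi\<^sub>M I (\<lambda>_. borel :: real measure))"
      unfolding ins(1) by (intro measurable_fun_upd[where J=K]) auto
    then have "(\<lambda>p. f ((fst p)(i := snd p))) \<in> borel_measurable (Pi\<^sub>M K (\<lambda>_. borel) \<Otimes>\<^sub>M borel)"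
      by (rule measurable_compose) (rule f)
    moreover have "sets (Pi\<^sub>M K D \<Otimes>\<^sub>M laplace s) = sets (Pi\<^sub>M K (\<lambda>_. borel) \<Otimes>\<^sub>M borel)"
      by (intro sets_pair_measure_cong sets_D) simp
    ultimately show "(\<lambda>v. \<integral>\<^sup>+y. f (v(i := y)) \<partial>laplace s) \<in> borel_measurable (Pi\<^sub>M K D)"
      by (intro borel_measurable_nn_integral) (simp add: case_prod_beta cong: measurable_cong_sets)
  qed
  also have "(\<integral>\<^sup>+v. \<integral>\<^sup>+y. f (v(i := y)) \<partial>laplace s \<partial>Pi\<^sub>M K D) = (\<integral>\<^sup>+v. f v \<partial>Pi\<^sub>M I D)"
    unfolding ins(1) D(2)[symmetric]
    by (subst D.product_nn_integral_insert) (use f ins in \<open>simp_all add: measurable_cong_sets[OF sets_D refl]\<close>)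
  finally show ?thesis .
qed

text \<open>Along the sorted times the values are partial sums of independent increments. Every
  partial sum contains the first increment, so adding \<open>c\<close> there moves all values, while
  only its law \<open>laplace (T r)\<close> enters the cost. The laws of the increments are
  determined by the times alone, so two different realizations of the process can be
  compared.\<close>

lemma laplace_process_shift:
  fixes M :: "'w measure" and M' :: "'v measure" and T :: "'i \<Rightarrow> real"
  assumes "prob_space M" "prob_space M'" and \<eta>: "0 < \<eta>"
    and "laplace_process M \<eta> Z" "laplace_process M' \<eta> Z'"
    and R: "finite R" "r \<in> R" and T: "\<eta> \<le> T r" "\<And>i. i \<in> R \<Longrightarrow> T r \<le> T i"
    and f: "f \<in> borel_measurable (Pi\<^sub>M R (\<lambda>_. borel))"
  shows "(\<integral>\<^sup>+x. f (\<lambda>i\<in>R. Z (T i) x + c) \<partial>M) \<le> ennreal (exp (\<bar>c\<bar> / T r)) * (\<integral>\<^sup>+x. f (\<lambda>i\<in>R. Z' (T i) x) \<partial>M')"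
proof -
  obtain P J where A: "laplace_sum M \<eta> P J Z"
    using laplace_process_laplace_sum assms by blast
  obtain P' J' where B: "laplace_sum M' \<eta> P' J' Z'"
    using laplace_process_laplace_sum assms by blast
  interpret A: laplace_sum M \<eta> P J Z by (rule A)
  interpret B: laplace_sum M' \<eta> P' J' Z' by (rule B)
  \<comment> \<open>Sorting the set of times merges coinciding ones; \<open>idx\<close> will recover
    the position of each index.\<close>
  define xs where "xs = sorted_list_of_set (T ` R)"
  define k where "k = length xs"
  define s where "s i = (case i of 0 \<Rightarrow> \<eta> | Suc j \<Rightarrow> xs ! j)" for i
  let ?A = "\<lambda>x. \<lambda>j\<in>{..<k}. A.increment s j x"
  let ?B = "\<lambda>x. \<lambda>j\<in>{..<k}. B.increment s j x"
  have xs: "set xs = T ` R" "sorted xs" "xs \<noteq> []"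
    using R by (auto simp: xs_def)
  have k: "0 < k" using xs by (simp add: k_def)
  have s0: "s 0 = \<eta>" by (simp add: s_def)
  have s1: "s 1 = T r"
  proof -
    have "xs ! 0 \<in> T ` R" using xs by (metis length_greater_0_conv nth_mem)
    moreover obtain j where "j < length xs" "xs ! j = T r"
      using R xs by (metis imageI in_set_conv_nth)
    moreover then have "xs ! 0 \<le> xs ! j" using xs by (intro sorted_nth_mono) auto
    ultimately show ?thesis using T by (auto simp: s_def intro: antisym)
  qed
  have mono: "s i \<le> s (Suc i)" if "i < k" for i
  proof (cases i)
    case 0
    then show ?thesis using s1 T(1) by (simp add: s_def)
  next
    case (Suc j)
    then show ?thesis using that xs by (auto simp: s_def k_def intro: sorted_nth_mono)
  qed
  have "\<forall>i\<in>R. \<exists>j<k. T i = s (Suc j)"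
  proof
    fix i assume "i \<in> R"
    then have "T i \<in> set xs" using xs by simp
    then show "\<exists>j<k. T i = s (Suc j)" by (auto simp: in_set_conv_nth s_def k_def)
  qed
  then obtain idx where idx: "\<And>i. i \<in> R \<Longrightarrow> idx i < k" "\<And>i. i \<in> R \<Longrightarrow> T i = s (Suc (idx i))"
    by metis
  define h where "h v = (\<lambda>i\<in>R. \<Sum>j\<le>idx i. v j)" for v :: "nat \<Rightarrow> real"
  have h: "h \<in> measurable (Pi\<^sub>M {..<k} (\<lambda>_. borel)) (Pi\<^sub>M R (\<lambda>_. borel))"
    unfolding h_def[abs_def]
  proof (rule measurable_restrict)
    fix i assume "i \<in> R"
    then have proj: "(\<lambda>v. v j) \<in> borel_measurable (Pi\<^sub>M {..<k} (\<lambda>_. borel :: real measure))" if "j \<in> {..idx i}" for j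
      using idx(1)[of i] that by (intro measurable_component_singleton) auto
    show "(\<lambda>v. \<Sum>j\<le>idx i. v j) \<in> borel_measurable (Pi\<^sub>M {..<k} (\<lambda>_. borel :: real measure))"
      using borel_measurable_sum[of "{..idx i}" "\<lambda>j v. v j", OF proj] by simp
  qed
  define D where "D j = distr M borel (A.increment s j)" for j
  \<comment> \<open>Outside \<open>{..<k}\<close> a fixed Laplace law stands in, because the shift
    bound asks for a real distribution at every index.\<close>
  define D' where "D' j = (if j < k then D j else laplace 1)" for j
  have D_real: "real_distribution (D' j)" for j
    using A.real_distribution_increment[of s k j, OF s0 mono k] real_distribution_laplace[of 1]
    by (simp add: D'_def D_def)
  have eqD: "distr M' borel (B.increment s j) = D j" if "j < k" for j
    unfolding D_def
  proof (rule Levy_uniqueness)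
    show "char (distr M' borel (B.increment s j)) = char (distr M borel (A.increment s j))"
      using A.char_increment[of s k j, OF s0 mono k that] B.char_increment[of s k j, OF s0 mono k that]
      by (simp add: fun_eq_iff)
  qed (use that in \<open>auto intro!: A.real_distribution_increment[of s k, OF s0 mono k] B.real_distribution_increment[of s k, OF s0 mono k]\<close>)
  have lawA: "distr M (Pi\<^sub>M {..<k} (\<lambda>_. borel)) (\<lambda>x. \<lambda>j\<in>{..<k}. A.increment s j x) = Pi\<^sub>M {..<k} D'"
  proof -
    have "distr M (Pi\<^sub>M {..<k} (\<lambda>_. borel)) (\<lambda>x. \<lambda>j\<in>{..<k}. A.increment s j x) = Pi\<^sub>M {..<k} (\<lambda>j. distr M borel (A.increment s j))"
      by (rule A.law_increments[of s k, OF s0 mono k])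
    also have "\<dots> = Pi\<^sub>M {..<k} D'"
      by (rule PiM_cong) (auto simp: D'_def D_def)
    finally show ?thesis .
  qed
  have lawB: "distr M' (Pi\<^sub>M {..<k} (\<lambda>_. borel)) (\<lambda>x. \<lambda>j\<in>{..<k}. B.increment s j x) = Pi\<^sub>M {..<k} D'"
  proof -
    have "distr M' (Pi\<^sub>M {..<k} (\<lambda>_. borel)) (\<lambda>x. \<lambda>j\<in>{..<k}. B.increment s j x) = Pi\<^sub>M {..<k} (\<lambda>j. distr M' borel (B.increment s j))"
      by (rule B.law_increments[of s k, OF s0 mono k])
    also have "\<dots> = Pi\<^sub>M {..<k} D'"
      by (rule PiM_cong) (auto simp: D'_def eqD)
    finally show ?thesis .
  qed
  have D0: "D' 0 = laplace (T r)"
    using k A.law_first_increment[of s k, OF s0 mono k] s1 by (simp add: D'_def D_def)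
  have sets_D: "sets (Pi\<^sub>M K D') = sets (Pi\<^sub>M K (\<lambda>_. borel))" for K
    using D_real by (intro sets_PiM_cong) (auto simp: real_distribution.events_eq_borel)

  have Tr: "0 < T r" using T \<eta> by simp

  have g: "(\<lambda>v. f (h v)) \<in> borel_measurable (Pi\<^sub>M {..<k} (\<lambda>_. borel))"
    using measurable_compose[OF h f] .
  have sh: "(\<lambda>v. v(0 := v 0 + c)) \<in> measurable (Pi\<^sub>M {..<k} (\<lambda>_. borel)) (Pi\<^sub>M {..<k} (\<lambda>_. borel :: real measure))"
    using k by (intro measurable_fun_upd[where J="{..<k}"]) auto
  have gs: "(\<lambda>v. f (h (v(0 := v 0 + c)))) \<in> borel_measurable (Pi\<^sub>M {..<k} (\<lambda>_. borel))"
    using measurable_compose[OF sh g] .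
  have mA: "(\<lambda>x. \<lambda>j\<in>{..<k}. A.increment s j x) \<in> measurable M (Pi\<^sub>M {..<k} (\<lambda>_. borel))"
    by (intro measurable_restrict) (auto intro: A.increment_measurable[of s k, OF s0 mono k])
  have mB: "(\<lambda>x. \<lambda>j\<in>{..<k}. B.increment s j x) \<in> measurable M' (Pi\<^sub>M {..<k} (\<lambda>_. borel))"
    by (intro measurable_restrict) (auto intro: B.increment_measurable[of s k, OF s0 mono k])
  have "(\<lambda>i\<in>R. Z (T i) x + c) = h ((?A x)(0 := (?A x) 0 + c))" for x
  proof (rule ext)
    fix i
    show "(\<lambda>i\<in>R. Z (T i) x + c) i = h ((?A x)(0 := (?A x) 0 + c)) i"
    proof (cases "i \<in> R")
      case True
      \<comment> \<open>Every range \<open>{..idx i}\<close> contains 0, so the shift of coordinate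
        0 is counted exactly once.\<close>
      have "(\<Sum>j\<le>idx i. ((?A x)(0 := (?A x) 0 + c)) j)
        = (\<Sum>j\<le>idx i. A.increment s j x + (if j = 0 then c else 0))"
        using idx(1)[OF True] by (intro sum.cong) auto
      also have "\<dots> = Z (T i) x + c"
        using A.Z_telescope[of s k "idx i" x, OF s0 mono k idx(1)[OF True]] idx(2)[OF True]
        by (simp add: sum.distrib)
      finally show ?thesis using True by (simp add: h_def)
    qed (simp add: h_def)
  qed
  then have "(\<integral>\<^sup>+x. f (\<lambda>i\<in>R. Z (T i) x + c) \<partial>M) =
     (\<integral>\<^sup>+x. f (h ((?A x)(0 := (?A x) 0 + c))) \<partial>M)"
    by simp
  also have "\<dots> = (\<integral>\<^sup>+v. f (h (v(0 := v 0 + c))) \<partial>Pi\<^sub>M {..<k} D')"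
    unfolding lawA[symmetric] by (rule nn_integral_distr[OF mA, symmetric]) (use gs in simp)
  also have "\<dots> \<le> ennreal (exp (\<bar>c\<bar> / T r)) * (\<integral>\<^sup>+v. f (h v) \<partial>Pi\<^sub>M {..<k} D')"
    using k by (intro nn_integral_PiM_laplace_shift D_real D0 Tr g) auto
  also have "(\<integral>\<^sup>+v. f (h v) \<partial>Pi\<^sub>M {..<k} D') = (\<integral>\<^sup>+x. f (h (?B x)) \<partial>M')"
    unfolding lawB[symmetric] by (rule nn_integral_distr[OF mB]) (use g in simp)
  also have "\<dots> = (\<integral>\<^sup>+x. f (\<lambda>i\<in>R. Z' (T i) x) \<partial>M')"
  proof -
    have "h (?B x) = (\<lambda>i\<in>R. Z' (T i) x)" for x
      unfolding h_def
    proof (rule restrict_ext)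
      fix i assume i: "i \<in> R"
      have "(\<Sum>j\<le>idx i. (?B x) j) = (\<Sum>j\<le>idx i. B.increment s j x)"
        using idx(1)[OF i] by (intro sum.cong) auto
      then show "(\<Sum>j\<le>idx i. (?B x) j) = Z' (T i) x"
        using B.Z_telescope[of s k "idx i" x, OF s0 mono k idx(1)[OF i]] idx(2)[OF i] by simp
    qed
    then show ?thesis by simp
  qed
  finally show ?thesis .
qed

section \<open>The halting probability for fixed iterates\<close>

text \<open>Evaluation of a path at a random time is not measurable for the product \<open>\<sigma>\<close>-algebra.  Right-continuous
  paths agree with this limit over dyadic times, which is.\<close>

definition path_eval :: "real \<Rightarrow> (real \<Rightarrow> real) \<Rightarrow> real \<Rightarrow> real" where
  "path_eval \<eta> z t = lim (\<lambda>m. z (max \<eta> ((of_int \<lfloor>2 ^ m * t\<rfloor> + 1) / 2 ^ m)))"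

text \<open>At each dyadic level the evaluation time takes countably many values, and for each of
  them evaluation is a coordinate map.\<close>

lemma path_eval_measurable:
  assumes z: "z \<in> measurable N (Pi\<^sub>M {\<eta>..} (\<lambda>_. borel))" and T[measurable]: "T \<in> borel_measurable N"
  shows "(\<lambda>p. path_eval \<eta> (z p) (T p)) \<in> borel_measurable N"
  unfolding path_eval_def
proof (rule borel_measurable_lim_metric)
  fix m :: nat
  have "(\<lambda>p. z p (max \<eta> ((of_int k + 1) / 2 ^ m))) \<in> borel_measurable N" for k :: int
    by (rule measurable_compose[OF z measurable_component_singleton]) simp
  moreover have "(\<lambda>p. \<lfloor>2 ^ m * T p\<rfloor>) \<in> measurable N (count_space UNIV)"
    by measurable
  ultimately show "(\<lambda>p. z p (max \<eta> ((of_int \<lfloor>2 ^ m * T p\<rfloor> + 1) / 2 ^ m))) \<in> borel_measurable N"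
    by (rule measurable_compose_countable)
qed

text \<open>The dyadic points lie within \<open>1 / 2 ^ m\<close> to the right of \<open>t\<close>,
  the side on which the path is continuous.\<close>

lemma (in laplace_sum) path_eval_Z:
  assumes "x \<in> space M" "\<eta> \<le> t"
  shows "path_eval \<eta> (\<lambda>t\<in>{\<eta>..}. Z t x) t = Z t x"
proof -
  define f :: "nat \<Rightarrow> real" where "f m = (of_int \<lfloor>2 ^ m * t\<rfloor> + 1) / 2 ^ m" for m
  have lower: "t \<le> f m" for m
  proof -
    have "2 ^ m * t \<le> of_int \<lfloor>2 ^ m * t\<rfloor> + 1" by linarith
    then show ?thesis by (simp add: f_def field_simps)
  qed
  have upper: "f m \<le> t + 1 / 2 ^ m" for m
  proof -
    have "of_int \<lfloor>2 ^ m * t\<rfloor> + 1 \<le> 2 ^ m * t + 1" by linarith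
    then show ?thesis by (simp add: f_def field_simps)
  qed
  have "(\<lambda>m. t + 1 / 2 ^ m) \<longlonglongrightarrow> t + 0"
    by (intro tendsto_intros LIMSEQ_divide_realpow_zero) simp
  then have "f \<longlonglongrightarrow> t"
    using lower upper by (intro tendsto_sandwich[of "\<lambda>_. t" f _ "\<lambda>m. t + 1 / 2 ^ m"]) auto
  then have "(\<lambda>m. Z (f m) x) \<longlonglongrightarrow> Z t x"
    using assms lower by (intro Z_right_cont)
  moreover have "(\<lambda>t\<in>{\<eta>..}. Z t x) (max \<eta> (f m)) = Z (f m) x" for m
    using lower[of m] assms(2) by (simp add: max_def)
  ultimately show ?thesis
    unfolding path_eval_def f_def[symmetric] by (simp add: limI)
qed

definition halts_at ::
  "real \<Rightarrow> ('y \<Rightarrow> real) \<Rightarrow> nat \<Rightarrow> (nat \<Rightarrow> 'y) \<Rightarrow> (nat \<Rightarrow> real) \<Rightarrow> (nat \<Rightarrow> real) \<Rightarrow> bool" where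
  "halts_at \<tau> v n \<beta> \<zeta> x \<longleftrightarrow>
     (\<forall>m\<in>{1..<n}. v (\<beta> m) + x m < \<tau> + \<zeta> m) \<and> \<tau> + \<zeta> n \<le> v (\<beta> n) + x n"

definition halts :: "real \<Rightarrow> ('y \<Rightarrow> real) \<Rightarrow> nat \<Rightarrow> (nat \<Rightarrow> 'y) \<Rightarrow> (nat \<Rightarrow> real) \<Rightarrow> (nat \<Rightarrow> real) \<Rightarrow> ennreal" where
  "halts \<tau> v n \<beta> \<zeta> x = (if halts_at \<tau> v n \<beta> \<zeta> x then 1 else 0)"

lemma halts_measurable:
  assumes "\<And>m. m \<in> {1..n} \<Longrightarrow> (\<lambda>p. v (\<beta> p m)) \<in> borel_measurable N"
    and "\<And>m. m \<in> {1..n} \<Longrightarrow> (\<lambda>p. \<zeta> p m) \<in> borel_measurable N"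
    and "\<And>m. m \<in> {1..n} \<Longrightarrow> (\<lambda>p. x p m) \<in> borel_measurable N" and n: "1 \<le> n"
  shows "(\<lambda>p. halts \<tau> v n (\<beta> p) (\<zeta> p) (x p)) \<in> borel_measurable N"
proof -
  have less: "Measurable.pred N (\<lambda>p. v (\<beta> p m) + x p m < \<tau> + \<zeta> p m)" if "m \<in> {1..n}" for m
    using that by (intro borel_measurable_pred_less borel_measurable_add borel_measurable_const assms)
  have le: "Measurable.pred N (\<lambda>p. \<tau> + \<zeta> p n \<le> v (\<beta> p n) + x p n)"
    unfolding pred_def using n
    by (intro borel_measurable_le borel_measurable_add borel_measurable_const assms) auto
  have "Measurable.pred N (\<lambda>p. halts_at \<tau> v n (\<beta> p) (\<zeta> p) (x p))"
    unfolding halts_at_def using less by (intro pred_intros_logic pred_intros_finite le) auto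
  then show ?thesis
    unfolding halts_def by measurable
qed

text \<open>Before round \<open>n\<close>, a utility larger by at most \<open>\<Delta>\<close> is
  offset by the raised threshold. In round \<open>n\<close> the utility may drop by
  \<open>\<Delta>\<close> while the threshold rises by \<open>\<Delta>\<close>, so the noise has to
  make up for \<open>2 * \<Delta>\<close>.\<close>

lemma halts_at_shift:
  assumes v: "\<And>m. m \<in> {1..n} \<Longrightarrow> \<bar>v (\<beta> m) - v' (\<beta> m)\<bar> \<le> \<Delta>" and n: "1 \<le> n"
    and "halts_at \<tau> v n \<beta> \<zeta> x"
  shows "halts_at \<tau> v' n \<beta> (\<lambda>m. \<zeta> m + \<Delta>) (x(n := x n + 2 * \<Delta>))"
proof -
  have "v' (\<beta> m) + x m < \<tau> + (\<zeta> m + \<Delta>)" if "m \<in> {1..<n}" for m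
    using v[of m] assms(3) that unfolding halts_at_def by fastforce
  moreover have "\<tau> + (\<zeta> n + \<Delta>) \<le> v' (\<beta> n) + (x n + 2 * \<Delta>)"
    using v[of n] n assms(3) unfolding halts_at_def by (simp add: abs_le_iff)
  ultimately show ?thesis by (simp add: halts_at_def)
qed

lemma laplace_1_family: "real_distribution ((\<lambda>_. laplace 1) j)"
  by (rule real_distribution_laplace) simp

lemma sets_PiM_laplace [measurable_cong]: "sets (Pi\<^sub>M I (\<lambda>_. laplace s)) = sets (Pi\<^sub>M I (\<lambda>_. borel))"
  by (rule sets_PiM_cong) auto

text \<open>Moving the path up by the sensitivity and the last noise up by twice the sensitivity turns
  halting at \<open>n\<close> under \<open>v\<close> into halting at \<open>n\<close> under \<open>v'\<close>; each move costs a factor \<open>exp (e / 2)\<close>.\<close>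

lemma halting_probability_le:
  fixes M :: "'w measure" and M' :: "'v measure"
  assumes P: "prob_space M" "prob_space M'" and \<eta>: "0 < \<eta>"
    and Z: "laplace_process M \<eta> Z" "laplace_process M' \<eta> Z'"
    and n: "1 \<le> n" and T: "\<eta> \<le> T n" "\<And>m. m \<in> {1..n} \<Longrightarrow> T n \<le> T m"
    and \<Delta>: "0 < \<Delta>" and e: "\<Delta> / T n = e / 2" "2 * \<Delta> / \<sigma> n = e / 2" and \<sigma>: "0 < \<sigma> n"
    and v: "\<And>m. m \<in> {1..n} \<Longrightarrow> \<bar>v (\<beta> m) - v' (\<beta> m)\<bar> \<le> \<Delta>"
  shows "(\<integral>\<^sup>+x. \<integral>\<^sup>+w. halts \<tau> v n \<beta> (\<lambda>m. Z (T m) x) (\<lambda>m. \<sigma> m * w m) \<partial>Pi\<^sub>M {1..n} (\<lambda>_. laplace 1) \<partial>M)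
    \<le> ennreal (exp e) * (\<integral>\<^sup>+x. \<integral>\<^sup>+w. halts \<tau> v' n \<beta> (\<lambda>m. Z' (T m) x) (\<lambda>m. \<sigma> m * w m) \<partial>Pi\<^sub>M {1..n} (\<lambda>_. laplace 1) \<partial>M')"
proof -
  let ?L = "Pi\<^sub>M {1..n} (\<lambda>_. laplace 1)"
  let ?B = "Pi\<^sub>M {1..n} (\<lambda>_. borel) :: (nat \<Rightarrow> real) measure"
  define g where "g v \<zeta> = (\<integral>\<^sup>+w. halts \<tau> v n \<beta> \<zeta> (\<lambda>m. \<sigma> m * w m) \<partial>?L)" for v :: "'a \<Rightarrow> real" and \<zeta>
  have PL: "prob_space ?L"
    by (rule prob_space_PiM) (rule prob_space_laplace_1)
  interpret L: prob_space ?L by (rule PL)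
  have joint_m: "(\<lambda>p. halts \<tau> v n \<beta> (fst p) (\<lambda>m. \<sigma> m * snd p m)) \<in> borel_measurable (?B \<Otimes>\<^sub>M ?B)" for v :: "'a \<Rightarrow> real"
    using n by (intro halts_measurable) auto
  have g_m: "g v \<in> borel_measurable ?B" for v
  proof -
    have "sets (?B \<Otimes>\<^sub>M ?L) = sets (?B \<Otimes>\<^sub>M ?B)"
      by (intro sets_pair_measure_cong sets_PiM_laplace) simp
    then show ?thesis
      unfolding g_def[abs_def] using joint_m[of v]
      by (intro L.borel_measurable_nn_integral) (simp add: case_prod_beta cong: measurable_cong_sets)
  qed
  \<comment> \<open>Only the coordinates in \<open>{1..n}\<close> enter the halting event, so
    restricted and unrestricted vectors of path values are interchangeable.\<close>
  have g_cong: "g v (\<lambda>i\<in>{1..n}. \<zeta> i) = g v \<zeta>" for v \<zeta>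
    using n by (simp add: g_def halts_def halts_at_def)
  have step: "g v \<zeta> \<le> ennreal (exp (e / 2)) * g v' (\<lambda>m. \<zeta> m + \<Delta>)" for \<zeta>
  proof -
    \<comment> \<open>The noise is \<open>\<sigma> n\<close> times a unit Laplace variable, so
      moving the noise by \<open>2 * \<Delta>\<close> means moving that variable by
      \<open>c\<close>.\<close>
    define c where "c = 2 * \<Delta> / \<sigma> n"
    have c: "0 < c" "\<bar>c\<bar> / 1 = e / 2" using \<Delta> \<sigma> e by (auto simp: c_def)
    have "g v \<zeta> \<le> (\<integral>\<^sup>+w. halts \<tau> v' n \<beta> (\<lambda>m. \<zeta> m + \<Delta>) (\<lambda>m. \<sigma> m * (w(n := w n + c)) m) \<partial>?L)"
      unfolding g_def
    proof (rule nn_integral_mono)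
      fix w
      have "(\<lambda>m. \<sigma> m * (w(n := w n + c)) m) = (\<lambda>m. \<sigma> m * w m)(n := \<sigma> n * w n + 2 * \<Delta>)"
        using \<sigma> by (auto simp: c_def fun_eq_iff distrib_left)
      then show "halts \<tau> v n \<beta> \<zeta> (\<lambda>m. \<sigma> m * w m) \<le> halts \<tau> v' n \<beta> (\<lambda>m. \<zeta> m + \<Delta>) (\<lambda>m. \<sigma> m * (w(n := w n + c)) m)"
        using halts_at_shift[of n v \<beta> v' \<Delta> \<tau> \<zeta> "\<lambda>m. \<sigma> m * w m", OF v n] by (simp add: halts_def)
    qed
    also have "\<dots> \<le> ennreal (exp (\<bar>c\<bar> / 1)) * g v' (\<lambda>m. \<zeta> m + \<Delta>)"
      unfolding g_def
    proof (rule nn_integral_PiM_laplace_shift[where s=1])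
      show "(\<lambda>w. halts \<tau> v' n \<beta> (\<lambda>m. \<zeta> m + \<Delta>) (\<lambda>m. \<sigma> m * w m)) \<in> borel_measurable ?B"
        using n by (intro halts_measurable) auto
    qed (use n laplace_1_family in auto)
    finally show ?thesis unfolding c(2) .
  qed
  have Tn: "0 < T n" using T \<eta> by simp
  have "(\<integral>\<^sup>+x. g v (\<lambda>m. Z (T m) x) \<partial>M) \<le> (\<integral>\<^sup>+x. ennreal (exp (e / 2)) * g v' (\<lambda>i\<in>{1..n}. Z (T i) x + \<Delta>) \<partial>M)"
    unfolding g_cong by (intro nn_integral_mono step)
  also have "\<dots> = ennreal (exp (e / 2)) * (\<integral>\<^sup>+x. g v' (\<lambda>i\<in>{1..n}. Z (T i) x + \<Delta>) \<partial>M)"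
  proof (rule nn_integral_cmult)
    obtain P J where A: "laplace_sum M \<eta> P J Z"
      using laplace_process_laplace_sum P \<eta> Z by blast
    have "(\<lambda>x. \<lambda>i\<in>{1..n}. Z (T i) x + \<Delta>) \<in> measurable M ?B"
    proof (rule measurable_restrict)
      fix m assume "m \<in> {1..n}"
      then have "\<eta> \<le> T m" using T(1) T(2)[of m] by simp
      then have "Z (T m) \<in> borel_measurable M" by (rule laplace_sum.Z_measurable[OF A])
      then show "(\<lambda>x. Z (T m) x + \<Delta>) \<in> borel_measurable M" by simp
    qed
    then show "(\<lambda>x. g v' (\<lambda>i\<in>{1..n}. Z (T i) x + \<Delta>)) \<in> borel_measurable M"
      by (rule measurable_compose) (rule g_m)
  qed
  also have "\<dots> \<le> ennreal (exp (e / 2)) * (ennreal (exp (\<bar>\<Delta>\<bar> / T n)) * (\<integral>\<^sup>+x. g v' (\<lambda>i\<in>{1..n}. Z' (T i) x) \<partial>M'))"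
    using n T by (intro mult_left_mono laplace_process_shift[OF P \<eta> Z] g_m) auto
  also have "\<dots> = ennreal (exp e) * (\<integral>\<^sup>+x. g v' (\<lambda>m. Z' (T m) x) \<partial>M')"
  proof -
    have "exp (e / 2) * exp (\<bar>\<Delta>\<bar> / T n) = exp e"
      using \<Delta> e(1) by (simp only: abs_of_pos exp_add[symmetric]) simp
    then have "ennreal (exp (e / 2)) * ennreal (exp (\<bar>\<Delta>\<bar> / T n)) = ennreal (exp e)"
      by (simp only: ennreal_mult[symmetric] exp_ge_zero)
    then show ?thesis
      by (simp only: g_cong mult.assoc[symmetric])
  qed
  finally show ?thesis by (simp add: g_def)
qed

section \<open>The output law\<close>

lemma generator_option_space:
  "insert {None} ((\<lambda>A. Some ` A) ` sets W) \<subseteq> Pow (insert None (Some ` space W))"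
  using sets.sets_into_space by fastforce

lemma space_option_space: "space (option_space W) = insert None (Some ` space W)"
  unfolding option_space_def by (rule space_measure_of[OF generator_option_space])

lemma sets_option_space:
  "sets (option_space W) = sigma_sets (insert None (Some ` space W)) (insert {None} ((\<lambda>A. Some ` A) ` sets W))"
  unfolding option_space_def by (rule sets_measure_of[OF generator_option_space])

lemma option_space_Some_image: "A \<in> sets W \<Longrightarrow> Some ` A \<in> sets (option_space W)"
  unfolding sets_option_space by (intro sigma_sets.Basic) auto

lemma option_space_None: "{None} \<in> sets (option_space W)"
  unfolding sets_option_space by (intro sigma_sets.Basic) auto

lemma measurable_Some: "Some \<in> measurable W (option_space W)"
  unfolding option_space_def
proof (rule measurable_measure_of[OF generator_option_space])
  fix B assume "B \<in> insert {None} ((\<lambda>A. Some ` A) ` sets W)"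
  then consider "B = {None}" | A where "A \<in> sets W" "B = Some ` A" by auto
  then show "Some -` B \<inter> space W \<in> sets W"
  proof cases
    case 1
    then have "Some -` B \<inter> space W = {}" by auto
    then show ?thesis by simp
  next
    case 2
    then have "Some -` B \<inter> space W = A" using sets.sets_into_space by auto
    with 2 show ?thesis by simp
  qed
qed auto

lemma measurable_case_option_space:
  assumes f: "f \<in> measurable W N" and d: "d \<in> space N"
  shows "case_option d f \<in> measurable (option_space W) N"
proof (rule measurableI)
  fix z assume "z \<in> space (option_space W)"
  then show "case_option d f z \<in> space N"
    using d measurable_space[OF f] by (auto simp: space_option_space)
next
  fix B assume "B \<in> sets N"
  then have "Some ` (f -` B \<inter> space W) \<in> sets (option_space W)"
    by (intro option_space_Some_image measurable_sets[OF f])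
  moreover have "case_option d f -` B \<inter> space (option_space W) =
      Some ` (f -` B \<inter> space W) \<union> (if d \<in> B then {None} else {})"
    by (auto simp: space_option_space)
  ultimately show "case_option d f -` B \<inter> space (option_space W) \<in> sets (option_space W)"
    by (simp only:) (intro sets.Un; simp add: option_space_None)
qed

text \<open>On rectangles, independence of the generated \<sigma>-algebras says that joint law and
  product law agree, and rectangles determine both.\<close>

lemma (in prob_space) distr_pair_indep_set:
  assumes X[measurable]: "X \<in> measurable M S" and Y[measurable]: "Y \<in> measurable M T"
    and ind: "indep_set (sets (vimage_algebra (space M) X S)) (sets (vimage_algebra (space M) Y T))"
  shows "distr M S X \<Otimes>\<^sub>M distr M T Y = distr M (S \<Otimes>\<^sub>M T) (\<lambda>x. (X x, Y x))"
proof (rule pair_measure_eqI)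
  show "sigma_finite_measure (distr M S X)" "sigma_finite_measure (distr M T Y)"
    by (intro prob_space_imp_sigma_finite prob_space_distr X Y)+
  fix A B assume "A \<in> sets (distr M S X)" "B \<in> sets (distr M T Y)"
  then have [measurable]: "A \<in> sets S" "B \<in> sets T" by auto
  have "prob ((X -` A \<inter> space M) \<inter> (Y -` B \<inter> space M)) = prob (X -` A \<inter> space M) * prob (Y -` B \<inter> space M)"
    by (rule indep_setD[OF ind]) (auto intro!: in_vimage_algebra)
  moreover have "(\<lambda>x. (X x, Y x)) -` (A \<times> B) \<inter> space M = (X -` A \<inter> space M) \<inter> (Y -` B \<inter> space M)"
    by auto
  ultimately show "emeasure (distr M S X) A * emeasure (distr M T Y) B = emeasure (distr M (S \<Otimes>\<^sub>M T) (\<lambda>x. (X x, Y x))) (A \<times> B)"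
    by (simp add: emeasure_distr emeasure_eq_measure ennreal_mult[symmetric])
qed simp

section \<open>Times and noise scales along the iterates\<close>

locale rat_params =
  fixes Y :: "'y measure" and \<Delta> \<epsilon>max \<tau> :: real and E :: "nat \<Rightarrow> (nat \<Rightarrow> 'y) \<Rightarrow> real"
  assumes \<Delta>: "0 < \<Delta>" and \<epsilon>max: "0 < \<epsilon>max" and E: "privacy_functions Y E"
    and E_le: "\<And>n \<beta>. 1 \<le> n \<Longrightarrow> \<beta> \<in> space (Pi\<^sub>M {1..<n} (\<lambda>_. Y)) \<Longrightarrow> E n \<beta> \<le> \<epsilon>max"
begin

definition \<eta> :: real where "\<eta> = 2 * \<Delta> / \<epsilon>max"

lemma \<eta>_pos: "0 < \<eta>"
  using \<Delta> \<epsilon>max by (simp add: \<eta>_def)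

definition time :: "(nat \<Rightarrow> 'y) \<Rightarrow> nat \<Rightarrow> real" where
  "time \<beta> m = 2 * \<Delta> / rat_eps E m \<beta>"

definition noise_scale :: "(nat \<Rightarrow> 'y) \<Rightarrow> nat \<Rightarrow> real" where
  "noise_scale \<beta> m = 4 * \<Delta> / rat_eps E m \<beta>"

lemma restrict_prefix:
  assumes "\<beta> \<in> space (Pi\<^sub>M K (\<lambda>_. Y))" "I \<subseteq> K"
  shows "restrict \<beta> I \<in> space (Pi\<^sub>M I (\<lambda>_. Y))"
  using assms by (auto simp: space_PiM PiE_iff)

lemma rat_eps_bounds:
  assumes "\<beta> \<in> space (Pi\<^sub>M K (\<lambda>_. Y))" "{1..<m} \<subseteq> K" "1 \<le> m"
  shows "0 < rat_eps E m \<beta>" "rat_eps E m \<beta> \<le> \<epsilon>max"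
  using restrict_prefix[OF assms(1,2)] assms(3) E E_le
  by (auto simp: rat_eps_def privacy_functions_def)

lemma rat_eps_mono:
  assumes \<beta>: "\<beta> \<in> space (Pi\<^sub>M K (\<lambda>_. Y))" "{1..<n} \<subseteq> K" and m: "1 \<le> m" "m \<le> n"
  shows "rat_eps E m \<beta> \<le> rat_eps E n \<beta>"
  using m(2) \<beta>(2)
proof (induction rule: dec_induct)
  case (step i)
  have "{1..<Suc i} = {1..i}" by auto
  then have "restrict \<beta> {1..i} \<in> space (Pi\<^sub>M {1..i} (\<lambda>_. Y))"
    using step.prems by (intro restrict_prefix[OF \<beta>(1)]) auto
  moreover have "restrict (restrict \<beta> {1..i}) {1..<i} = restrict \<beta> {1..<i}" "restrict \<beta> {1..i} = restrict \<beta> {1..<Suc i}"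
    using \<open>{1..<Suc i} = {1..i}\<close> by (auto simp: restrict_def fun_eq_iff)
  ultimately have "rat_eps E i \<beta> \<le> rat_eps E (Suc i) \<beta>"
    using E step.hyps m(1) unfolding privacy_functions_def rat_eps_def by (metis le_trans)
  moreover have "{1..<i} \<subseteq> K" using step.prems by auto
  ultimately show ?case using step.IH by simp
qed simp

lemma rat_eps_measurable:
  assumes "{1..<m} \<subseteq> K" "1 \<le> m"
  shows "rat_eps E m \<in> borel_measurable (Pi\<^sub>M K (\<lambda>_. Y))"
proof -
  have "E m \<in> borel_measurable (Pi\<^sub>M {1..<m} (\<lambda>_. Y))"
    using E assms by (simp add: privacy_functions_def)
  then show ?thesis
    unfolding rat_eps_def[abs_def]
    by (rule measurable_compose[OF measurable_restrict_subset[OF assms(1)]])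
qed

text \<open>The parameter of round \<open>m\<close> reads only earlier iterates, so cutting the
  sequence after round \<open>n\<close> changes no parameter up to that round.\<close>

lemma rat_eps_restrict:
  assumes "m \<le> n" shows "rat_eps E m (restrict \<beta> {1..n}) = rat_eps E m \<beta>"
proof -
  have "restrict (restrict \<beta> {1..n}) {1..<m} = restrict \<beta> {1..<m}"
    using assms by (auto simp: restrict_def fun_eq_iff)
  then show ?thesis by (simp add: rat_eps_def)
qed

lemma time_ge:
  assumes "\<beta> \<in> space (Pi\<^sub>M K (\<lambda>_. Y))" "{1..<m} \<subseteq> K" "1 \<le> m"
  shows "\<eta> \<le> time \<beta> m"
  using rat_eps_bounds[OF assms] \<Delta> unfolding \<eta>_def time_def by (intro divide_left_mono) auto

lemma time_measurable:
  assumes "{1..<m} \<subseteq> K" "1 \<le> m"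
  shows "(\<lambda>\<beta>. time \<beta> m) \<in> borel_measurable (Pi\<^sub>M K (\<lambda>_. Y))"
  unfolding time_def using rat_eps_measurable[OF assms] by measurable

lemma noise_scale_measurable:
  assumes "{1..<m} \<subseteq> K" "1 \<le> m"
  shows "(\<lambda>\<beta>. noise_scale \<beta> m) \<in> borel_measurable (Pi\<^sub>M K (\<lambda>_. Y))"
  unfolding noise_scale_def using rat_eps_measurable[OF assms] by measurable

lemma noise_vector_measurable:
  assumes "{1..n} \<subseteq> K"
  shows "(\<lambda>p. \<lambda>i\<in>{1..n}. noise_scale (fst (fst p)) i * snd p i)
    \<in> measurable ((Pi\<^sub>M K (\<lambda>_. Y) \<Otimes>\<^sub>M N) \<Otimes>\<^sub>M Pi\<^sub>M {1..n} (\<lambda>_. laplace 1)) (Pi\<^sub>M {1..n} (\<lambda>_. borel))"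
    (is "_ \<in> measurable ?N _")
proof (rule measurable_restrict)
  fix i assume i: "i \<in> {1..n}"
  have fst2: "(\<lambda>p. fst (fst p)) \<in> measurable ?N (Pi\<^sub>M K (\<lambda>_. Y))" by measurable
  have "(\<lambda>p. snd p i) \<in> borel_measurable ?N"
    using measurable_compose[OF measurable_snd measurable_component_singleton[OF i, of "\<lambda>_. laplace 1"]]
    by (simp only: measurable_cong_sets[OF refl sets_laplace])
  moreover have "(\<lambda>p. noise_scale (fst (fst p)) i) \<in> borel_measurable ?N"
    using i assms by (intro measurable_compose[OF fst2 noise_scale_measurable]) auto
  ultimately show "(\<lambda>p. noise_scale (fst (fst p)) i * snd p i) \<in> borel_measurable ?N"
    by (rule borel_measurable_times[rotated])
qed

text \<open>The conditional probability of halting at round \<open>n\<close> given the iterates,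
  written with the iterates frozen at \<open>\<beta>\<close>: the laws of the path and of the unit
  noises do not vary with \<open>\<beta>\<close>, which enters only through the integrand.\<close>

definition halting_prob :: "'w measure \<Rightarrow> (real \<Rightarrow> 'w \<Rightarrow> real) \<Rightarrow> ('y \<Rightarrow> real) \<Rightarrow> nat \<Rightarrow> (nat \<Rightarrow> 'y) \<Rightarrow> ennreal" where
  "halting_prob M Z v n \<beta> = (\<integral>\<^sup>+x. \<integral>\<^sup>+w. halts \<tau> v n \<beta> (\<lambda>m. Z (time \<beta> m) x) (\<lambda>m. noise_scale \<beta> m * w m)
     \<partial>Pi\<^sub>M {1..n} (\<lambda>_. laplace 1) \<partial>M)"

lemma halting_prob_le:
  assumes P: "prob_space M" "prob_space M'" and Z: "laplace_process M \<eta> Z" "laplace_process M' \<eta> Z'"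
    and n: "1 \<le> n" and \<beta>: "\<beta> \<in> space (Pi\<^sub>M {1..n} (\<lambda>_. Y))"
    and v: "\<And>y. y \<in> space Y \<Longrightarrow> \<bar>v y - v' y\<bar> \<le> \<Delta>"
  shows "halting_prob M Z v n \<beta> \<le> ennreal (exp (rat_eps E n \<beta>)) * halting_prob M' Z' v' n \<beta>"
  unfolding halting_prob_def
proof (rule halting_probability_le[OF P \<eta>_pos Z n _ _ \<Delta>])
  have sub: "{1..<m} \<subseteq> {1..n}" if "m \<le> n" for m using that by auto
  note b = rat_eps_bounds[OF \<beta> sub]
  show "\<eta> \<le> time \<beta> n" using n by (intro time_ge[OF \<beta>]) auto
  show "time \<beta> n \<le> time \<beta> m" if "m \<in> {1..n}" for m
    using rat_eps_mono[OF \<beta> sub[of n], of m] b[of m] b[of n] that n \<Delta>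
    unfolding time_def by (intro divide_left_mono) auto
  \<comment> \<open>The two scales balance: \<open>\<Delta>\<close> against
    \<open>2 * \<Delta> / \<epsilon>\<close> and \<open>2 * \<Delta>\<close> against
    \<open>4 * \<Delta> / \<epsilon>\<close> have the same ratio.\<close>
  show "\<Delta> / time \<beta> n = rat_eps E n \<beta> / 2" "2 * \<Delta> / noise_scale \<beta> n = rat_eps E n \<beta> / 2" "0 < noise_scale \<beta> n"
    using b[of n] n \<Delta> by (simp_all add: time_def noise_scale_def)
  show "\<bar>v (\<beta> m) - v' (\<beta> m)\<bar> \<le> \<Delta>" if "m \<in> {1..n}" for m
    using \<beta> that by (intro v) (auto simp: space_PiM)
qed

end

section \<open>One run with random iterates\<close>

locale rat_instance = rat_params Y \<Delta> \<epsilon>max \<tau> E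
  for Y :: "'y measure" and \<Delta> \<epsilon>max \<tau> :: real and E :: "nat \<Rightarrow> (nat \<Rightarrow> 'y) \<Rightarrow> real" +
  fixes v :: "'y \<Rightarrow> real" and L :: "(nat \<Rightarrow> 'y) measure"
    and M :: "'w measure" and A :: "'w \<Rightarrow> nat \<Rightarrow> 'y"
    and Z :: "real \<Rightarrow> 'w \<Rightarrow> real" and \<xi> :: "nat \<Rightarrow> 'w \<Rightarrow> real"
  assumes v: "v \<in> borel_measurable Y" and run: "rat_run Y \<Delta> \<epsilon>max E L M A Z \<xi>"
begin

abbreviation "Seq \<equiv> Pi\<^sub>M {1..} (\<lambda>_. Y)"
abbreviation "Path \<equiv> Pi\<^sub>M {\<eta>..} (\<lambda>_. borel :: real measure)"
abbreviation "Pre n \<equiv> Pi\<^sub>M {1..n} (\<lambda>_. Y)"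
abbreviation "Zpath \<equiv> \<lambda>x. \<lambda>t\<in>{\<eta>..}. Z t x"
abbreviation "exceeds \<equiv> rat_above \<Delta> \<tau> E v A Z \<xi>"
abbreviation "RAT \<equiv> rat_output \<Delta> \<tau> E v A Z \<xi>"

lemma run_facts:
  shows prob: "prob_space M" and A_law: "distr M Seq A = L" and process: "laplace_process M \<eta> Z"
    and A_indep: "prob_space.indep_set M (sets (vimage_algebra (space M) A Seq)) (sets (vimage_algebra (space M) Zpath Path))"
    and noise: "cond_indep_law M (Seq \<Otimes>\<^sub>M Path) (\<lambda>x. (A x, Zpath x)) {1..} \<xi> (\<lambda>i a. laplace (noise_scale (fst a) i))"
  using run by (simp_all add: rat_run_def Let_def \<eta>_def noise_scale_def case_prod_beta')

sublocale prob_space M by (rule prob)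

lemma A_measurable [measurable]: "A \<in> measurable M Seq"
  using run by (simp add: rat_run_def Let_def)

lemma A_component: "1 \<le> m \<Longrightarrow> (\<lambda>x. A x m) \<in> measurable M Y"
  by (rule measurable_compose[OF A_measurable measurable_component_singleton]) simp

lemma Zpath_measurable [measurable]: "Zpath \<in> measurable M Path"
proof -
  have "(\<lambda>x. (A x, Zpath x)) \<in> measurable M (Seq \<Otimes>\<^sub>M Path)"
    using noise by (simp add: cond_indep_law_def)
  from measurable_compose[OF this measurable_snd] show ?thesis by simp
qed

lemma noise_measurable [measurable]: "1 \<le> m \<Longrightarrow> \<xi> m \<in> borel_measurable M"
  using noise by (simp add: cond_indep_law_def)

lemma A_space: "x \<in> space M \<Longrightarrow> A x \<in> space Seq"
  using A_measurable by (rule measurable_space)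

lemma path_eval_time:
  assumes "x \<in> space M" "\<eta> \<le> t"
  shows "path_eval \<eta> (Zpath x) t = Z t x"
proof -
  obtain P J where "laplace_sum M \<eta> P J Z"
    using laplace_process_laplace_sum[OF prob \<eta>_pos process] by blast
  then show ?thesis
    using assms by (rule laplace_sum.path_eval_Z)
qed

text \<open>The path is sampled at a random time, so measurability goes through
  \<open>path_eval\<close>, which agrees with \<open>Z\<close> from time \<open>\<eta>\<close>
  on.\<close>

lemma exceeds_measurable:
  assumes m: "1 \<le> m"
  shows "Measurable.pred M (exceeds m)"
proof -
  have sub: "{1..<m} \<subseteq> {1..}" by auto
  have "(\<lambda>x. path_eval \<eta> (Zpath x) (time (A x) m)) \<in> borel_measurable M"
    by (rule path_eval_measurable[OF Zpath_measurable])
      (rule measurable_compose[OF A_measurable time_measurable[OF sub m]])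
  moreover have "(\<lambda>x. v (A x m)) \<in> borel_measurable M"
    using A_component[OF m] v by (rule measurable_compose)
  ultimately have "Measurable.pred M (\<lambda>x. \<tau> + path_eval \<eta> (Zpath x) (time (A x) m) \<le> v (A x m) + \<xi> m x)"
    unfolding pred_def using m by (intro borel_measurable_le borel_measurable_add) auto
  moreover have "exceeds m x \<longleftrightarrow> \<tau> + path_eval \<eta> (Zpath x) (time (A x) m) \<le> v (A x m) + \<xi> m x" if "x \<in> space M" for x
    using path_eval_time[OF that time_ge[OF A_space[OF that] sub m]]
    by (simp add: rat_above_def time_def)
  ultimately show ?thesis
    by (simp cong: measurable_cong)
qed

definition halted :: "nat \<Rightarrow> 'w \<Rightarrow> bool" where
  "halted n x \<longleftrightarrow> (\<forall>m\<in>{1..<n}. \<not> exceeds m x) \<and> exceeds n x"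

text \<open>The halting event is expressed through data whose joint law is known: the first
  \<open>n\<close> iterates, the recorded path and the vector of noises.\<close>

lemma halts_restrict:
  assumes x: "x \<in> space M" and n: "1 \<le> n"
  shows "halts \<tau> v n (restrict (A x) {1..n}) (\<lambda>m. path_eval \<eta> (Zpath x) (time (restrict (A x) {1..n}) m)) (\<lambda>i\<in>{1..n}. \<xi> i x)
    = (if halted n x then 1 else 0)"
proof -
  have "path_eval \<eta> (Zpath x) (time (restrict (A x) {1..n}) m) = Z (2 * \<Delta> / rat_eps E m (A x)) x" if "m \<in> {1..n}" for m
    using path_eval_time[OF x time_ge[OF A_space[OF x], of m]] that
    using rat_eps_restrict[of m n "A x"] by (simp add: time_def subset_eq)
  then show ?thesis
    using n by (auto simp: halts_def halts_at_def halted_def rat_above_def not_le)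
qed

text \<open>Given the iterates, the halting round has the law it has for fixed iterates: the path is
  independent of them, and the noises are scaled unit Laplace variables.\<close>

lemma halting_law:
  assumes n: "1 \<le> n" and h: "h \<in> borel_measurable (Pre n)"
  shows "halting_prob M Z v n \<in> borel_measurable (Pre n)"
    and "(\<integral>\<^sup>+x. h (restrict (A x) {1..n}) * (if halted n x then 1 else 0) \<partial>M) =
      (\<integral>\<^sup>+\<beta>. h \<beta> * halting_prob M Z v n \<beta> \<partial>prefix_law Y n L)"
proof -
  let ?LZ = "distr M Path Zpath"
  let ?W = "Pi\<^sub>M {1..n} (\<lambda>_. laplace 1)"
  let ?B = "Pi\<^sub>M {1..n} (\<lambda>_. borel) :: (nat \<Rightarrow> real) measure"
  let ?S = "Seq \<Otimes>\<^sub>M Path"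
  let ?X = "\<lambda>x. (A x, Zpath x)"
  let ?r = "\<lambda>\<beta>. restrict \<beta> {1..n}"
  define \<Phi> where "\<Phi> \<beta> z x = halts \<tau> v n \<beta> (\<lambda>m. path_eval \<eta> z (time \<beta> m)) x" for \<beta> z x
  have W: "prob_space ?W" by (rule prob_space_PiM) (rule prob_space_laplace_1)
  have LZ: "prob_space ?LZ" by (rule prob_space_distr) measurable
  interpret W: prob_space ?W by (rule W)
  interpret LZ: prob_space ?LZ by (rule LZ)
  have sub: "{1..<m} \<subseteq> {1..n}" if "m \<in> {1..n}" for m using that by auto
  have \<Phi>m: "(\<lambda>p. \<Phi> (fst (fst p)) (snd (fst p)) (snd p)) \<in> borel_measurable ((Pre n \<Otimes>\<^sub>M Path) \<Otimes>\<^sub>M ?B)"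
    unfolding \<Phi>_def
  proof (rule halts_measurable[OF _ _ _ n])
    fix m assume m: "m \<in> {1..n}"
    have fst2: "(\<lambda>p. fst (fst p)) \<in> measurable ((Pre n \<Otimes>\<^sub>M Path) \<Otimes>\<^sub>M ?B) (Pre n)" by measurable
    show "(\<lambda>p. v (fst (fst p) m)) \<in> borel_measurable ((Pre n \<Otimes>\<^sub>M Path) \<Otimes>\<^sub>M ?B)"
      by (rule measurable_compose[OF measurable_compose[OF fst2 measurable_component_singleton[OF m]] v])
    show "(\<lambda>p. path_eval \<eta> (snd (fst p)) (time (fst (fst p)) m)) \<in> borel_measurable ((Pre n \<Otimes>\<^sub>M Path) \<Otimes>\<^sub>M ?B)"
      using m by (intro path_eval_measurable measurable_compose[OF fst2 time_measurable[OF sub[OF m]]]) auto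
    show "(\<lambda>p. snd p m) \<in> borel_measurable ((Pre n \<Otimes>\<^sub>M Path) \<Otimes>\<^sub>M ?B)"
      by (rule measurable_compose[OF measurable_snd measurable_component_singleton[OF m]])
  qed
  note scaled = noise_vector_measurable[of n "{1..n}" Path, OF order_refl]
  have \<Phi>s: "(\<lambda>p. \<Phi> (fst (fst p)) (snd (fst p)) (\<lambda>i\<in>{1..n}. noise_scale (fst (fst p)) i * snd p i))
      \<in> borel_measurable ((Pre n \<Otimes>\<^sub>M Path) \<Otimes>\<^sub>M ?W)"
    using measurable_compose[OF measurable_Pair[OF measurable_fst scaled] \<Phi>m] by simp
  \<comment> \<open>The noises are integrated out for a fixed path; a second integration over the
    law of the path will give the halting probability.\<close>
  define \<psi> where "\<psi> p = (\<integral>\<^sup>+w. \<Phi> (fst p) (snd p) (\<lambda>i\<in>{1..n}. noise_scale (fst p) i * w i) \<partial>?W)" for p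
  have \<psi>m: "\<psi> \<in> borel_measurable (Pre n \<Otimes>\<^sub>M Path)"
    unfolding \<psi>_def[abs_def] using \<Phi>s by (intro W.borel_measurable_nn_integral) (simp add: case_prod_beta)
  have hp: "halting_prob M Z v n \<beta> = (\<integral>\<^sup>+z. \<psi> (\<beta>, z) \<partial>?LZ)" if \<beta>: "\<beta> \<in> space (Pre n)" for \<beta>
  proof -
    have "(\<lambda>z. \<psi> (\<beta>, z)) \<in> borel_measurable Path"
      using measurable_compose[OF measurable_Pair1'[OF \<beta>] \<psi>m] .
    then have "(\<integral>\<^sup>+z. \<psi> (\<beta>, z) \<partial>?LZ) = (\<integral>\<^sup>+x. \<psi> (\<beta>, Zpath x) \<partial>M)"
      by (intro nn_integral_distr) auto
    also have "\<dots> = halting_prob M Z v n \<beta>"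
      unfolding halting_prob_def \<psi>_def
    proof (intro nn_integral_cong)
      fix x w assume x: "x \<in> space M"
      have "path_eval \<eta> (Zpath x) (time \<beta> m) = Z (time \<beta> m) x" if "m \<in> {1..n}" for m
        using path_eval_time[OF x time_ge[OF \<beta> sub[OF that]]] that by simp
      then show "\<Phi> (fst (\<beta>, Zpath x)) (snd (\<beta>, Zpath x)) (\<lambda>i\<in>{1..n}. noise_scale (fst (\<beta>, Zpath x)) i * w i) =
          halts \<tau> v n \<beta> (\<lambda>m. Z (time \<beta> m) x) (\<lambda>m. noise_scale \<beta> m * w m)"
        using n by (simp add: \<Phi>_def halts_def halts_at_def)
    qed
    finally show ?thesis ..
  qed
  have "(\<lambda>\<beta>. \<integral>\<^sup>+z. \<psi> (\<beta>, z) \<partial>?LZ) \<in> borel_measurable (Pre n)"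
    using \<psi>m by (intro LZ.borel_measurable_nn_integral) (simp cong: measurable_cong_sets)
  then show hp_m: "halting_prob M Z v n \<in> borel_measurable (Pre n)"
    by (rule measurable_cong[THEN iffD1, rotated]) (simp add: hp)

  have r_m: "?r \<in> measurable Seq (Pre n)"
    by (rule measurable_restrict_subset) auto
  have r_pair: "(\<lambda>p. (?r (fst p), snd p)) \<in> measurable ?S (Pre n \<Otimes>\<^sub>M Path)"
    by (intro measurable_Pair measurable_compose[OF measurable_fst r_m] measurable_snd)
  have r3: "(\<lambda>p. ((?r (fst (fst p)), snd (fst p)), snd p)) \<in> measurable (?S \<Otimes>\<^sub>M N) ((Pre n \<Otimes>\<^sub>M Path) \<Otimes>\<^sub>M N)" for N :: "(nat \<Rightarrow> real) measure"
    by (intro measurable_Pair measurable_compose[OF measurable_fst measurable_compose[OF measurable_fst r_m]]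
      measurable_compose[OF measurable_fst measurable_snd] measurable_snd)
  \<comment> \<open>The integrand lives on whole sequences because the noises are conditionally
    independent given the whole sequence; the restriction makes it depend on the first
    \<open>n\<close> iterates only.\<close>
  define G where "G p = h (?r (fst (fst p))) * \<Phi> (?r (fst (fst p))) (snd (fst p)) (snd p)" for p
  have G: "G \<in> borel_measurable (?S \<Otimes>\<^sub>M ?B)"
    unfolding G_def[abs_def]
    using measurable_compose[OF r3 \<Phi>m]
    by (intro borel_measurable_times_ennreal measurable_compose[OF measurable_compose[OF measurable_fst measurable_compose[OF measurable_fst r_m]] h]) simp_all
  have X: "?X \<in> measurable M ?S" by measurable
  \<comment> \<open>The independence of iterates and path enters here and makes the law of the pair
    a product.\<close>
  have "distr M ?S ?X = distr M Seq A \<Otimes>\<^sub>M ?LZ"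
    by (rule distr_pair_indep_set[OF A_measurable Zpath_measurable A_indep, symmetric])
  then have law_X: "distr M ?S ?X = L \<Otimes>\<^sub>M ?LZ" by (simp only: A_law)
  have joint: "distr M (?S \<Otimes>\<^sub>M ?B) (\<lambda>x. (?X x, \<lambda>i\<in>{1..n}. \<xi> i x)) =
    distr (distr M ?S ?X \<Otimes>\<^sub>M ?W) (?S \<Otimes>\<^sub>M ?B) (\<lambda>(a, w). (a, \<lambda>i\<in>{1..n}. noise_scale (fst a) i * w i))"
  proof (rule cond_indep_law_laplace_joint[OF prob noise])
    fix i assume "i \<in> {1..n}"
    then show "(\<lambda>a. noise_scale (fst a) i) \<in> borel_measurable ?S"
      by (intro measurable_compose[OF measurable_fst noise_scale_measurable]) auto
  next
    have "\<forall>i\<in>{1..n}. 0 < noise_scale (A x) i" if "x \<in> space M" for x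
      using rat_eps_bounds(1)[OF A_space[OF that]] \<Delta> by (auto simp: noise_scale_def subset_eq)
    then show "AE x in M. \<forall>i\<in>{1..n}. 0 < noise_scale (fst (?X x)) i"
      by (intro AE_I2) simp
  qed auto
  have mX: "(\<lambda>x. (?X x, \<lambda>i\<in>{1..n}. \<xi> i x)) \<in> measurable M (?S \<Otimes>\<^sub>M ?B)"
    by (intro measurable_Pair[OF X] measurable_restrict) auto
  have law_cong: "measurable (distr M ?S ?X \<Otimes>\<^sub>M ?W) ?B = measurable (?S \<Otimes>\<^sub>M ?W) ?B"
    by (intro measurable_cong_sets sets_pair_measure_cong) simp_all
  have "(\<lambda>p. \<lambda>i\<in>{1..n}. noise_scale (fst (fst p)) i * snd p i) \<in> measurable (distr M ?S ?X \<Otimes>\<^sub>M ?W) ?B"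
    unfolding law_cong by (rule noise_vector_measurable) auto
  then have scaled': "(\<lambda>(a, w). (a, \<lambda>i\<in>{1..n}. noise_scale (fst a) i * w i)) \<in> measurable (distr M ?S ?X \<Otimes>\<^sub>M ?W) (?S \<Otimes>\<^sub>M ?B)"
    unfolding case_prod_beta by (intro measurable_Pair) simp_all
  have Gs: "(\<lambda>p. G (case p of (a, w) \<Rightarrow> (a, \<lambda>i\<in>{1..n}. noise_scale (fst a) i * w i))) \<in> borel_measurable (distr M ?S ?X \<Otimes>\<^sub>M ?W)"
    using scaled' G by (rule measurable_compose)
  have scale_r: "(\<lambda>i\<in>{1..n}. noise_scale \<beta> i * w i) = (\<lambda>i\<in>{1..n}. noise_scale (?r \<beta>) i * w i)" for \<beta> w
  proof (rule restrict_ext)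
    fix i assume "i \<in> {1..n}"
    then show "noise_scale \<beta> i * w i = noise_scale (?r \<beta>) i * w i"
      using rat_eps_restrict[of i n \<beta>] by (simp add: noise_scale_def)
  qed
  have L: "prob_space L" unfolding A_law[symmetric] by (rule prob_space_distr) measurable
  have sets_L: "sets L = sets Seq" unfolding A_law[symmetric] by simp
  have "(\<integral>\<^sup>+x. h (?r (A x)) * (if halted n x then 1 else 0) \<partial>M) = (\<integral>\<^sup>+x. G (?X x, \<lambda>i\<in>{1..n}. \<xi> i x) \<partial>M)"
    by (intro nn_integral_cong) (simp only: G_def \<Phi>_def fst_conv snd_conv halts_restrict[OF _ n])
  also have "\<dots> = (\<integral>\<^sup>+p. G p \<partial>distr M (?S \<Otimes>\<^sub>M ?B) (\<lambda>x. (?X x, \<lambda>i\<in>{1..n}. \<xi> i x)))"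
    by (rule nn_integral_distr[OF mX, symmetric]) (use G in simp)
  also have "\<dots> = (\<integral>\<^sup>+p. G (case p of (a, w) \<Rightarrow> (a, \<lambda>i\<in>{1..n}. noise_scale (fst a) i * w i)) \<partial>(distr M ?S ?X \<Otimes>\<^sub>M ?W))"
    unfolding joint by (rule nn_integral_distr[OF scaled']) (use G in simp)
  also have "\<dots> = (\<integral>\<^sup>+a. \<integral>\<^sup>+w. G (a, \<lambda>i\<in>{1..n}. noise_scale (fst a) i * w i) \<partial>?W \<partial>distr M ?S ?X)"
    by (subst W.nn_integral_fst[OF Gs, symmetric]) simp
  also have "\<dots> = (\<integral>\<^sup>+a. h (?r (fst a)) * \<psi> (?r (fst a), snd a) \<partial>distr M ?S ?X)"
  proof (rule nn_integral_cong)
    fix a assume "a \<in> space (distr M ?S ?X)"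
    then have a: "(?r (fst a), snd a) \<in> space (Pre n \<Otimes>\<^sub>M Path)"
      using measurable_space[OF r_pair, of a] by simp
    have "(\<lambda>w. \<Phi> (?r (fst a)) (snd a) (\<lambda>i\<in>{1..n}. noise_scale (?r (fst a)) i * w i)) \<in> borel_measurable ?W"
      using measurable_compose[OF measurable_Pair1'[OF a] \<Phi>s] by simp
    moreover have "G (a, \<lambda>i\<in>{1..n}. noise_scale (fst a) i * w i) =
        h (?r (fst a)) * \<Phi> (?r (fst a)) (snd a) (\<lambda>i\<in>{1..n}. noise_scale (?r (fst a)) i * w i)" for w
      by (simp only: G_def fst_conv snd_conv scale_r[of "fst a" w])
    ultimately show "(\<integral>\<^sup>+w. G (a, \<lambda>i\<in>{1..n}. noise_scale (fst a) i * w i) \<partial>?W) = h (?r (fst a)) * \<psi> (?r (fst a), snd a)"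
      by (simp only: \<psi>_def fst_conv snd_conv nn_integral_cmult)
  qed
  also have "\<dots> = (\<integral>\<^sup>+\<beta>. \<integral>\<^sup>+z. h (?r \<beta>) * \<psi> (?r \<beta>, z) \<partial>?LZ \<partial>L)"
  proof -
    have "(\<lambda>a. h (?r (fst a)) * \<psi> (?r (fst a), snd a)) \<in> borel_measurable ?S"
      by (intro borel_measurable_times_ennreal measurable_compose[OF measurable_compose[OF measurable_fst r_m] h] measurable_compose[OF r_pair \<psi>m])
    moreover have "sets (L \<Otimes>\<^sub>M ?LZ) = sets ?S"
      by (intro sets_pair_measure_cong sets_L) simp
    ultimately show ?thesis
      unfolding law_X by (subst LZ.nn_integral_fst[symmetric]) (simp_all cong: measurable_cong_sets)
  qed
  also have "\<dots> = (\<integral>\<^sup>+\<beta>. h (?r \<beta>) * halting_prob M Z v n (?r \<beta>) \<partial>L)"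
  proof (rule nn_integral_cong)
    fix \<beta> assume "\<beta> \<in> space L"
    then have r: "?r \<beta> \<in> space (Pre n)"
      using measurable_space[OF r_m] by (simp add: sets_eq_imp_space_eq[OF sets_L])
    have "(\<lambda>z. \<psi> (?r \<beta>, z)) \<in> borel_measurable ?LZ"
      using measurable_compose[OF measurable_Pair1'[OF r] \<psi>m] by simp
    then show "(\<integral>\<^sup>+z. h (?r \<beta>) * \<psi> (?r \<beta>, z) \<partial>?LZ) = h (?r \<beta>) * halting_prob M Z v n (?r \<beta>)"
      by (simp only: nn_integral_cmult hp[OF r])
  qed
  also have "\<dots> = (\<integral>\<^sup>+\<beta>. h \<beta> * halting_prob M Z v n \<beta> \<partial>prefix_law Y n L)"
    unfolding prefix_law_def
    using r_m h hp_m by (subst nn_integral_distr) (simp_all add: measurable_cong_sets[OF sets_L refl])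
  finally show "(\<integral>\<^sup>+x. h (?r (A x)) * (if halted n x then 1 else 0) \<partial>M) =
      (\<integral>\<^sup>+\<beta>. h \<beta> * halting_prob M Z v n \<beta> \<partial>prefix_law Y n L)" .
qed

end

section \<open>Outputs halting at a given round\<close>

context rat_params
begin

text \<open>The full output is determined by the halting round and the iterates up to it; reading
  the iterates back undoes this map.\<close>

definition halted_output :: "nat \<Rightarrow> (nat \<Rightarrow> 'y) \<Rightarrow> nat \<Rightarrow> ('y \<times> bool) option" where
  "halted_output n \<beta> = (\<lambda>m\<in>{1..}. if m \<le> n then Some (\<beta> m, m = n) else None)"

lemma measurable_Some_pair:
  "f \<in> measurable N Y \<Longrightarrow> Measurable.pred N g \<Longrightarrow>
    (\<lambda>p. Some (f p, g p)) \<in> measurable N (option_space (Y \<Otimes>\<^sub>M count_space UNIV))"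
  by (rule measurable_compose[OF _ measurable_Some]) (intro measurable_Pair, simp_all)

lemma measurable_None: "(\<lambda>p. None) \<in> measurable N (option_space W)"
  by (rule measurable_const) (simp add: space_option_space)

lemma halted_output_measurable:
  "halted_output n \<in> measurable (Pi\<^sub>M {1..n} (\<lambda>_. Y)) (rat_output_space Y)"
  unfolding halted_output_def[abs_def] rat_output_space_def
proof (rule measurable_restrict)
  fix m :: nat assume m: "m \<in> {1..}"
  show "(\<lambda>\<beta>. if m \<le> n then Some (\<beta> m, m = n) else None)
      \<in> measurable (Pi\<^sub>M {1..n} (\<lambda>_. Y)) (option_space (Y \<Otimes>\<^sub>M count_space UNIV))"
  proof (cases "m \<le> n")
    case True
    then have "(\<lambda>\<beta>. \<beta> m) \<in> measurable (Pi\<^sub>M {1..n} (\<lambda>_. Y)) Y"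
      using m by (intro measurable_component_singleton) auto
    then show ?thesis
      using True by (simp add: measurable_Some_pair)
  qed (simp add: measurable_None)
qed

text \<open>Only the entry of round \<open>n\<close> is constrained: in an actual output a bit 1
  there already forces all earlier bits to be 0.\<close>

definition halted_space :: "nat \<Rightarrow> (nat \<Rightarrow> ('y \<times> bool) option) set" where
  "halted_space n = {z \<in> space (rat_output_space Y). \<exists>y\<in>space Y. z n = Some (y, True)}"

lemma halted_space_sets:
  assumes "1 \<le> n"
  shows "halted_space n \<in> sets (rat_output_space Y)"
proof -
  let ?O = "option_space (Y \<Otimes>\<^sub>M count_space (UNIV :: bool set))"
  have "Some ` (space Y \<times> {True}) \<in> sets ?O"
    by (intro option_space_Some_image) auto
  moreover have "(\<lambda>z. z n) \<in> measurable (rat_output_space Y) ?O"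
    unfolding rat_output_space_def using assms by (intro measurable_component_singleton) auto
  ultimately have "(\<lambda>z. z n) -` (Some ` (space Y \<times> {True})) \<inter> space (rat_output_space Y) \<in> sets (rat_output_space Y)"
    by (rule measurable_sets[rotated])
  also have "(\<lambda>z. z n) -` (Some ` (space Y \<times> {True})) \<inter> space (rat_output_space Y) = halted_space n"
    by (auto simp: halted_space_def)
  finally show ?thesis .
qed

text \<open>The element \<open>y\<close> fills in for entries \<open>None\<close> and makes the map
  total and measurable on the whole output space; an output halting at \<open>n\<close> has no such
  entry among its first \<open>n\<close> rounds.\<close>

definition iterates :: "'y \<Rightarrow> nat \<Rightarrow> (nat \<Rightarrow> ('y \<times> bool) option) \<Rightarrow> nat \<Rightarrow> 'y" where
  "iterates y n z = (\<lambda>m\<in>{1..n}. case_option y fst (z m))"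

lemma iterates_measurable:
  assumes "y \<in> space Y"
  shows "iterates y n \<in> measurable (rat_output_space Y) (Pi\<^sub>M {1..n} (\<lambda>_. Y))"
  unfolding iterates_def[abs_def]
proof (rule measurable_restrict)
  fix m assume m: "m \<in> {1..n}"
  have "(\<lambda>z. z m) \<in> measurable (rat_output_space Y) (option_space (Y \<Otimes>\<^sub>M count_space (UNIV :: bool set)))"
    unfolding rat_output_space_def using m by (intro measurable_component_singleton) auto
  then show "(\<lambda>z. case_option y fst (z m)) \<in> measurable (rat_output_space Y) Y"
    by (rule measurable_compose) (intro measurable_case_option_space measurable_fst assms)
qed

lemma iterates_halted_output:
  assumes "\<beta> \<in> extensional {1..n}"
  shows "iterates y n (halted_output n \<beta>) = \<beta>"
  using assms by (auto simp: iterates_def halted_output_def fun_eq_iff extensional_def)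

end

context rat_instance
begin

lemma RAT_measurable: "RAT \<in> measurable M (rat_output_space Y)"
  unfolding rat_output_def[abs_def] rat_output_space_def
proof (rule measurable_restrict)
  fix n :: nat assume n: "n \<in> {1..}"
  have "Measurable.pred M (\<lambda>x. \<forall>m\<in>{1..<n}. \<not> exceeds m x)"
    by (intro pred_intros_finite pred_intros_logic exceeds_measurable) auto
  then show "(\<lambda>x. if \<forall>m\<in>{1..<n}. \<not> exceeds m x then Some (A x n, exceeds n x) else None)
      \<in> measurable M (option_space (Y \<Otimes>\<^sub>M count_space UNIV))"
    using n unfolding pred_def
    by (intro measurable_If measurable_Some_pair measurable_None A_component exceeds_measurable) auto
qed

lemma RAT_halted:
  assumes "halted n x" "1 \<le> n"
  shows "RAT x = halted_output n (restrict (A x) {1..n})"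
proof
  fix m
  consider "m = 0" | "1 \<le> m" "m < n" | "m = n" | "n < m" by linarith
  then show "RAT x m = halted_output n (restrict (A x) {1..n}) m"
    using assms by cases (auto simp: rat_output_def halted_output_def halted_def)
qed

lemma RAT_halted_space_iff:
  assumes "x \<in> space M" "1 \<le> n"
  shows "RAT x \<in> halted_space n \<longleftrightarrow> halted n x"
proof -
  have "A x n \<in> space Y"
    using A_space[OF assms(1)] assms(2) by (auto simp: space_PiM)
  then show ?thesis
    using assms measurable_space[OF RAT_measurable assms(1)]
    by (auto simp: halted_space_def rat_output_def halted_def split: if_splits)
qed

text \<open>An infimum over the empty set of extended naturals is infinite, so a finite one is
  attained by well-ordering.\<close>

lemma halting_round_halted:
  assumes "halting_round (RAT x) = enat n"
  shows "1 \<le> n \<and> halted n x"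
proof -
  let ?S = "{enat n |n. 1 \<le> n \<and> (\<exists>\<beta>. RAT x n = Some (\<beta>, True))}"
  have "?S \<noteq> {}"
    using assms unfolding halting_round_def by (metis Inf_enat_def enat.distinct(2) infinity_enat_def)
  then have "Inf ?S \<in> ?S"
    by (metis (no_types, lifting) wellorder_InfI ex_in_conv)
  then have "enat n \<in> ?S"
    using assms by (simp only: halting_round_def)
  then obtain \<beta> where "1 \<le> n" "RAT x n = Some (\<beta>, True)" by auto
  then show ?thesis
    by (auto simp: rat_output_def halted_def split: if_splits)
qed

text \<open>On outputs halting at \<open>n\<close>, the output law is the image under
  \<open>halted_output n\<close> of the prefix law weighted by \<open>halting_prob\<close>.
  Comparing output laws is thereby reduced to comparing weighted prefix laws.\<close>

lemma nn_integral_RAT: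
  assumes n: "1 \<le> n" and f: "f \<in> borel_measurable (rat_output_space Y)"
    and supp: "\<And>z. z \<notin> halted_space n \<Longrightarrow> f z = 0"
  shows "(\<integral>\<^sup>+z. f z \<partial>distr M (rat_output_space Y) RAT) =
    (\<integral>\<^sup>+\<beta>. f (halted_output n \<beta>) * halting_prob M Z v n \<beta> \<partial>prefix_law Y n L)"
proof -
  have "(\<integral>\<^sup>+z. f z \<partial>distr M (rat_output_space Y) RAT) = (\<integral>\<^sup>+x. f (RAT x) \<partial>M)"
    using f by (intro nn_integral_distr RAT_measurable) simp
  also have "\<dots> = (\<integral>\<^sup>+x. f (halted_output n (restrict (A x) {1..n})) * (if halted n x then 1 else 0) \<partial>M)"
  proof (rule nn_integral_cong)
    fix x assume x: "x \<in> space M"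
    show "f (RAT x) = f (halted_output n (restrict (A x) {1..n})) * (if halted n x then 1 else 0)"
    proof (cases "halted n x")
      case True
      then show ?thesis by (simp only: RAT_halted[OF True n] if_True mult_1_right)
    next
      case False
      then show ?thesis using RAT_halted_space_iff[OF x n] supp by simp
    qed
  qed
  also have "\<dots> = (\<integral>\<^sup>+\<beta>. f (halted_output n \<beta>) * halting_prob M Z v n \<beta> \<partial>prefix_law Y n L)"
    by (rule halting_law(2)[OF n]) (rule measurable_compose[OF halted_output_measurable f])
  finally show ?thesis .
qed

lemma prefix_law_prob: "prob_space (prefix_law Y n L)" "sets (prefix_law Y n L) = sets (Pre n)"
proof -
  have "prob_space L" unfolding A_law[symmetric] by (rule prob_space_distr) measurable
  moreover have "(\<lambda>\<beta>. restrict \<beta> {1..n}) \<in> measurable L (Pre n)"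
    unfolding A_law[symmetric] measurable_distr_eq1 by (rule measurable_restrict_subset) auto
  ultimately show "prob_space (prefix_law Y n L)"
    unfolding prefix_law_def by (rule prob_space.prob_space_distr)
qed (simp add: prefix_law_def)

end

section \<open>Comparison of the output laws on neighbors\<close>

theorem theorem5p1:
  fixes Y :: "'y measure"
    and nbr :: "'x \<Rightarrow> 'x \<Rightarrow> bool"
    and Alg :: "'x \<Rightarrow> (nat \<Rightarrow> 'y) measure"
    and u :: "'y \<Rightarrow> 'x \<Rightarrow> real"
    and E :: "nat \<Rightarrow> (nat \<Rightarrow> 'y) \<Rightarrow> real"
    and \<Delta> \<epsilon>max \<tau> :: real
    and x x' :: 'x
    and M :: "'w measure" and A :: "'w \<Rightarrow> nat \<Rightarrow> 'y"
    and Z :: "real \<Rightarrow> 'w \<Rightarrow> real" and \<xi> :: "nat \<Rightarrow> 'w \<Rightarrow> real"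
    and M' :: "'v measure" and A' :: "'v \<Rightarrow> nat \<Rightarrow> 'y"
    and Z' :: "real \<Rightarrow> 'v \<Rightarrow> real" and \<xi>' :: "nat \<Rightarrow> 'v \<Rightarrow> real"
  defines "RAT \<equiv> rat_output \<Delta> \<tau> E (\<lambda>\<beta>. u \<beta> x) A Z \<xi>"
    and "RAT' \<equiv> rat_output \<Delta> \<tau> E (\<lambda>\<beta>. u \<beta> x') A' Z' \<xi>'"
  assumes "standard_borel Y"
    and "\<And>x. Alg x \<in> space (prob_algebra (Pi\<^sub>M {1..} (\<lambda>_. Y)))"
    and "0 < \<Delta>" and "0 < \<epsilon>max"
    and "\<And>x. (\<lambda>\<beta>. u \<beta> x) \<in> borel_measurable Y"
    and "\<And>\<beta>. \<beta> \<in> space Y \<Longrightarrow> sensitive nbr \<Delta> (u \<beta>)"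
    and "privacy_functions Y E"
    and "\<And>n \<beta>. 1 \<le> n \<Longrightarrow> \<beta> \<in> space (Pi\<^sub>M {1..<n} (\<lambda>_. Y)) \<Longrightarrow> E n \<beta> \<le> \<epsilon>max"
    and "nbr x x'"
    and "rat_run Y \<Delta> \<epsilon>max E (Alg x) M A Z \<xi>"
    and "rat_run Y \<Delta> \<epsilon>max E (Alg x') M' A' Z' \<xi>'"
  shows "AE \<omega> in M. \<forall>n. halting_round (RAT \<omega>) = enat n \<longrightarrow>
           privacy_loss (distr M (rat_output_space Y) RAT) (distr M' (rat_output_space Y) RAT') (RAT \<omega>)
           \<le> privacy_loss (prefix_law Y n (Alg x)) (prefix_law Y n (Alg x')) (restrict (A \<omega>) {1..n})
             + ereal (E n (restrict (A \<omega>) {1..<n}))"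
proof -
  interpret R: rat_instance Y \<Delta> \<epsilon>max \<tau> E "\<lambda>\<beta>. u \<beta> x" "Alg x" M A Z \<xi>
    by unfold_locales (use assms in auto)
  interpret R': rat_instance Y \<Delta> \<epsilon>max \<tau> E "\<lambda>\<beta>. u \<beta> x'" "Alg x'" M' A' Z' \<xi>'
    by unfold_locales (use assms in auto)
  let ?O = "rat_output_space Y"
  define P where "P = distr M ?O RAT"
  define P' where "P' = distr M' ?O RAT'"
  have RAT_m: "RAT \<in> measurable M ?O" "RAT' \<in> measurable M' ?O"
    unfolding RAT_def RAT'_def by (rule R.RAT_measurable R'.RAT_measurable)+
  have P: "finite_measure P" "finite_measure P'" "sets P' = sets P"
    unfolding P_def P'_def
    using R.prob_space_distr[OF RAT_m(1)] R'.prob_space_distr[OF RAT_m(2)] by (auto simp: prob_space_def)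
  \<comment> \<open>A filler element for \<open>iterates\<close>; it exists because the run produces
    a first iterate.\<close>
  obtain y where y: "y \<in> space Y"
  proof -
    obtain \<omega> where "\<omega> \<in> space M" using R.not_empty by auto
    then show thesis
      using R.A_space[of \<omega>] by (intro that[of "A \<omega> 1"]) (auto simp: space_PiM)
  qed
  have u: "\<bar>u z x - u z x'\<bar> \<le> \<Delta>" if "z \<in> space Y" for z
    using assms(8)[OF that] \<open>nbr x x'\<close> by (simp add: sensitive_def)
  have main: "AE \<omega> in M. halting_round (RAT \<omega>) = enat n \<longrightarrow>
      privacy_loss P P' (RAT \<omega>)
      \<le> privacy_loss (prefix_law Y n (Alg x)) (prefix_law Y n (Alg x')) (restrict (A \<omega>) {1..n})
        + ereal (E n (restrict (A \<omega>) {1..<n}))" if n: "1 \<le> n" for n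
  proof -
    let ?Pre = "Pi\<^sub>M {1..n} (\<lambda>_. Y)"
    define a where "a = prefix_law Y n (Alg x)"
    define a' where "a' = prefix_law Y n (Alg x')"
    have a: "finite_measure a" "finite_measure a'" "sets a' = sets a" "sets a = sets ?Pre"
      using R.prefix_law_prob[of n] R'.prefix_law_prob[of n] by (auto simp: a_def a'_def prob_space_def)
    \<comment> \<open>The density ratio of the two prefix laws, whose logarithm is the privacy loss
      of the iterates.\<close>
    define g where "g \<beta> = RN_deriv (sum_measure a a') a \<beta> / RN_deriv (sum_measure a a') a' \<beta>" for \<beta>
    define e where "e \<beta> = ennreal (exp (rat_eps E n \<beta>))" for \<beta>
    \<comment> \<open>The claimed bound for the ratio of the output densities, expressed as a
      function of the output.\<close>
    define r where "r z = g (R.iterates y n z) * e (R.iterates y n z)" for z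
    \<comment> \<open>Where \<open>g\<close> is infinite, the right-hand side of the claim is
      infinite as well, so only the remaining outputs need a comparison of densities.\<close>
    define D where "D = {z \<in> space ?O. z \<in> R.halted_space n \<and> g (R.iterates y n z) \<noteq> \<infinity>}"
    have it: "R.iterates y n \<in> measurable ?O ?Pre"
      by (rule R.iterates_measurable[OF y])
    have g_m: "g \<in> borel_measurable ?Pre"
    proof -
      have "g \<in> borel_measurable a"
        unfolding g_def using measurable_RN_sum_measure[OF a(1-3)] by measurable
      then show ?thesis
        by (simp cong: measurable_cong_sets add: a(4))
    qed
    have e_m: "e \<in> borel_measurable ?Pre"
    proof -
      have "rat_eps E n \<in> borel_measurable ?Pre"
        by (rule R.rat_eps_measurable) (use n in auto)
      then show ?thesis unfolding e_def by measurable
    qed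
    have g_it: "(\<lambda>z. g (R.iterates y n z)) \<in> borel_measurable ?O"
      using it g_m by (rule measurable_compose)
    have r_m: "r \<in> borel_measurable ?O"
      unfolding r_def using g_it measurable_compose[OF it e_m] by measurable
    have D_m: "D \<in> sets ?O"
    proof -
      have "{z \<in> space ?O. g (R.iterates y n z) \<noteq> \<infinity>} \<in> sets ?O"
        using g_it by measurable
      then have "R.halted_space n \<inter> {z \<in> space ?O. g (R.iterates y n z) \<noteq> \<infinity>} \<in> sets ?O"
        by (intro sets.Int R.halted_space_sets[OF n])
      also have "R.halted_space n \<inter> {z \<in> space ?O. g (R.iterates y n z) \<noteq> \<infinity>} = D"
        by (auto simp: D_def)
      finally show ?thesis .
    qed
    have "AE z in P. z \<in> D \<longrightarrow> RN_deriv (sum_measure P P') P z / RN_deriv (sum_measure P P') P' z \<le> r z"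
    proof (rule RN_ratio_le[OF P])
      show "D \<in> sets P" "r \<in> borel_measurable P"
        using D_m r_m by (simp_all add: P_def)
      show "r z \<noteq> \<infinity>" if "z \<in> D" for z
        using that by (auto simp: D_def r_def e_def ennreal_mult_eq_top_iff)
      fix C assume "C \<in> sets P" and CD: "C \<subseteq> D"
      then have C: "C \<in> sets ?O" by (simp add: P_def)
      let ?F = "R.halted_output n"
      let ?q = "R.halting_prob M Z (\<lambda>\<beta>. u \<beta> x) n"
      let ?q' = "R.halting_prob M' Z' (\<lambda>\<beta>. u \<beta> x') n"
      have F_m: "(\<lambda>\<beta>. indicator C (?F \<beta>) :: ennreal) \<in> borel_measurable ?Pre"
        by (rule measurable_compose[OF R.halted_output_measurable]) (use C in simp)
      have ext: "R.iterates y n (?F \<beta>) = \<beta>" if "\<beta> \<in> space ?Pre" for \<beta>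
        using that by (intro R.iterates_halted_output) (auto simp: space_PiM PiE_def)
      have off: "indicator C z = (0::ennreal)" if "z \<notin> R.halted_space n" for z
        using CD that by (auto simp: D_def indicator_def)
      have space_a: "space a = space ?Pre" "space a' = space ?Pre"
        using a(3,4) by (auto dest: sets_eq_imp_space_eq)
      have "emeasure P C = (\<integral>\<^sup>+z. indicator C z \<partial>P)"
        using C by (simp add: P_def)
      also have "\<dots> = (\<integral>\<^sup>+\<beta>. indicator C (?F \<beta>) * ?q \<beta> \<partial>a)"
        unfolding P_def a_def RAT_def by (rule R.nn_integral_RAT[OF n _ off]) (use C in simp)
      \<comment> \<open>Change from the prefix law of \<open>x\<close> to that of \<open>x'\<close>;
        it is admissible because \<open>C\<close> avoids the outputs with infinite ratio.\<close>
      also have "\<dots> = (\<integral>\<^sup>+\<beta>. g \<beta> * (indicator C (?F \<beta>) * ?q \<beta>) \<partial>a')"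
        unfolding g_def
      proof (rule nn_integral_RN_ratio[OF a(1-3)])
        show "(\<lambda>\<beta>. indicator C (?F \<beta>) * ?q \<beta>) \<in> borel_measurable a"
          using F_m R.halting_law(1)[OF n borel_measurable_const[of 0]]
          by (simp cong: measurable_cong_sets add: a(4))
        fix \<beta> assume "\<beta> \<in> space a" "RN_deriv (sum_measure a a') a \<beta> / RN_deriv (sum_measure a a') a' \<beta> = \<infinity>"
        then have "?F \<beta> \<notin> C"
          using CD ext[of \<beta>] space_a by (auto simp: D_def g_def)
        then show "indicator C (?F \<beta>) * ?q \<beta> = 0" by simp
      qed
      \<comment> \<open>The halting probabilities of the neighbors are compared pointwise, for
        frozen iterates.\<close>
      also have "\<dots> \<le> (\<integral>\<^sup>+\<beta>. (r (?F \<beta>) * indicator C (?F \<beta>)) * ?q' \<beta> \<partial>a')"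
      proof (rule nn_integral_mono)
        fix \<beta> assume "\<beta> \<in> space a'"
        then have \<beta>: "\<beta> \<in> space ?Pre" using space_a by simp
        have "?q \<beta> \<le> e \<beta> * ?q' \<beta>"
          unfolding e_def by (rule R.halting_prob_le[OF R.prob R'.prob R.process R'.process n \<beta> u])
        then have "g \<beta> * (indicator C (?F \<beta>) * ?q \<beta>) \<le> g \<beta> * (indicator C (?F \<beta>) * (e \<beta> * ?q' \<beta>))"
          by (intro mult_left_mono) auto
        also have "\<dots> = (r (?F \<beta>) * indicator C (?F \<beta>)) * ?q' \<beta>"
          using ext[OF \<beta>] by (simp add: r_def mult_ac)
        finally show "g \<beta> * (indicator C (?F \<beta>) * ?q \<beta>) \<le> (r (?F \<beta>) * indicator C (?F \<beta>)) * ?q' \<beta>" .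
      qed
      also have "\<dots> = (\<integral>\<^sup>+z. r z * indicator C z \<partial>P')"
        unfolding P'_def a'_def RAT'_def
        by (rule R'.nn_integral_RAT[OF n, symmetric]) (use C r_m off in auto)
      finally show "emeasure P C \<le> (\<integral>\<^sup>+z. r z * indicator C z \<partial>P')" .
    qed
    then have "AE \<omega> in M. RAT \<omega> \<in> D \<longrightarrow>
        RN_deriv (sum_measure P P') P (RAT \<omega>) / RN_deriv (sum_measure P P') P' (RAT \<omega>) \<le> r (RAT \<omega>)"
      unfolding P_def by (rule AE_distrD[OF RAT_m(1)])
    then show ?thesis
      using AE_space
    proof eventually_elim
      case (elim \<omega>)
      show ?case
      proof
        assume "halting_round (RAT \<omega>) = enat n"
        then have h: "R.halted n \<omega>"
          unfolding RAT_def using R.halting_round_halted by blast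
        let ?b = "restrict (A \<omega>) {1..n}"
        have "?b \<in> extensional {1..n}" by simp
        then have b: "R.iterates y n (RAT \<omega>) = ?b"
          unfolding RAT_def R.RAT_halted[OF h n] by (rule R.iterates_halted_output)
        have eps: "rat_eps E n ?b = E n (restrict (A \<omega>) {1..<n})"
          unfolding R.rat_eps_restrict[OF order_refl] by (simp add: rat_eps_def)
        have rhs: "privacy_loss a a' ?b + ereal (E n (restrict (A \<omega>) {1..<n})) = ennreal_log (g ?b * e ?b)"
          unfolding e_def eps ennreal_log_times_exp by (simp add: privacy_loss_def g_def)
        show "privacy_loss P P' (RAT \<omega>)
          \<le> privacy_loss (prefix_law Y n (Alg x)) (prefix_law Y n (Alg x')) ?b + ereal (E n (restrict (A \<omega>) {1..<n}))"
          unfolding a_def[symmetric] a'_def[symmetric] rhs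
        proof (cases "g ?b = \<infinity>")
          case True
          then have "g ?b * e ?b = \<infinity>" by (simp add: e_def ennreal_top_mult)
          then show "privacy_loss P P' (RAT \<omega>) \<le> ennreal_log (g ?b * e ?b)"
            by (simp add: ennreal_log_def)
        next
          case False
          have "RAT \<omega> \<in> R.halted_space n"
            unfolding RAT_def using R.RAT_halted_space_iff[OF elim(2) n] h by simp
          then have "RAT \<omega> \<in> D"
            using False b measurable_space[OF RAT_m(1) elim(2)] by (simp add: D_def)
          then have "RN_deriv (sum_measure P P') P (RAT \<omega>) / RN_deriv (sum_measure P P') P' (RAT \<omega>) \<le> g ?b * e ?b"
            using elim(1) b by (simp add: r_def)
          then show "privacy_loss P P' (RAT \<omega>) \<le> ennreal_log (g ?b * e ?b)"
            unfolding privacy_loss_def by (rule ennreal_log_mono)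
        qed
      qed
    qed
  qed
  \<comment> \<open>There are countably many rounds, so the exceptional null sets of the single
    rounds may be united.\<close>
  show ?thesis
    unfolding AE_all_countable P_def[symmetric] P'_def[symmetric]
  proof
    fix n
    show "AE \<omega> in M. halting_round (RAT \<omega>) = enat n \<longrightarrow>
      privacy_loss P P' (RAT \<omega>)
      \<le> privacy_loss (prefix_law Y n (Alg x)) (prefix_law Y n (Alg x')) (restrict (A \<omega>) {1..n})
        + ereal (E n (restrict (A \<omega>) {1..<n}))"
    proof (cases "1 \<le> n")
      case True
      then show ?thesis by (rule main)
    next
      case False
      then have "halting_round (RAT \<omega>) \<noteq> enat n" for \<omega>
        unfolding RAT_def using R.halting_round_halted by blast
      then show ?thesis by simp
    qed
  qed
qed

end
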